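(* Let $g$ be a totally positive function of Gaussian type and let $\Lambda\subseteq\mathbb{R}$ be a separated set. Then $\mathcal{G}(g,\Lambda\times\mathbb{Z})$ is a Gabor frame for $L^2(\mathbb{R})$ if and only if $D^-(\Lambda)>1$.
   Context: Fourier transform: $\hat f(\xi)=\int_{\mathbb{R}} f(x)e^{-2\pi i x\xi}\,dx$. A function $g$ on $\mathbb{R}$ is called totally positive of Gaussian type if its Fourier transform factors as $\hat g(\xi)=\prod_{j=1}^n(1+2\pi i\delta_j\xi)^{-1}e^{-c\xi^2}$ for some $n\in\mathbb{N}\cup\{0\}$, $\delta_1,\dots,\delta_n\in\mathbb{R}$ and $c>0$. A set $\Lambda\subseteq\mathbb{R}$ is separated if $\inf\{|\lambda-\mu|:\lambda,\mu\in\Lambda,\lambda\neq\mu\}>0$. Lower Beurling density: $D^-(\Lambda)=\liminf_{R\to\infty}\inf_{x\in\mathbb{R}}\frac{\#(\Lambda\cap[x-R,x+R])}{2R}$. Time-frequency shifts: $M_\xi T_x g(t)=e^{2\pi i\xi t}g(t-x)$. For $\Omega\subseteq\mathbb{R}^2$, $\mathcal{G}(g,\Omega)=\{M_\nu T_\mu g:(\mu,\nu)\in\Omega\}$. It is a (Gabor) frame for $L^2(\mathbb{R})$ if there exist $A,B>0$ such that $A\|f\|_2^2\le\sum_{(\mu,\nu)\in\Omega}|\langle f,M_\nu T_\mu g\rangle|^2\le B\|f\|_2^2$ for all $f\in L^2(\mathbb{R})$. *)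

theory Defs
  imports "HOL-Analysis.Analysis"
begin

definition fourier_transform :: "(real \<Rightarrow> complex) \<Rightarrow> real \<Rightarrow> complex" where
  "fourier_transform f \<xi> =
     (LINT x|lebesgue. f x * exp (- (2 * of_real pi * \<i> * of_real x * of_real \<xi>)))"

text \<open>
  Integrability is what gives the Fourier integral its meaning: without it the Bochner integral
  has the default value 0.  Values of \<open>g\<close> are only constrained almost everywhere; the given Fourier
  transform forces \<open>g\<close> to be real-valued almost everywhere, so complex codomain is no extra
  generality up to null sets.
\<close>
definition totally_positive_gaussian_type :: "(real \<Rightarrow> complex) \<Rightarrow> bool" where
  "totally_positive_gaussian_type g \<longleftrightarrow>
     integrable lebesgue g \<and>
     (\<exists>(n::nat) (\<delta>::nat \<Rightarrow> real) (c::real). c > 0 \<and>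
        (\<forall>\<xi>. fourier_transform g \<xi> =
           (\<Prod>j=1..n. inverse (1 + 2 * of_real pi * \<i> * of_real (\<delta> j) * of_real \<xi>)) *
           of_real (exp (- c * \<xi>\<^sup>2))))"

text \<open>
  The infimum is taken in the extended reals, so that sets with at most one point are separated
  (the infimum of the empty set is \<open>\<infinity>\<close>).
\<close>
definition separated_set :: "real set \<Rightarrow> bool" where
  "separated_set \<Lambda> \<longleftrightarrow>
     Inf {ereal \<bar>l - m\<bar> | l m. l \<in> \<Lambda> \<and> m \<in> \<Lambda> \<and> l \<noteq> m} > 0"

lemma separated_set_iff_uniform_discrete: "separated_set \<Lambda> \<longleftrightarrow> uniform_discrete \<Lambda>"
proof
  assume "separated_set \<Lambda>"
  then obtain e where e: "0 < ereal e"
    "ereal e < Inf {ereal \<bar>l - m\<bar> | l m. l \<in> \<Lambda> \<and> m \<in> \<Lambda> \<and> l \<noteq> m}"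
    unfolding separated_set_def using ereal_dense2 by blast
  have "x = y" if "x \<in> \<Lambda>" "y \<in> \<Lambda>" "dist x y < e" for x y
  proof (rule ccontr)
    assume "x \<noteq> y"
    then have "Inf {ereal \<bar>l - m\<bar> | l m. l \<in> \<Lambda> \<and> m \<in> \<Lambda> \<and> l \<noteq> m} \<le> ereal \<bar>x - y\<bar>"
      using that by (intro Inf_lower) blast
    then have "ereal e < ereal \<bar>x - y\<bar>"
      using e(2) less_le_trans by blast
    then show False
      using that(3) by (simp add: dist_real_def)
  qed
  then show "uniform_discrete \<Lambda>"
    unfolding uniform_discrete_def using e(1) by (intro exI[of _ e]) simp
next
  assume "uniform_discrete \<Lambda>"
  then obtain e where e: "e > 0" "\<And>x y. x \<in> \<Lambda> \<Longrightarrow> y \<in> \<Lambda> \<Longrightarrow> dist x y < e \<Longrightarrow> x = y"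
    unfolding uniform_discrete_def by blast
  have "ereal e \<le> Inf {ereal \<bar>l - m\<bar> | l m. l \<in> \<Lambda> \<and> m \<in> \<Lambda> \<and> l \<noteq> m}"
  proof (rule Inf_greatest)
    fix z assume "z \<in> {ereal \<bar>l - m\<bar> | l m. l \<in> \<Lambda> \<and> m \<in> \<Lambda> \<and> l \<noteq> m}"
    then obtain l m where "z = ereal \<bar>l - m\<bar>" "l \<in> \<Lambda>" "m \<in> \<Lambda>" "l \<noteq> m"
      by blast
    with e(2)[of l m] show "ereal e \<le> z"
      by (cases "\<bar>l - m\<bar> < e") (simp_all add: dist_real_def)
  qed
  then show "separated_set \<Lambda>"
    unfolding separated_set_def using e(1) less_le_trans[of 0 "ereal e"] by simp
qed

text \<open>
  Points are counted with the counting measure, which, unlike \<open>card\<close>, is \<open>\<infinity>\<close> on infinite sets.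
\<close>
definition lower_beurling_density :: "real set \<Rightarrow> ennreal" where
  "lower_beurling_density \<Lambda> =
     Liminf at_top (\<lambda>R::real. INF x::real.
       emeasure (count_space UNIV) (\<Lambda> \<inter> {x - R..x + R}) / ennreal (2 * R))"

definition translation :: "real \<Rightarrow> (real \<Rightarrow> complex) \<Rightarrow> real \<Rightarrow> complex" where
  "translation x f = (\<lambda>t. f (t - x))"

definition modulation :: "real \<Rightarrow> (real \<Rightarrow> complex) \<Rightarrow> real \<Rightarrow> complex" where
  "modulation \<xi> f = (\<lambda>t. exp (2 * of_real pi * \<i> * of_real \<xi> * of_real t) * f t)"

text \<open>Functions rather than classes modulo null sets; everything below respects a.e. equality.\<close>
definition L2 :: "(real \<Rightarrow> complex) set" where
  "L2 = {f. f \<in> borel_measurable lebesgue \<and> integrable lebesgue (\<lambda>x. (cmod (f x))\<^sup>2)}"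

definition L2_norm :: "(real \<Rightarrow> complex) \<Rightarrow> real" where
  "L2_norm f = sqrt (LINT x|lebesgue. (cmod (f x))\<^sup>2)"

definition L2_inner :: "(real \<Rightarrow> complex) \<Rightarrow> (real \<Rightarrow> complex) \<Rightarrow> complex" where
  "L2_inner f h = (LINT x|lebesgue. f x * cnj (h x))"

text \<open>
  The sum over \<open>\<Omega>\<close> is taken in \<open>[0, \<infinity>]\<close>, so the upper bound includes its convergence.
  The condition \<open>g \<in> L2\<close> says that the members of the system are vectors of the Hilbert space.
\<close>
definition gabor_frame :: "(real \<Rightarrow> complex) \<Rightarrow> (real \<times> real) set \<Rightarrow> bool" where
  "gabor_frame g \<Omega> \<longleftrightarrow>
     g \<in> L2 \<and>
     (\<exists>A B::real. A > 0 \<and> B > 0 \<and>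
        (\<forall>f\<in>L2.
           ennreal (A * (L2_norm f)\<^sup>2)
             \<le> (\<Sum>\<^sub>\<infinity>(\<mu>, \<nu>)\<in>\<Omega>. ennreal ((cmod (L2_inner f (modulation \<nu> (translation \<mu> g))))\<^sup>2)) \<and>
           (\<Sum>\<^sub>\<infinity>(\<mu>, \<nu>)\<in>\<Omega>. ennreal ((cmod (L2_inner f (modulation \<nu> (translation \<mu> g))))\<^sup>2))
             \<le> ennreal (B * (L2_norm f)\<^sup>2)))"

end

theory Submission
  imports Defs "HOL-Complex_Analysis.Complex_Analysis" "HOL-Probability.Probability" "HOL-Real_Asymp.Real_Asymp"
begin

text \<open>
  The Fourier transform determines \<open>g\<close> almost everywhere: it is a Gaussian to which the averages
  \<open>G \<mapsto> (x \<mapsto> \<integral>\<^sub>0\<^sup>\<infinity> e\<^bsup>-s\<^esup> G (x - \<delta> s) ds)\<close>, the inverses of \<open>1 + \<delta> d/dx\<close>, have been applied.  By periodization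
  and Parseval's identity, the frame inequalities for \<open>\<G>(g, \<Lambda> \<times> \<int>)\<close> become \<open>\<ell>\<^sup>2\<close> sampling inequalities for
  \<open>\<Sum> c\<^sub>k g (t + k)\<close> on \<open>t - \<Lambda>\<close>, uniformly in \<open>t\<close>; the upper one is Schur's test.

  If the density exceeds 1 and the lower inequality fails, an averaging argument and compactness produce a
  nonzero combination \<open>F = \<Sum> d\<^sub>k g (\<cdot> + k)\<close> with coefficients of small exponential growth that vanishes on a set of
  density above 1.  Since \<open>g\<close> comes from the Gaussian by inverting \<open>1 + \<delta> d/dx\<close>, Rolle's theorem interlaces
  zeros of \<open>F\<close> with zeros of the same combination of Gaussians, so the latter has zeros of density above 1
  too.  After multiplication by \<open>e\<^bsup>c x\<^sup>2\<^esup>\<close> it is a Laurent series in \<open>e\<^bsup>-2 c x\<^esup>\<close>, and dividing out the zeros in a large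
  annulus contradicts the maximum modulus principle.

  Conversely, the sampling inequality, being uniform in \<open>t\<close>, survives replacing the integers \<open>k\<close> by the denser
  points \<open>\<theta> k\<close> with \<open>\<theta> < 1\<close> close to 1, because \<open>\<theta> k\<close> looks locally like a shift of the integers.
  Counting dimensions in long intervals then gives density at least \<open>1 / \<theta> > 1\<close>.
\<close>

section \<open>Sums over separated families\<close>

text \<open>Sequences that nearly violate the sampling inequality may spread out, so a plain weak
  limit could be zero. Weighting by \<open>exp (- a \<bar>k - m\<bar>)\<close> around a good centre
  \<open>m\<close> keeps the normalised central coefficient equal to 1; the price is a limit that is
  no longer known to be square summable, only to grow at rate at most \<open>a / 2\<close>. The
  kernel decays at rate \<open>a\<close>, and in the Laurent series Gaussian coefficients swallow
  any exponential growth. The centre is uncontrolled, hence uniformity in the translation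
  \<open>t\<close>.

  Each average costs one zero per interval, whatever its length. Intervals are taken so long that
  the surplus of points outweighs the \<open>length ds\<close> lost zeros; separation keeps zeros
  distinct in the limit.

  In the converse, the points \<theta> k and a shift of the integers agree only near one index. A
  slowly decaying weight localises there, the Lipschitz bound on the kernel pays for the mismatch,
  and summing over all centres restores the global norm. The rate of the weight is fixed before
  \<theta>: its own error is relative to the total weight, while the mismatch grows as the weight
  gets wider.\<close>

lemma nn_integral_exp_int:
  assumes "a > 0"
  shows "(\<integral>\<^sup>+(n::int). ennreal (exp (- a * \<bar>real_of_int n\<bar>)) \<partial>count_space UNIV) \<le> ennreal (2 / (1 - exp (- a)))"
proof -
  let ?f = "\<lambda>n::int. ennreal (exp (- a * \<bar>real_of_int n\<bar>))"
  have sums: "(\<lambda>n. exp (- a * real n)) sums (1 / (1 - exp (- a)))"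
    using geometric_sums[of "exp (- a)"] assms by (simp add: exp_of_nat_mult[symmetric] mult.commute)
  have geo: "(\<integral>\<^sup>+(n::nat). ennreal (exp (- a * real n)) \<partial>count_space UNIV) = ennreal (1 / (1 - exp (- a)))"
    unfolding nn_integral_count_space_nat using sums
    by (subst suminf_ennreal2) (auto simp: sums_iff)
  have img: "(\<integral>\<^sup>+n. ?f n \<partial>count_space (range h)) = ennreal (1 / (1 - exp (- a)))"
    if "inj h" "\<And>m. \<bar>h m\<bar> = int m" for h :: "nat \<Rightarrow> int"
  proof -
    have "bij_betw h UNIV (range h)"
      using that(1) by (simp add: bij_betw_def)
    then have "(\<integral>\<^sup>+n. ?f n \<partial>count_space (range h)) = (\<integral>\<^sup>+m. ?f (h m) \<partial>count_space UNIV)"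
      by (rule nn_integral_bij_count_space[symmetric])
    also have "\<dots> = (\<integral>\<^sup>+m. ennreal (exp (- a * real m)) \<partial>count_space UNIV)"
      by (intro nn_integral_cong) (metis of_int_abs of_int_of_nat_eq that(2))
    finally show ?thesis using geo by simp
  qed
  have "(\<integral>\<^sup>+n. ?f n \<partial>count_space UNIV) \<le>
      (\<integral>\<^sup>+n. ?f n * indicator (range int) n + ?f n * indicator (range (\<lambda>m. - int m)) n \<partial>count_space UNIV)"
  proof (rule nn_integral_mono)
    fix n :: int
    have "n \<in> range int \<or> n \<in> range (\<lambda>m. - int m)"
      by (cases n rule: int_cases2) auto
    then show "?f n \<le> ?f n * indicator (range int) n + ?f n * indicator (range (\<lambda>m. - int m)) n"
      by (auto simp: indicator_def)
  qed
  also have "\<dots> = (\<integral>\<^sup>+n. ?f n \<partial>count_space (range int)) + (\<integral>\<^sup>+n. ?f n \<partial>count_space (range (\<lambda>m. - int m)))"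
    by (subst nn_integral_add) (auto simp: nn_integral_count_space_indicator)
  also have "\<dots> = ennreal (1 / (1 - exp (- a))) + ennreal (1 / (1 - exp (- a)))"
    by (subst (1 2) img) (auto simp: inj_on_def)
  also have "\<dots> = ennreal (2 / (1 - exp (- a)))"
    using assms by (subst ennreal_plus[symmetric]) (auto simp: field_simps)
  finally show ?thesis .
qed

text \<open>Bounds the sum of \<open>exp (- a \<bar>x - p\<bar>)\<close> over any
  \<open>d\<close>-separated family of points \<open>p\<close>, uniformly in \<open>x\<close>: a
  geometric series over all integers at rate \<open>a d\<close>, times \<open>exp (a * d)\<close>
  for rounding the points to a grid of mesh \<open>d\<close>.\<close>

definition sep_const :: "real \<Rightarrow> real \<Rightarrow> real" where
  "sep_const a d = exp (a * d) * (2 / (1 - exp (- (a * d))))"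

lemma sep_const_pos: "a > 0 \<Longrightarrow> d > 0 \<Longrightarrow> sep_const a d > 0"
  unfolding sep_const_def by simp

lemma nn_integral_count_space_inj_le:
  assumes "inj_on h I"
  shows "(\<integral>\<^sup>+i. f (h i) \<partial>count_space I) \<le> (\<integral>\<^sup>+j. f j \<partial>count_space UNIV)"
proof -
  have "(\<integral>\<^sup>+i. f (h i) \<partial>count_space I) = (\<integral>\<^sup>+j. f j \<partial>count_space (h ` I))"
    using assms by (intro nn_integral_bij_count_space) (simp add: bij_betw_def)
  also have "\<dots> \<le> (\<integral>\<^sup>+j. f j \<partial>count_space UNIV)"
  proof (cases "h ` I = UNIV")
    case False
    have "f x * indicator (h ` I) x \<le> f x" for x
      by (cases "x \<in> h ` I") simp_all
    then show ?thesis
      by (subst nn_integral_count_space_indicator) (auto intro!: nn_integral_mono)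
  qed simp
  finally show ?thesis .
qed

text \<open>Points at distance at least \<open>d\<close> fall into different cells of length
  \<open>d\<close>, so the cell index \<open>h\<close> is injective and the sum is dominated by the
  one over all integers. The indexed form covers \<Lambda>, shifted integers and the multiples
  \<open>\<theta> k\<close> alike.\<close>

lemma separated_exp_sum:
  fixes p :: "'i \<Rightarrow> real"
  assumes "a > 0" "d > 0" and sep: "\<And>i j. i \<in> I \<Longrightarrow> j \<in> I \<Longrightarrow> i \<noteq> j \<Longrightarrow> d \<le> \<bar>p i - p j\<bar>"
  shows "(\<integral>\<^sup>+i. ennreal (exp (- a * \<bar>x - p i\<bar>)) \<partial>count_space I) \<le> ennreal (sep_const a d)"
proof -
  define h where "h i = \<lfloor>(p i - x) / d\<rfloor>" for i
  have fl: "real_of_int (h i) * d \<le> p i - x" "p i - x < (real_of_int (h i) + 1) * d" for i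
    unfolding h_def using floor_divide_lower[OF \<open>d > 0\<close>, of "p i - x"] floor_divide_upper[OF \<open>d > 0\<close>, of "p i - x"]
    by (auto simp: algebra_simps)
  have "inj_on h I"
  proof (rule inj_onI, rule ccontr)
    fix i j assume *: "i \<in> I" "j \<in> I" "h i = h j" "i \<noteq> j"
    have "\<bar>p i - p j\<bar> < d"
      using fl[of i] fl[of j] *(3) by (auto simp: algebra_simps abs_if)
    then show False using sep[OF *(1,2,4)] by simp
  qed
  have pt: "exp (- a * \<bar>x - p i\<bar>) \<le> exp (a * d) * exp (- (a * d) * \<bar>real_of_int (h i)\<bar>)" for i
  proof -
    have "d * \<bar>real_of_int (h i)\<bar> \<le> d + \<bar>x - p i\<bar>"
      using fl[of i] \<open>d > 0\<close> by (cases "h i \<ge> 0") (auto simp: algebra_simps abs_if)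
    then have "a * (d * \<bar>real_of_int (h i)\<bar>) \<le> a * (d + \<bar>x - p i\<bar>)"
      using \<open>a > 0\<close> by (intro mult_left_mono) auto
    then show ?thesis by (simp add: exp_add[symmetric] algebra_simps)
  qed
  have "(\<integral>\<^sup>+i. ennreal (exp (- a * \<bar>x - p i\<bar>)) \<partial>count_space I)
     \<le> (\<integral>\<^sup>+i. ennreal (exp (a * d)) * ennreal (exp (- (a * d) * \<bar>real_of_int (h i)\<bar>)) \<partial>count_space I)"
    using pt by (intro nn_integral_mono) (simp add: ennreal_mult[symmetric] ennreal_leI)
  also have "\<dots> = ennreal (exp (a * d)) * (\<integral>\<^sup>+i. ennreal (exp (- (a * d) * \<bar>real_of_int (h i)\<bar>)) \<partial>count_space I)"
    by (rule nn_integral_cmult) simp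
  also have "\<dots> \<le> ennreal (exp (a * d)) * (\<integral>\<^sup>+(n::int). ennreal (exp (- (a * d) * \<bar>real_of_int n\<bar>)) \<partial>count_space UNIV)"
    by (intro mult_left_mono nn_integral_count_space_inj_le[OF \<open>inj_on h I\<close>]) simp
  also have "\<dots> \<le> ennreal (exp (a * d)) * ennreal (2 / (1 - exp (- (a * d))))"
    using assms by (intro mult_left_mono nn_integral_exp_int) auto
  also have "\<dots> = ennreal (sep_const a d)"
    using assms unfolding sep_const_def by (subst ennreal_mult) auto
  finally show ?thesis .
qed

lemma norm_integral_le_nn_integral:
  fixes f :: "'a \<Rightarrow> 'b::{banach, second_countable_topology}"
  shows "ennreal (norm (integral\<^sup>L M f)) \<le> (\<integral>\<^sup>+x. ennreal (norm (f x)) \<partial>M)"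
  by (cases "integrable M f") (auto simp: not_integrable_integral_eq intro: integral_norm_bound_ennreal)

text \<open>Splitting \<open>a c\<close> as \<open>sqrt a\<close> times \<open>sqrt a c\<close>,
  Cauchy-Schwarz in \<open>j\<close> spends the row bound and Tonelli in \<open>i\<close> the column
  bound. With values in \<open>[0, \<infinity>]\<close> no convergence question arises.\<close>

lemma schur_test:
  fixes a :: "'i \<Rightarrow> 'j \<Rightarrow> real" and c :: "'j \<Rightarrow> real"
  assumes "countable I" "countable J"
    and nonneg: "\<And>i j. a i j \<ge> 0" "\<And>j. c j \<ge> 0"
    and row: "\<And>i. i \<in> I \<Longrightarrow> (\<integral>\<^sup>+j. ennreal (a i j) \<partial>count_space J) \<le> ennreal K"
    and col: "\<And>j. j \<in> J \<Longrightarrow> (\<integral>\<^sup>+i. ennreal (a i j) \<partial>count_space I) \<le> ennreal K'"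
  shows "(\<integral>\<^sup>+i. (\<integral>\<^sup>+j. ennreal (a i j * c j) \<partial>count_space J)\<^sup>2 \<partial>count_space I)
     \<le> ennreal K * ennreal K' * (\<integral>\<^sup>+j. ennreal ((c j)\<^sup>2) \<partial>count_space J)"
proof -
  have "(\<integral>\<^sup>+i. (\<integral>\<^sup>+j. ennreal (a i j * c j) \<partial>count_space J)\<^sup>2 \<partial>count_space I)
      \<le> (\<integral>\<^sup>+i. ennreal K * (\<integral>\<^sup>+j. ennreal (a i j * (c j)\<^sup>2) \<partial>count_space J) \<partial>count_space I)"
  proof (rule nn_integral_mono)
    fix i assume "i \<in> space (count_space I)"
    then have i: "i \<in> I" by simp
    have "(\<integral>\<^sup>+j. ennreal (a i j * c j) \<partial>count_space J)\<^sup>2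
       = (\<integral>\<^sup>+j. ennreal (sqrt (a i j)) * ennreal (sqrt (a i j) * c j) \<partial>count_space J)\<^sup>2"
      using nonneg by (simp add: ennreal_mult[symmetric] mult.assoc[symmetric])
    also have "\<dots> \<le> (\<integral>\<^sup>+j. (ennreal (sqrt (a i j)))\<^sup>2 \<partial>count_space J) * (\<integral>\<^sup>+j. (ennreal (sqrt (a i j) * c j))\<^sup>2 \<partial>count_space J)"
      by (rule Cauchy_Schwarz_nn_integral) auto
    also have "\<dots> = (\<integral>\<^sup>+j. ennreal (a i j) \<partial>count_space J) * (\<integral>\<^sup>+j. ennreal (a i j * (c j)\<^sup>2) \<partial>count_space J)"
      using nonneg by (simp add: ennreal_power power_mult_distrib)
    also have "\<dots> \<le> ennreal K * (\<integral>\<^sup>+j. ennreal (a i j * (c j)\<^sup>2) \<partial>count_space J)"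
      by (intro mult_right_mono row i) auto
    finally show "(\<integral>\<^sup>+j. ennreal (a i j * c j) \<partial>count_space J)\<^sup>2
        \<le> ennreal K * (\<integral>\<^sup>+j. ennreal (a i j * (c j)\<^sup>2) \<partial>count_space J)" .
  qed
  also have "\<dots> = ennreal K * (\<integral>\<^sup>+i. (\<integral>\<^sup>+j. ennreal (a i j * (c j)\<^sup>2) \<partial>count_space J) \<partial>count_space I)"
    by (rule nn_integral_cmult) simp
  also have "(\<integral>\<^sup>+i. (\<integral>\<^sup>+j. ennreal (a i j * (c j)\<^sup>2) \<partial>count_space J) \<partial>count_space I)
      = (\<integral>\<^sup>+j. (\<integral>\<^sup>+i. ennreal (a i j * (c j)\<^sup>2) \<partial>count_space I) \<partial>count_space J)"
    by (rule nn_integral_count_space_nn_integral) (use assms in auto)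
  also have "\<dots> \<le> (\<integral>\<^sup>+j. ennreal K' * ennreal ((c j)\<^sup>2) \<partial>count_space J)"
  proof (rule nn_integral_mono)
    fix j assume "j \<in> space (count_space J)"
    then have j: "j \<in> J" by simp
    have "(\<integral>\<^sup>+i. ennreal (a i j * (c j)\<^sup>2) \<partial>count_space I) = (\<integral>\<^sup>+i. ennreal (a i j) \<partial>count_space I) * ennreal ((c j)\<^sup>2)"
      using nonneg by (subst nn_integral_multc[symmetric]) (auto simp: ennreal_mult)
    also have "\<dots> \<le> ennreal K' * ennreal ((c j)\<^sup>2)"
      by (intro mult_right_mono col j) auto
    finally show "(\<integral>\<^sup>+i. ennreal (a i j * (c j)\<^sup>2) \<partial>count_space I) \<le> ennreal K' * ennreal ((c j)\<^sup>2)" .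
  qed
  also have "\<dots> = ennreal K' * (\<integral>\<^sup>+j. ennreal ((c j)\<^sup>2) \<partial>count_space J)"
    by (rule nn_integral_cmult) simp
  finally show ?thesis
    by (simp add: mult.assoc mult_left_mono)
qed

text \<open>The Lipschitz clause carries decay as well, from both endpoints, so that differences of
  shifted kernels still form a matrix accessible to Schur's test. Both clauses survive
  \<open>exp_smooth\<close> at the same rate \<open>a\<close>.\<close>

definition exp_decay :: "real \<Rightarrow> real \<Rightarrow> (real \<Rightarrow> real) \<Rightarrow> bool" where
  "exp_decay a C G \<longleftrightarrow> a > 0 \<and> C > 0 \<and> (\<forall>x. \<bar>G x\<bar> \<le> C * exp (- a * \<bar>x\<bar>)) \<and>
     (\<forall>x y. \<bar>G x - G y\<bar> \<le> C * \<bar>x - y\<bar> * (exp (- a * \<bar>x\<bar>) + exp (- a * \<bar>y\<bar>)))"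

lemma exp_decay_continuous:
  assumes "exp_decay a C G"
  shows "continuous_on UNIV G"
proof -
  have "\<bar>G x - G y\<bar> \<le> (2 * C) * \<bar>x - y\<bar>" for x y
  proof -
    have "\<bar>G x - G y\<bar> \<le> C * \<bar>x - y\<bar> * (exp (- a * \<bar>x\<bar>) + exp (- a * \<bar>y\<bar>))"
      using assms by (simp add: exp_decay_def)
    also have "\<dots> \<le> C * \<bar>x - y\<bar> * (1 + 1)"
      using assms by (intro mult_left_mono add_mono) (auto simp: exp_decay_def)
    finally show ?thesis by simp
  qed
  then have "(2 * C)-lipschitz_on UNIV G"
    using assms by (intro lipschitz_onI) (auto simp: dist_real_def exp_decay_def)
  then show ?thesis
    by (rule lipschitz_on_continuous_on)
qed

section \<open>Laurent series with Gaussian coefficients\<close>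

text \<open>Completing the square with slope \<open>\<bar>b\<bar> + 1\<close> instead of
  \<open>\<bar>b\<bar>\<close>: the extra unit of slope leaves the factor
  \<open>exp (- \<bar>u\<bar>)\<close>, which makes the bound summable over the integers.\<close>

lemma exp_linear_minus_square_le:
  fixes b c u :: real
  assumes "c > 0"
  shows "exp (b * u - c * u\<^sup>2) \<le> exp ((\<bar>b\<bar> + 1)\<^sup>2 / (4 * c)) * exp (- \<bar>u\<bar>)"
proof -
  have "0 \<le> (2 * c * \<bar>u\<bar> - (\<bar>b\<bar> + 1))\<^sup>2" by simp
  then have "4 * c * ((\<bar>b\<bar> + 1) * \<bar>u\<bar>) \<le> (\<bar>b\<bar> + 1)\<^sup>2 + 4 * c * (c * u\<^sup>2)"
    by (simp add: power2_diff power_mult_distrib) (simp add: power2_eq_square algebra_simps)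
  then have "(\<bar>b\<bar> + 1) * \<bar>u\<bar> \<le> (\<bar>b\<bar> + 1)\<^sup>2 / (4 * c) + c * u\<^sup>2"
    using assms by (simp add: field_simps)
  moreover have "b * u \<le> \<bar>b\<bar> * \<bar>u\<bar>"
    by (metis abs_ge_self abs_mult)
  ultimately have "b * u - c * u\<^sup>2 \<le> (\<bar>b\<bar> + 1)\<^sup>2 / (4 * c) - \<bar>u\<bar>"
    by (simp add: algebra_simps)
  then show ?thesis by (simp add: exp_add[symmetric])
qed

text \<open>The negative indices are enumerated as \<open>- int n - 1\<close>, so that 0 is counted
  only on the nonnegative side. A sum against counting measure thus becomes two ordinary series, the
  form in which power series are treated.\<close>

lemma integral_count_space_int:
  fixes f :: "int \<Rightarrow> 'b::{banach, second_countable_topology}"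
  assumes "integrable (count_space UNIV) f"
  shows "(\<lambda>n. f (int n)) sums (LINT k|count_space (range int). f k)"
    and "(\<lambda>n. f (- int n - 1)) sums (LINT k|count_space (range (\<lambda>n. - int n - 1)). f k)"
    and "integral\<^sup>L (count_space UNIV) f = (\<Sum>n. f (int n)) + (\<Sum>n. f (- int n - 1))"
proof -
  let ?P = "range int" and ?N = "range (\<lambda>n. - int n - 1)"
  have s: "Infinite_Set_Sum.abs_summable_on f UNIV" "Infinite_Set_Sum.abs_summable_on f ?P"
    "Infinite_Set_Sum.abs_summable_on f ?N"
    using assms by (auto simp: Infinite_Set_Sum.abs_summable_on_def[symmetric] intro: Infinite_Set_Sum.abs_summable_on_subset)
  have bij: "bij_betw int UNIV ?P" "bij_betw (\<lambda>n. - int n - 1) UNIV ?N"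
    by (auto simp: bij_betw_def inj_on_def)
  have "Infinite_Set_Sum.abs_summable_on (\<lambda>n. f (int n)) UNIV"
    "Infinite_Set_Sum.abs_summable_on (\<lambda>n. f (- int n - 1)) UNIV"
    using s(2,3) Infinite_Set_Sum.abs_summable_on_reindex_bij_betw[OF bij(1), of f] Infinite_Set_Sum.abs_summable_on_reindex_bij_betw[OF bij(2), of f]
    by auto
  note sums = this[THEN sums_infsetsum_nat']
  show 1: "(\<lambda>n. f (int n)) sums (LINT k|count_space ?P. f k)"
    using sums(1) unfolding infsetsum_reindex_bij_betw[OF bij(1), of f] by (simp add: infsetsum_def)
  show 2: "(\<lambda>n. f (- int n - 1)) sums (LINT k|count_space ?N. f k)"
    using sums(2) unfolding infsetsum_reindex_bij_betw[OF bij(2), of f] by (simp add: infsetsum_def)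
  have "UNIV = ?P \<union> ?N"
  proof -
    have "k \<in> ?P \<union> ?N" for k
      by (cases k rule: int_cases) auto
    then show ?thesis by blast
  qed
  moreover have "infsetsum f (?P \<union> ?N) = infsetsum f ?P + infsetsum f ?N"
    by (rule infsetsum_Un_disjoint) (use s in auto)
  ultimately show "integral\<^sup>L (count_space UNIV) f = (\<Sum>n. f (int n)) + (\<Sum>n. f (- int n - 1))"
    using 1 2 by (simp add: infsetsum_def sums_iff)
qed

lemma entire_power_series:
  fixes a :: "nat \<Rightarrow> complex"
  assumes "\<And>z. summable (\<lambda>n. a n * z ^ n)"
  shows "(\<lambda>z. \<Sum>n. a n * z ^ n) holomorphic_on UNIV"
proof -
  have "(\<lambda>z. \<Sum>n. a n * z ^ n) holomorphic_on ball 0 r" for r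
    using assms by (intro power_series_holomorphic[where a = a]) (simp add: summable_sums)
  then have "(\<lambda>z. \<Sum>n. a n * z ^ n) holomorphic_on (\<Union>r. ball 0 r)"
    by (subst holomorphic_on_UN_open) auto
  moreover have "(\<Union>r. ball 0 r) = (UNIV :: complex set)"
    by (auto intro: lt_ex gt_ex)
  ultimately show ?thesis by simp
qed

text \<open>The coefficients will be \<open>d k exp (- c k^2)\<close> with \<open>d\<close> of
  exponential growth \<open>b\<close>; their Gaussian decay makes the two-sided series converge on
  the whole punctured plane.\<close>

locale gaussian_laurent =
  fixes a :: "int \<Rightarrow> complex" and c C b :: real
  assumes c_pos: "c > 0" and b_nonneg: "b \<ge> 0"
    and a_le: "\<And>k. norm (a k) \<le> C * exp (b * \<bar>real_of_int k\<bar> - c * (real_of_int k)\<^sup>2)"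
begin

definition laurent :: "complex \<Rightarrow> complex" where
  "laurent z = (LINT k|count_space UNIV. a k * z powi k)"

definition bnd :: real where
  "bnd = C * (exp ((b + 1)\<^sup>2 / (4 * c)) * sep_const 1 1)"

lemma C_nonneg: "C \<ge> 0"
  using a_le[of 0] order.trans[OF norm_ge_zero] by fastforce

lemma bnd_nonneg: "bnd \<ge> 0"
  unfolding bnd_def using C_nonneg sep_const_pos[of 1 1] by simp

text \<open>With the radius written as \<open>exp (2 * c * y)\<close>, the exponent
  \<open>2 c y k - c k^2\<close> equals \<open>c y^2 - c (k - y)^2\<close>: the terms peak at
  \<open>k\<close> near \<open>y\<close>, and what remains is a convergent sum around
  \<open>y\<close>. The growth \<open>exp (c y^2)\<close> is the quantity against which zeros will
  be counted.\<close>

lemma nn_bound: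
  assumes "norm z = exp (2 * c * y)"
  shows "(\<integral>\<^sup>+k. ennreal (norm (a k * z powi k)) \<partial>count_space UNIV) \<le> ennreal (bnd * exp (c * y\<^sup>2 + b * \<bar>y\<bar>))"
proof -
  let ?D = "C * exp (c * y\<^sup>2 + b * \<bar>y\<bar>) * exp ((b + 1)\<^sup>2 / (4 * c))"
  have D: "?D \<ge> 0" using C_nonneg by simp
  have "norm (a k * z powi k) \<le> ?D * exp (- 1 * \<bar>y - real_of_int k\<bar>)" for k
  proof -
    let ?k = "real_of_int k"
    have zk: "norm (z powi k) = exp (2 * c * y * ?k)"
      by (simp add: norm_power_int assms exp_power_int mult.commute)
    have "norm (a k * z powi k) \<le> C * exp (b * \<bar>?k\<bar> - c * ?k\<^sup>2) * exp (2 * c * y * ?k)"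
      by (simp add: norm_mult zk a_le)
    also have "\<dots> = C * exp (c * y\<^sup>2) * exp (b * \<bar>?k\<bar> - c * \<bar>?k - y\<bar>\<^sup>2)"
      by (simp add: mult.assoc exp_add[symmetric] power2_diff algebra_simps)
    also have "b * \<bar>?k\<bar> \<le> b * \<bar>y\<bar> + b * \<bar>?k - y\<bar>"
      using b_nonneg by (simp add: distrib_left[symmetric] mult_left_mono)
    then have "C * exp (c * y\<^sup>2) * exp (b * \<bar>?k\<bar> - c * \<bar>?k - y\<bar>\<^sup>2)
        \<le> C * exp (c * y\<^sup>2) * exp (b * \<bar>y\<bar> + (b * \<bar>?k - y\<bar> - c * \<bar>?k - y\<bar>\<^sup>2))"
      using C_nonneg by (intro mult_left_mono) auto
    also have "\<dots> = C * exp (c * y\<^sup>2 + b * \<bar>y\<bar>) * exp (b * \<bar>?k - y\<bar> - c * \<bar>?k - y\<bar>\<^sup>2)"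
      by (simp add: mult.assoc exp_add[symmetric] algebra_simps)
    also have "\<dots> \<le> C * exp (c * y\<^sup>2 + b * \<bar>y\<bar>) * (exp ((b + 1)\<^sup>2 / (4 * c)) * exp (- \<bar>\<bar>?k - y\<bar>\<bar>))"
      using C_nonneg b_nonneg c_pos exp_linear_minus_square_le[OF c_pos, of b "\<bar>?k - y\<bar>"]
      by (intro mult_left_mono) auto
    finally show ?thesis by (simp add: mult.assoc abs_minus_commute)
  qed
  then have "(\<integral>\<^sup>+k. ennreal (norm (a k * z powi k)) \<partial>count_space UNIV)
      \<le> (\<integral>\<^sup>+(k::int). ennreal ?D * ennreal (exp (- 1 * \<bar>y - real_of_int k\<bar>)) \<partial>count_space UNIV)"
    using D by (intro nn_integral_mono) (simp add: ennreal_mult[symmetric] ennreal_leI)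
  also have "\<dots> = ennreal ?D * (\<integral>\<^sup>+(k::int). ennreal (exp (- 1 * \<bar>y - real_of_int k\<bar>)) \<partial>count_space UNIV)"
    by (rule nn_integral_cmult) simp
  also have "\<dots> \<le> ennreal ?D * ennreal (sep_const 1 1)"
    by (intro mult_left_mono separated_exp_sum) auto
  also have "\<dots> = ennreal (bnd * exp (c * y\<^sup>2 + b * \<bar>y\<bar>))"
    using D sep_const_pos[of 1 1] by (simp add: ennreal_mult[symmetric] bnd_def mult_ac)
  finally show ?thesis .
qed

lemma integrable_terms:
  assumes "z \<noteq> 0"
  shows "integrable (count_space UNIV) (\<lambda>k. a k * z powi k)"
proof (rule integrableI_bounded)
  have "norm z = exp (2 * c * (ln (norm z) / (2 * c)))"
    using assms c_pos by simp
  from nn_bound[OF this] show "(\<integral>\<^sup>+k. ennreal (norm (a k * z powi k)) \<partial>count_space UNIV) < \<infinity>"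
    by (rule le_less_trans) simp
qed simp

lemma norm_laurent_le:
  assumes "norm z = exp (2 * c * y)"
  shows "norm (laurent z) \<le> bnd * exp (c * y\<^sup>2 + b * \<bar>y\<bar>)"
proof -
  have "ennreal (norm (laurent z)) \<le> ennreal (bnd * exp (c * y\<^sup>2 + b * \<bar>y\<bar>))"
    unfolding laurent_def using norm_integral_le_nn_integral nn_bound[OF assms] by (rule order.trans)
  then show ?thesis using bnd_nonneg by (subst (asm) ennreal_le_iff) auto
qed

definition fpos :: "complex \<Rightarrow> complex" where "fpos z = (\<Sum>n. a (int n) * z ^ n)"
definition fneg :: "complex \<Rightarrow> complex" where "fneg z = (\<Sum>n. a (- int n - 1) * z ^ n)"

lemma powi_neg: "z \<noteq> 0 \<Longrightarrow> z powi (- int n - 1) = (1 / z) ^ n * (1 / z)" for z :: complex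
  by (simp add: power_int_diff power_int_minus power_int_of_nat field_simps)

lemma summable_parts:
  "summable (\<lambda>n. a (int n) * z ^ n)" "summable (\<lambda>n. a (- int n - 1) * z ^ n)"
proof -
  show "summable (\<lambda>n. a (int n) * z ^ n)"
  proof (cases "z = 0")
    case False
    from integral_count_space_int(1)[OF integrable_terms[OF False]]
    show ?thesis by (simp add: sums_iff)
  qed auto
  show "summable (\<lambda>n. a (- int n - 1) * z ^ n)"
  proof (cases "z = 0")
    case False
    then have "1 / z \<noteq> 0" by simp
    from integral_count_space_int(2)[OF integrable_terms[OF this]]
    have "summable (\<lambda>n. a (- int n - 1) * (z ^ n * z))"
      using powi_neg[OF \<open>1 / z \<noteq> 0\<close>] by (simp add: sums_iff)
    from summable_mult2[OF this, of "1 / z"] False show ?thesis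
      by (simp add: mult.assoc)
  qed auto
qed

lemma holomorphic_parts: "fpos holomorphic_on UNIV" "fneg holomorphic_on UNIV"
  unfolding fpos_def[abs_def] fneg_def[abs_def] by (intro entire_power_series summable_parts)+

lemma laurent_eq:
  assumes "z \<noteq> 0"
  shows "laurent z = fpos z + fneg (1 / z) * (1 / z)"
proof -
  have "laurent z = (\<Sum>n. a (int n) * z ^ n) + (\<Sum>n. a (- int n - 1) * (1 / z) ^ n * (1 / z))"
    unfolding laurent_def integral_count_space_int(3)[OF integrable_terms[OF assms]]
    by (simp only: powi_neg[OF assms] power_int_of_nat mult.assoc)
  also have "(\<Sum>n. a (- int n - 1) * (1 / z) ^ n * (1 / z)) = fneg (1 / z) * (1 / z)"
    unfolding fneg_def by (rule suminf_mult2[symmetric]) (rule summable_parts)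
  finally show ?thesis by (simp add: fpos_def)
qed

lemma holomorphic_laurent: "laurent holomorphic_on - {0}"
proof -
  have "(\<lambda>z. fpos z + fneg (1 / z) * (1 / z)) holomorphic_on - {0}"
  proof (intro holomorphic_intros)
    show "fpos holomorphic_on - {0}"
      using holomorphic_parts(1) holomorphic_on_subset by blast
    have "(fneg \<circ> (\<lambda>z. 1 / z)) holomorphic_on - {0}"
      by (rule holomorphic_on_compose_gen[OF _ holomorphic_parts(2)]) (auto intro!: holomorphic_intros)
    then show "(\<lambda>z. fneg (1 / z)) holomorphic_on - {0}" by (simp add: o_def)
  qed auto
  then show ?thesis
    by (rule holomorphic_transform) (simp add: laurent_eq)
qed

text \<open>The identity theorem spreads the zeros from the circle to the punctured plane. Then
  \<open>fpos z = - fneg (1 / z) / z\<close> tends to 0 at infinity, so the entire function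
  \<open>fpos\<close> vanishes by Liouville's theorem, and its value at 0 is
  \<open>a 0\<close>.\<close>

lemma coeff_0_eq_0:
  assumes "\<And>z. norm z = 1 \<Longrightarrow> laurent z = 0"
  shows "a 0 = 0"
proof -
  have zero: "laurent z = 0" if "z \<noteq> 0" for z
  proof (rule analytic_continuation[OF holomorphic_laurent _ _ _ _ _ _ ])
    show "connected (- {0 :: complex})"
      by (rule connected_punctured_universe) simp
    show "(1 :: complex) islimpt sphere 0 1"
    proof (rule connected_imp_perfect)
      show "connected (sphere (0 :: complex) 1)" by (rule connected_sphere) simp
      have "- 1 \<in> sphere (0 :: complex) 1" "1 \<in> sphere (0 :: complex) 1" by auto
      then show "sphere (0 :: complex) 1 \<noteq> {x}" for x by (metis one_neq_neg_one singletonD)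
    qed auto
  qed (use assms that in auto)
  have "(fpos \<longlongrightarrow> 0) at_infinity"
  proof -
    have inv: "((\<lambda>z. 1 / z) \<longlongrightarrow> (0 :: complex)) at_infinity"
      using tendsto_inverse_0[where 'a = complex] by (simp add: inverse_eq_divide[abs_def])
    have "isCont fneg 0"
      using holomorphic_parts(2) holomorphic_on_imp_continuous_on continuous_on_eq_continuous_at by blast
    then have "((\<lambda>z. fneg (1 / z)) \<longlongrightarrow> fneg 0) at_infinity"
      by (rule isCont_tendsto_compose[OF _ inv])
    then have "((\<lambda>z. - (fneg (1 / z) * (1 / z))) \<longlongrightarrow> - (fneg 0 * 0)) at_infinity"
      by (intro tendsto_intros inv)
    then have "((\<lambda>z. - (fneg (1 / z) * (1 / z))) \<longlongrightarrow> 0) at_infinity" by simp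
    moreover have "eventually (\<lambda>z. - (fneg (1 / z) * (1 / z)) = fpos z) at_infinity"
      unfolding eventually_at_infinity
    proof (intro exI[of _ 1] allI impI)
      fix z :: complex assume "1 \<le> norm z"
      then have "z \<noteq> 0" by auto
      from zero[OF this] laurent_eq[OF this] show "- (fneg (1 / z) * (1 / z)) = fpos z"
        by (metis add_eq_0_iff minus_minus)
    qed
    ultimately show ?thesis using Lim_transform_eventually by blast
  qed
  then have "fpos 0 = 0"
    by (rule Liouville_weak_0[OF holomorphic_parts(1)])
  moreover have "fpos 0 = a 0"
    unfolding fpos_def by (simp add: powser_zero)
  ultimately show ?thesis by simp
qed

end

text \<open>Both branches vanish exactly at \<open>w = exp (- 2 * c * x)\<close>. For
  \<open>x < 0\<close> this point lies outside the unit circle and the factor is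
  \<open>1 - z / w\<close>; otherwise it lies in the closed unit disc and the factor is
  \<open>1 - w / z\<close>. So every factor has modulus at most 2 on the unit circle, and is large
  on a large circle or on a small one, respectively.\<close>

definition zfactor :: "real \<Rightarrow> real \<Rightarrow> complex \<Rightarrow> complex" where
  "zfactor c x z = (if x < 0 then 1 - z * of_real (exp (2 * c * x)) else 1 - of_real (exp (- 2 * c * x)) / z)"

lemma zfactor_eq_0_iff: "c > 0 \<Longrightarrow> z \<noteq> 0 \<Longrightarrow> zfactor c x z = 0 \<longleftrightarrow> z = of_real (exp (- 2 * c * x))"
  by (auto simp: zfactor_def exp_minus field_simps)

text \<open>Zeros are removed one at a time: distinct \<open>x\<close> give distinct points, so the
  factors already removed do not vanish at the next zero, hence the quotient does. Dividing by
  \<open>z - w\<close> leaves a removable singularity.\<close>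

lemma factor_out_zeros:
  fixes f :: "complex \<Rightarrow> complex"
  assumes "c > 0" "finite X" "f holomorphic_on - {0}" "\<And>x. x \<in> X \<Longrightarrow> f (of_real (exp (- 2 * c * x))) = 0"
  shows "\<exists>q. q holomorphic_on - {0} \<and> (\<forall>z. z \<noteq> 0 \<longrightarrow> f z = (\<Prod>x\<in>X. zfactor c x z) * q z)"
  using assms(2,4)
proof (induction X)
  case empty
  then show ?case using assms(3) by auto
next
  case (insert x X)
  then obtain q where q: "q holomorphic_on - {0}" "\<And>z. z \<noteq> 0 \<Longrightarrow> f z = (\<Prod>x\<in>X. zfactor c x z) * q z"
    by auto
  define w :: complex where "w = of_real (exp (- 2 * c * x))"
  have w: "w \<noteq> 0" by (simp add: w_def)
  have "(\<Prod>x\<in>X. zfactor c x w) \<noteq> 0"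
  proof -
    have "zfactor c y w \<noteq> 0" if "y \<in> X" for y
    proof -
      have "y \<noteq> x" using that insert.hyps by auto
      then have "w \<noteq> of_real (exp (- 2 * c * y))"
        using \<open>c > 0\<close> unfolding w_def of_real_eq_iff by simp
      then show ?thesis using zfactor_eq_0_iff[OF \<open>c > 0\<close> w] by simp
    qed
    then show ?thesis using insert.hyps by simp
  qed
  moreover have "f w = 0"
    using insert.prems by (simp add: w_def)
  ultimately have "q w = 0" using q(2)[OF w] by simp
  define r where "r z = (if z = w then deriv q w else (q z - q w) / (z - w))" for z
  have r: "r holomorphic_on - {0}"
    unfolding r_def[abs_def] by (rule pole_lemma_open[OF q(1)]) auto
  have qr: "q z = (z - w) * r z" for z
    unfolding r_def using \<open>q w = 0\<close> by simp
  \<comment> \<open>Absorbs the factor \<open>- w\<close> or \<open>z\<close>, without zeros on the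
    punctured plane, by which \<open>z - w\<close> differs from
    \<open>zfactor c x z\<close>.\<close>
  define p where "p z = (if x < 0 then - w else z) * r z" for z
  have "p holomorphic_on - {0}"
    unfolding p_def[abs_def] using r by (cases "x < 0") (auto intro!: holomorphic_intros)
  moreover have "q z = zfactor c x z * p z" if "z \<noteq> 0" for z
    unfolding qr p_def zfactor_def w_def using that by (simp add: exp_minus field_simps)
  ultimately show ?case
    using q(2) insert.hyps by (intro exI[of _ p]) (auto simp: mult_ac)
qed

lemma annulus_max_modulus:
  fixes f :: "complex \<Rightarrow> complex"
  assumes f: "f holomorphic_on - {0}" and "R > 1"
    and le: "\<And>z. norm z = R \<or> norm z = 1 / R \<Longrightarrow> norm (f z) \<le> D"
    and \<xi>: "norm \<xi> = 1"
  shows "norm (f \<xi>) \<le> D"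
proof -
  define S where "S = cball (0 :: complex) R - ball 0 (1 / R)"
  have R: "1 / R < 1" "1 / R > 0" using \<open>R > 1\<close> by auto
  have cl: "closed S" by (auto simp: S_def intro: closed_Diff)
  have sub: "S \<subseteq> - {0}" using R by (auto simp: S_def)
  show ?thesis
  proof (rule maximum_modulus_frontier[of f S])
    show "f holomorphic_on interior S"
      using f sub interior_subset by (blast intro: holomorphic_on_subset)
    show "continuous_on (closure S) f"
      using cl f sub by (simp add: holomorphic_on_imp_continuous_on holomorphic_on_subset)
    show "bounded S" by (auto simp: S_def intro: bounded_diff)
    show "\<xi> \<in> S" using \<xi> R by (auto simp: S_def)
    fix z assume z: "z \<in> frontier S"
    have "ball 0 R - cball 0 (1 / R) \<subseteq> interior S"
      by (rule interior_maximal) (auto simp: S_def intro: open_Diff)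
    with z cl have "z \<in> S" "z \<notin> ball 0 R - cball 0 (1 / R)"
      by (auto simp: frontier_def)
    then have "norm z = R \<or> norm z = 1 / R" by (auto simp: S_def)
    then show "norm (f z) \<le> D" by (rule le)
  qed
qed

context gaussian_laurent
begin

text \<open>A Jensen-type estimate: maximum principle on the annulus with radii \<open>R\<close> and
  \<open>1 / R\<close>, after dividing by all factors \<open>zfactor\<close>. On the outer circle
  only the zeros with \<open>x < 0\<close> are known to give large factors, on the inner one only
  the others; hence \<open>T\<close> bounds both sums from below. A factor may lose 1/2 on the
  boundary and is at most 2 on the unit circle, which makes up \<open>4 ^ card X\<close>.\<close>

lemma laurent_small_if_many_zeros:
  assumes "finite X" "s \<ge> 0" "\<And>x. x \<in> X \<Longrightarrow> \<bar>x\<bar> \<le> s"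
    and zero: "\<And>x. x \<in> X \<Longrightarrow> laurent (of_real (exp (- 2 * c * x))) = 0"
    and T: "T \<le> (\<Sum>x\<in>X. if x < 0 then s - \<bar>x\<bar> else 0)" "T \<le> (\<Sum>x\<in>X. if x < 0 then 0 else s - \<bar>x\<bar>)"
    and "norm z = 1"
  defines "s' \<equiv> s + ln 2 / (2 * c)"
  shows "norm (laurent z) \<le> 4 ^ card X * (bnd * exp (c * s'\<^sup>2 + b * s')) * exp (- (2 * c * T))"
proof -
  define N where "N = card X"
  define L where "L = bnd * exp (c * s'\<^sup>2 + b * s')"
  have "s' \<ge> 0" using c_pos \<open>s \<ge> 0\<close> by (simp add: s'_def)
  define R where "R = exp (2 * c * s')"
  \<comment> \<open>The summand \<open>ln 2 / (2 * c)\<close> in \<open>s'\<close> doubles the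
    radius. On the circle on the side of its zero a factor \<open>1 - u\<close> has
    \<open>norm u = 2 exp (2 c (s - \<bar>x\<bar>))\<close> and keeps at least half of that; on the
    opposite circle \<open>norm u \<le> 1 / 2\<close>.\<close>
  have R: "R = 2 * exp (2 * c * s)"
    unfolding R_def s'_def using c_pos by (simp add: distrib_left exp_add)
  have "R > 1"
  proof -
    have "exp (2 * c * s) \<ge> 1" using c_pos \<open>s \<ge> 0\<close> by simp
    then show ?thesis unfolding R by linarith
  qed
  obtain q where q: "q holomorphic_on - {0}"
    and lq: "\<And>z. z \<noteq> 0 \<Longrightarrow> laurent z = (\<Prod>x\<in>X. zfactor c x z) * q z"
    using factor_out_zeros[OF c_pos \<open>finite X\<close> holomorphic_laurent zero] by blast
  have big: "exp (2 * c * (s - \<bar>x\<bar>)) \<le> norm (1 - u)" if "x \<in> X" "norm u = R * exp (- (2 * c * \<bar>x\<bar>))" for x and u :: complex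
  proof -
    have "norm u = 2 * exp (2 * c * (s - \<bar>x\<bar>))"
      using that(2) unfolding R by (simp add: exp_add[symmetric] right_diff_distrib)
    moreover have "exp (2 * c * (s - \<bar>x\<bar>)) \<ge> 1"
      using assms(3)[OF that(1)] c_pos by simp
    moreover have "norm u - 1 \<le> norm (1 - u)"
      using norm_triangle_ineq2[of u 1] by (simp add: norm_minus_commute)
    ultimately show ?thesis by linarith
  qed
  have half: "1 / 2 \<le> norm (1 - u)" if "norm u = exp (- (2 * c * \<bar>x\<bar>)) / R" for x and u :: complex
  proof -
    have "norm u \<le> 1 / R"
      using that c_pos \<open>R > 1\<close> by (simp add: divide_right_mono)
    also have "1 / R \<le> 1 / 2"
      using c_pos \<open>s \<ge> 0\<close> unfolding R by (simp add: field_simps)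
    finally have "norm u \<le> 1 / 2" .
    moreover have "1 - norm u \<le> norm (1 - u)"
      using norm_triangle_ineq2[of 1 u] by simp
    ultimately show ?thesis by linarith
  qed
  have Lnn: "L \<ge> 0" unfolding L_def using bnd_nonneg by simp
  \<comment> \<open>\<open>e x\<close> is the exponent gained from the zero \<open>x\<close> on the
    circle in question: \<open>s - \<bar>x\<bar>\<close> on its own side, 0 on the other.\<close>
  have qbound: "norm (q z) \<le> L * 2 ^ N * exp (- (2 * c * T))"
    if "z \<noteq> 0" "norm (laurent z) \<le> L"
      and low: "\<And>x. x \<in> X \<Longrightarrow> exp (2 * c * e x) / 2 \<le> norm (zfactor c x z)" and "T \<le> (\<Sum>x\<in>X. e x)" for z e
  proof -
    have "exp (2 * c * T) / 2 ^ N \<le> exp (2 * c * (\<Sum>x\<in>X. e x)) / 2 ^ N"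
      using that(4) c_pos by (simp add: divide_right_mono)
    also have "\<dots> = (\<Prod>x\<in>X. exp (2 * c * e x) / 2)"
      by (simp add: sum_distrib_left exp_sum[OF \<open>finite X\<close>] prod_dividef N_def)
    also have "\<dots> \<le> (\<Prod>x\<in>X. norm (zfactor c x z))"
      using low by (intro prod_mono) auto
    finally have P: "exp (2 * c * T) / 2 ^ N \<le> norm (\<Prod>x\<in>X. zfactor c x z)"
      by (simp add: prod_norm)
    have "exp (2 * c * T) / 2 ^ N * norm (q z) \<le> norm (\<Prod>x\<in>X. zfactor c x z) * norm (q z)"
      by (intro mult_right_mono P) simp
    also have "\<dots> \<le> L" using that(2) lq[OF that(1)] by (simp add: norm_mult)
    finally show ?thesis by (simp add: exp_minus field_simps)
  qed
  have qb: "norm (q z) \<le> L * 2 ^ N * exp (- (2 * c * T))" if "norm z = R \<or> norm z = 1 / R" for z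
  proof -
    have "z \<noteq> 0" using that \<open>R > 1\<close> by auto
    show ?thesis
      using that
    proof
      assume z: "norm z = R"
      show ?thesis
      proof (rule qbound[OF \<open>z \<noteq> 0\<close> _ _ T(1)])
        show "norm (laurent z) \<le> L"
          using norm_laurent_le[of z s'] z \<open>s' \<ge> 0\<close> by (simp add: R_def L_def)
        fix x assume x: "x \<in> X"
        show "exp (2 * c * (if x < 0 then s - \<bar>x\<bar> else 0)) / 2 \<le> norm (zfactor c x z)"
        proof (cases "x < 0")
          case True
          have "exp (2 * c * (s - \<bar>x\<bar>)) \<le> norm (zfactor c x z)"
            using True big[OF x, of "z * of_real (exp (2 * c * x))"] by (simp add: zfactor_def norm_mult z)
          moreover have "exp (2 * c * (s - \<bar>x\<bar>)) / 2 \<le> exp (2 * c * (s - \<bar>x\<bar>))" by simp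
          ultimately have "exp (2 * c * (s - \<bar>x\<bar>)) / 2 \<le> norm (zfactor c x z)" by linarith
          then show ?thesis using True by (simp only: if_True if_False)
        next
          case False
          then show ?thesis
            using half[of "of_real (exp (- 2 * c * x)) / z" x] by (simp add: zfactor_def norm_divide z)
        qed
      qed
    next
      assume z: "norm z = 1 / R"
      show ?thesis
      proof (rule qbound[OF \<open>z \<noteq> 0\<close> _ _ T(2)])
        show "norm (laurent z) \<le> L"
          using norm_laurent_le[of z "- s'"] z \<open>s' \<ge> 0\<close> by (simp add: R_def L_def exp_minus inverse_eq_divide)
        fix x assume x: "x \<in> X"
        show "exp (2 * c * (if x < 0 then 0 else s - \<bar>x\<bar>)) / 2 \<le> norm (zfactor c x z)"
        proof (cases "x < 0")
          case True
          then show ?thesis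
            using half[of "z * of_real (exp (2 * c * x))" x] by (simp add: zfactor_def norm_mult z)
        next
          case False
          have "exp (2 * c * (s - \<bar>x\<bar>)) \<le> norm (zfactor c x z)"
            using False big[OF x, of "of_real (exp (- 2 * c * x)) / z"] \<open>R > 1\<close>
            by (simp add: zfactor_def norm_divide z mult.commute)
          moreover have "exp (2 * c * (s - \<bar>x\<bar>)) / 2 \<le> exp (2 * c * (s - \<bar>x\<bar>))" by simp
          ultimately have "exp (2 * c * (s - \<bar>x\<bar>)) / 2 \<le> norm (zfactor c x z)" by linarith
          then show ?thesis using False by (simp only: if_True if_False)
        qed
      qed
    qed
  qed
  have qz: "norm (q z) \<le> L * 2 ^ N * exp (- (2 * c * T))"
    by (rule annulus_max_modulus[OF q \<open>R > 1\<close> qb \<open>norm z = 1\<close>])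
  have "norm (\<Prod>x\<in>X. zfactor c x z) \<le> (\<Prod>x\<in>X. 2)"
    unfolding prod_norm[symmetric]
  proof (intro prod_mono conjI)
    fix x
    have "norm (1 - u) \<le> 2" if "norm u \<le> 1" for u :: complex
      using norm_triangle_ineq4[of 1 u] that by simp
    then show "norm (zfactor c x z) \<le> 2"
      using c_pos \<open>norm z = 1\<close> by (auto simp: zfactor_def norm_mult norm_divide mult_le_0_iff)
  qed simp
  then have "norm (\<Prod>x\<in>X. zfactor c x z) \<le> 2 ^ N" by (simp add: N_def)
  moreover have "z \<noteq> 0" using \<open>norm z = 1\<close> by auto
  ultimately have "norm (laurent z) \<le> 2 ^ N * (L * 2 ^ N * exp (- (2 * c * T)))"
    unfolding lq[OF \<open>z \<noteq> 0\<close>] norm_mult by (intro mult_mono qz) auto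
  also have "\<dots> = 4 ^ N * L * exp (- (2 * c * T))"
  proof -
    have "(4 :: real) ^ N = 2 ^ N * 2 ^ N" by (simp add: power_mult_distrib[symmetric])
    then show ?thesis by simp
  qed
  finally show ?thesis by (simp add: N_def L_def)
qed

end

lemma sum_triangle: "(\<Sum>i<m. real m - 1 - real i) = real m * (real m - 1) / 2"
proof -
  have "(\<Sum>i<m. real i) = real m * (real m - 1) / 2"
    by (induction m) (auto simp: field_simps)
  then show ?thesis by (simp add: sum_subtractf)
qed

text \<open>More than \<open>1\<close> zero per unit length makes \<open>laurent\<close> vanish on the unit circle: the zeros up to height
  \<open>s\<close> gain a factor \<open>exp (- c s\<^sup>2 M / B)\<close>, which beats the growth \<open>exp (c s\<^sup>2)\<close>.\<close>

lemma gaussian_shifts_uniqueness: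
  fixes d :: "int \<Rightarrow> real"
  assumes "c > 0" "b \<ge> 0" "d 0 = 1" and d_le: "\<And>k. \<bar>d k\<bar> \<le> C * exp (b * \<bar>real_of_int k\<bar>)"
    and "B > 0" "B < real M"
    and Z: "\<And>j. finite (Z j)" "\<And>j. card (Z j) = M" "\<And>j x. x \<in> Z j \<Longrightarrow> of_int j * B \<le> x \<and> x < (of_int j + 1) * B"
    and zero: "\<And>j x. x \<in> Z j \<Longrightarrow> (LINT k|count_space UNIV. d k * exp (- c * (x + of_int k)\<^sup>2)) = 0"
  shows False
proof -
  define a :: "int \<Rightarrow> complex" where "a k = of_real (d k * exp (- c * (of_int k)\<^sup>2))" for k
  interpret gaussian_laurent a c C b
  proof
    fix k
    have "norm (a k) = \<bar>d k\<bar> * exp (- c * (of_int k)\<^sup>2)"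
      by (simp only: a_def norm_of_real abs_mult abs_exp_cancel)
    also have "\<dots> \<le> C * exp (b * \<bar>real_of_int k\<bar>) * exp (- c * (of_int k)\<^sup>2)"
      by (intro mult_right_mono d_le) simp
    finally show "norm (a k) \<le> C * exp (b * \<bar>real_of_int k\<bar> - c * (real_of_int k)\<^sup>2)"
      by (simp add: exp_diff exp_minus field_simps)
  qed (use assms in auto)
  have lz: "laurent (of_real (exp (- 2 * c * x))) = 0" if "x \<in> Z j" for x j
  proof -
    have "a k * of_real (exp (- 2 * c * x)) powi k =
        of_real (exp (c * x\<^sup>2)) * of_real (d k * exp (- c * (x + of_int k)\<^sup>2))" for k
    proof -
      have "exp (- 2 * c * x) powi k = exp (of_int k * (- 2 * c * x))"
        by (rule exp_power_int)
      then have "exp (- c * (of_int k)\<^sup>2) * exp (- 2 * c * x) powi k = exp (c * x\<^sup>2) * exp (- c * (x + of_int k)\<^sup>2)"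
        by (simp add: exp_add[symmetric] power2_sum algebra_simps)
      then have "d k * exp (- c * (of_int k)\<^sup>2) * exp (- 2 * c * x) powi k = exp (c * x\<^sup>2) * (d k * exp (- c * (x + of_int k)\<^sup>2))"
        by simp
      then show ?thesis
        unfolding a_def of_real_power_int[symmetric] of_real_mult[symmetric] of_real_eq_iff .
    qed
    then have "laurent (of_real (exp (- 2 * c * x))) =
      (LINT k|count_space UNIV. of_real (exp (c * x\<^sup>2)) * of_real (d k * exp (- c * (x + of_int k)\<^sup>2)))"
      unfolding laurent_def by simp
    also have "\<dots> = of_real (exp (c * x\<^sup>2)) * of_real (LINT k|count_space UNIV. d k * exp (- c * (x + of_int k)\<^sup>2))"
      by (simp del: of_real_mult)
    finally show ?thesis using zero[OF that] by simp
  qed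
  have dis: "Z i \<inter> Z j = {}" if "i \<noteq> j" for i j
  proof (rule ccontr)
    assume "Z i \<inter> Z j \<noteq> {}"
    then obtain x where x: "x \<in> Z i" "x \<in> Z j" by auto
    have "of_int i * B < (of_int j + 1) * B" "of_int j * B < (of_int i + 1) * B"
      using Z(3)[OF x(1)] Z(3)[OF x(2)] by linarith+
    then have "real_of_int i < of_int j + 1" "real_of_int j < of_int i + 1" using \<open>B > 0\<close> by auto
    then show False using that by linarith
  qed
  define \<eta> where "\<eta> = ln 2 / (2 * c)"
  have le: "norm (laurent z) \<le> 4 ^ (2 * m * M) * (bnd * exp (c * (real m * B + \<eta>)\<^sup>2 + b * (real m * B + \<eta>)))
        * exp (- (2 * c * (real M * B * (real m * (real m - 1) / 2))))" if "norm z = 1" for m z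
  proof -
    let ?s = "real m * B"
    \<comment> \<open>Zeros in the first \<open>m\<close> cells on each side. Here \<open>i\<close>
      counts cells away from the origin: a zero in the \<open>i\<close>-th has
      \<open>\<bar>x\<bar> \<le> (i + 1) B\<close> and gains at least \<open>(m - 1 - i) B\<close>,
      so each side gains at least \<open>M B m (m - 1) / 2\<close>.\<close>
    define X1 where "X1 = (\<Union>i<m. Z (- int i - 1))"
    define X2 where "X2 = (\<Union>i<m. Z (int i))"
    have neg: "x < 0" "\<bar>x\<bar> \<le> ?s" "(real m - 1 - real i) * B \<le> ?s - \<bar>x\<bar>" if "i < m" "x \<in> Z (- int i - 1)" for i x
    proof -
      have "(- real i - 1) * B \<le> x" "x < - (real i * B)"
        using Z(3)[OF that(2)] by auto
      moreover have i: "real i * B \<ge> 0" "(real i + 1) * B \<le> ?s"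
        using \<open>B > 0\<close> that(1) by (auto intro!: mult_right_mono)
      ultimately show "x < 0" by linarith
      then have "\<bar>x\<bar> = - x" by simp
      then show "\<bar>x\<bar> \<le> ?s" "(real m - 1 - real i) * B \<le> ?s - \<bar>x\<bar>"
        using \<open>(- real i - 1) * B \<le> x\<close> i(2) by (simp_all add: algebra_simps)
    qed
    have pos: "\<not> x < 0" "\<bar>x\<bar> \<le> ?s" "(real m - 1 - real i) * B \<le> ?s - \<bar>x\<bar>" if "i < m" "x \<in> Z (int i)" for i x
    proof -
      have "real i * B \<le> x" "x < (real i + 1) * B"
        using Z(3)[OF that(2)] by auto
      moreover have i: "real i * B \<ge> 0" "(real i + 1) * B \<le> ?s"
        using \<open>B > 0\<close> that(1) by (auto intro!: mult_right_mono)
      ultimately show "\<not> x < 0" by linarith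
      then have "\<bar>x\<bar> = x" by simp
      then show "\<bar>x\<bar> \<le> ?s" "(real m - 1 - real i) * B \<le> ?s - \<bar>x\<bar>"
        using \<open>x < (real i + 1) * B\<close> i(2) by (simp_all add: algebra_simps)
    qed
    have fin: "finite X1" "finite X2" using Z(1) by (auto simp: X1_def X2_def)
    have disj: "X1 \<inter> X2 = {}"
      using neg(1) pos(1) unfolding X1_def X2_def by blast
    have Tsum: "real M * B * (real m * (real m - 1) / 2) \<le> (\<Sum>x\<in>(\<Union>i<m. Z (h i)). ?s - \<bar>x\<bar>)"
      if "inj h" and low: "\<And>i x. i < m \<Longrightarrow> x \<in> Z (h i) \<Longrightarrow> (real m - 1 - real i) * B \<le> ?s - \<bar>x\<bar>" for h :: "nat \<Rightarrow> int"
    proof -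
      have "real M * B * (real m * (real m - 1) / 2) = (\<Sum>i<m. \<Sum>x\<in>Z (h i). (real m - 1 - real i) * B)"
        unfolding sum_triangle[symmetric] by (simp add: Z(2) sum_distrib_left mult_ac)
      also have "\<dots> \<le> (\<Sum>i<m. \<Sum>x\<in>Z (h i). ?s - \<bar>x\<bar>)"
        by (intro sum_mono low) auto
      also have "\<dots> = (\<Sum>x\<in>(\<Union>i<m. Z (h i)). ?s - \<bar>x\<bar>)"
        by (rule sum.UNION_disjoint[symmetric]) (use Z(1) dis that(1) in \<open>auto simp: inj_eq\<close>)
      finally show ?thesis .
    qed
    have T1: "real M * B * (real m * (real m - 1) / 2) \<le> (\<Sum>x\<in>X1. ?s - \<bar>x\<bar>)"
      unfolding X1_def by (rule Tsum[OF _ neg(3)]) (auto simp: inj_on_def)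
    have T2: "real M * B * (real m * (real m - 1) / 2) \<le> (\<Sum>x\<in>X2. ?s - \<bar>x\<bar>)"
      unfolding X2_def by (rule Tsum[OF _ pos(3)]) (auto simp: inj_on_def)
    have s1: "(\<Sum>x\<in>X1 \<union> X2. if x < 0 then ?s - \<bar>x\<bar> else 0) = (\<Sum>x\<in>X1. ?s - \<bar>x\<bar>)"
      using neg(1) pos(1) fin
      by (intro sum.mono_neutral_cong_right) (auto simp: X1_def X2_def)
    have s2: "(\<Sum>x\<in>X1 \<union> X2. if x < 0 then 0 else ?s - \<bar>x\<bar>) = (\<Sum>x\<in>X2. ?s - \<bar>x\<bar>)"
      using neg(1) pos(1) fin
      by (intro sum.mono_neutral_cong_right) (auto simp: X1_def X2_def)
    have card: "card (X1 \<union> X2) \<le> 2 * m * M"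
    proof -
      have "card X1 \<le> (\<Sum>i<m. card (Z (- int i - 1)))" "card X2 \<le> (\<Sum>i<m. card (Z (int i)))"
        unfolding X1_def X2_def by (rule card_UN_le; simp)+
      then show ?thesis using card_Un_le[of X1 X2] by (simp add: Z(2))
    qed
    have "norm (laurent z) \<le> 4 ^ card (X1 \<union> X2) * (bnd * exp (c * (?s + \<eta>)\<^sup>2 + b * (?s + \<eta>)))
        * exp (- (2 * c * (real M * B * (real m * (real m - 1) / 2))))"
      unfolding \<eta>_def
    proof (rule laurent_small_if_many_zeros)
      show "\<bar>x\<bar> \<le> ?s" if "x \<in> X1 \<union> X2" for x
        using that neg(2) pos(2) by (auto simp: X1_def X2_def)
      show "laurent (of_real (exp (- 2 * c * x))) = 0" if "x \<in> X1 \<union> X2" for x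
        using that lz by (auto simp: X1_def X2_def simp del: of_real_exp)
    qed (use fin \<open>B > 0\<close> s1 s2 T1 T2 that in auto)
    also have "\<dots> \<le> 4 ^ (2 * m * M) * (bnd * exp (c * (?s + \<eta>)\<^sup>2 + b * (?s + \<eta>)))
        * exp (- (2 * c * (real M * B * (real m * (real m - 1) / 2))))"
      using bnd_nonneg card by (intro mult_right_mono power_increasing) auto
    finally show ?thesis .
  qed
  have "laurent z = 0" if z: "norm z = 1" for z
  proof -
    \<comment> \<open>Balance of the terms quadratic in \<open>m\<close>: the growth contributes
      \<open>c B^2\<close>, the zeros take away \<open>c B M\<close>, and the net rate
      \<open>- p\<close> is negative because \<open>B < M\<close>. Everything linear in
      \<open>m\<close>, including the factor \<open>4 ^ (2 * m * M)\<close>, goes into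
      \<open>r\<close>.\<close>
    define p where "p = c * B * (real M - B)"
    define r where "r = ln 4 * 2 * real M + 2 * c * B * \<eta> + b * B + c * B * real M"
    define t where "t = c * \<eta>\<^sup>2 + b * \<eta>"
    have "p > 0" using \<open>c > 0\<close> \<open>B > 0\<close> \<open>B < real M\<close> by (simp add: p_def)
    have "4 ^ (2 * m * M) * (bnd * exp (c * (real m * B + \<eta>)\<^sup>2 + b * (real m * B + \<eta>)))
        * exp (- (2 * c * (real M * B * (real m * (real m - 1) / 2)))) = bnd * exp (- p * (real m)\<^sup>2 + r * real m + t)" for m
    proof -
      have "(4 :: real) ^ (2 * m * M) = exp (real (2 * m * M) * ln 4)"
        by (simp add: exp_of_nat_mult del: of_nat_mult)
      moreover have "2 * c * (real M * B * (real m * (real m - 1) / 2)) = c * real M * B * ((real m)\<^sup>2 - real m)"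
        by (simp add: power2_eq_square field_simps)
      ultimately show ?thesis
        by (simp add: p_def r_def t_def exp_add[symmetric] power2_sum power2_eq_square algebra_simps)
    qed
    then have "norm (laurent z) \<le> bnd * exp (- p * (real m)\<^sup>2 + r * real m + t)" for m
      using le[OF z, of m] by (simp only:)
    moreover have "(\<lambda>m. bnd * exp (- p * (real m)\<^sup>2 + r * real m + t)) \<longlonglongrightarrow> 0"
      using \<open>p > 0\<close> by real_asymp
    ultimately have "norm (laurent z) \<le> 0"
      by (intro LIMSEQ_le_const) auto
    then show ?thesis by simp
  qed
  then have "a 0 = 0" by (rule coeff_0_eq_0)
  then show False using \<open>d 0 = 1\<close> by (simp add: a_def)
qed

section \<open>One-sided exponential averages\<close>

lemma has_bochner_integral_exp_Ici:
  fixes k t :: real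
  assumes "k > 0"
  shows "has_bochner_integral lborel (\<lambda>s. indicator {t..} s * exp (- k * s)) (exp (- k * t) / k)"
proof (rule has_bochner_integral_nn_integral)
  have "((\<lambda>s. - (exp (- k * s) / k)) \<longlongrightarrow> 0) at_top"
    using assms by real_asymp
  then have "(\<integral>\<^sup>+s. ennreal (exp (- k * s)) * indicator {t..} s \<partial>lborel) = ennreal (0 - - (exp (- k * t) / k))"
    using assms by (intro nn_integral_FTC_atLeast) (auto intro!: derivative_eq_intros)
  then show "(\<integral>\<^sup>+s. ennreal (indicator {t..} s * exp (- k * s)) \<partial>lborel) = ennreal (exp (- k * t) / k)"
    by (simp add: ennreal_mult ennreal_indicator mult.commute)
qed (use assms in auto)

text \<open>The solution of \<open>F + \<delta> F' = G\<close> as a one-sided average: it looks to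
  the left of \<open>x\<close> for \<open>\<delta> > 0\<close>, to the right for
  \<open>\<delta> < 0\<close>, and is \<open>G\<close> itself for \<open>\<delta> = 0\<close>.
  Putting \<delta> into the argument of \<open>G\<close> covers the three cases by one
  formula.\<close>

definition exp_smooth :: "real \<Rightarrow> (real \<Rightarrow> real) \<Rightarrow> real \<Rightarrow> real" where
  "exp_smooth \<delta> G x = (LINT s|lborel. indicator {0..} s * (exp (- s) * G (x - \<delta> * s)))"

text \<open>The lower limit \<open>t\<close> is arbitrary because the Rolle argument compares two
  tails of one integral. The growth bound serves both for combinations of shifts growing at rate
  \<open>b\<close> and, with negative \<open>b\<close>, for decaying kernels.\<close>

lemma exp_smooth_integrable:
  fixes G :: "real \<Rightarrow> real"
  assumes "continuous_on UNIV G" and le: "\<And>x. \<bar>G x\<bar> \<le> K * exp (b * \<bar>x\<bar>)" and "\<bar>b\<bar> * \<bar>\<delta>\<bar> < 1"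
  shows "integrable lborel (\<lambda>s. indicator {t..} s * (exp (- s) * G (x - \<delta> * s)))"
proof -
  have K: "K \<ge> 0" using le[of 0] abs_ge_zero[of "G 0"] by simp
  define k where "k = 1 - \<bar>b\<bar> * \<bar>\<delta>\<bar>"
  have k: "k > 0" using assms(3) by (simp add: k_def)
  \<comment> \<open>The term with \<open>\<bar>t\<bar>\<close> comes from
    \<open>\<bar>s\<bar> \<le> s + 2 \<bar>t\<bar>\<close> for \<open>s \<ge> t\<close>, since
    \<open>s\<close> may be negative there.\<close>
  define D where "D = K * exp (\<bar>b\<bar> * \<bar>x\<bar> + 2 * \<bar>b\<bar> * \<bar>\<delta>\<bar> * \<bar>t\<bar>)"
  have [measurable]: "G \<in> borel_measurable borel"
    using assms(1) by (rule borel_measurable_continuous_onI)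
  have "integrable lborel (\<lambda>s. D * (indicator {t..} s * exp (- k * s)))"
    by (intro integrable_mult_right has_bochner_integral_exp_Ici[THEN integrable.intros] k)
  then show ?thesis
  proof (rule Bochner_Integration.integrable_bound)
    show "AE s in lborel. norm (indicator {t..} s * (exp (- s) * G (x - \<delta> * s)))
        \<le> norm (D * (indicator {t..} s * exp (- k * s)))"
    proof (rule AE_I2)
      fix s :: real
      have "exp (- s) * \<bar>G (x - \<delta> * s)\<bar> \<le> D * exp (- k * s)" if "s \<ge> t"
      proof -
        have "b * \<bar>x - \<delta> * s\<bar> \<le> \<bar>b\<bar> * (\<bar>x\<bar> + \<bar>\<delta>\<bar> * \<bar>s\<bar>)"
          using abs_triangle_ineq4[of x "\<delta> * s"] by (intro mult_mono) (auto simp: abs_mult)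
        also have "\<bar>s\<bar> \<le> s + 2 * \<bar>t\<bar>" using that by auto
        then have "\<bar>b\<bar> * (\<bar>x\<bar> + \<bar>\<delta>\<bar> * \<bar>s\<bar>) \<le> \<bar>b\<bar> * (\<bar>x\<bar> + \<bar>\<delta>\<bar> * (s + 2 * \<bar>t\<bar>))"
          by (intro mult_left_mono add_mono) auto
        finally have "- s + b * \<bar>x - \<delta> * s\<bar> \<le> (\<bar>b\<bar> * \<bar>x\<bar> + 2 * \<bar>b\<bar> * \<bar>\<delta>\<bar> * \<bar>t\<bar>) + - k * s"
          by (simp add: k_def algebra_simps)
        then have "exp (- s) * exp (b * \<bar>x - \<delta> * s\<bar>) \<le> exp (\<bar>b\<bar> * \<bar>x\<bar> + 2 * \<bar>b\<bar> * \<bar>\<delta>\<bar> * \<bar>t\<bar>) * exp (- k * s)"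
          by (simp only: exp_add[symmetric] exp_le_cancel_iff)
        then have "K * (exp (- s) * exp (b * \<bar>x - \<delta> * s\<bar>)) \<le> D * exp (- k * s)"
          unfolding D_def using mult_left_mono[OF _ K] by (simp only: mult.assoc)
        moreover have "exp (- s) * \<bar>G (x - \<delta> * s)\<bar> \<le> K * (exp (- s) * exp (b * \<bar>x - \<delta> * s\<bar>))"
          by (subst mult.left_commute) (intro mult_left_mono le, simp)
        ultimately show ?thesis by linarith
      qed
      moreover have "D \<ge> 0" using K by (simp add: D_def)
      ultimately show "norm (indicator {t..} s * (exp (- s) * G (x - \<delta> * s)))
        \<le> norm (D * (indicator {t..} s * exp (- k * s)))"
        by (auto simp: indicator_def abs_mult)
    qed
  qed measurable
qed

text \<open>The shift by \<open>\<delta> s\<close> costs a factor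
  \<open>exp (a \<bar>\<delta>\<bar> s) \<le> exp (s / 2)\<close>, paid by \<open>exp (- s)\<close>;
  the remaining \<open>exp (- s / 2)\<close> has integral 2, hence the constant
  \<open>2 * C\<close>. The rate \<open>a\<close> is kept, so one rate serves a whole list of
  averages.\<close>

lemma exp_decay_exp_smooth:
  assumes G: "exp_decay a C G" and \<delta>: "a * \<bar>\<delta>\<bar> \<le> 1 / 2"
  shows "exp_decay a (2 * C) (exp_smooth \<delta> G)"
proof -
  have a: "a > 0" and C: "C > 0" and le: "\<bar>G x\<bar> \<le> C * exp (- a * \<bar>x\<bar>)"
    and lip: "\<bar>G x - G y\<bar> \<le> C * \<bar>x - y\<bar> * (exp (- a * \<bar>x\<bar>) + exp (- a * \<bar>y\<bar>))" for x y
    using G by (auto simp: exp_decay_def)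
  have cont: "continuous_on UNIV G" using G by (rule exp_decay_continuous)
  have int: "integrable lborel (\<lambda>s. indicator {0..} s * (exp (- s) * G (x - \<delta> * s)))" for x
    by (rule exp_smooth_integrable[OF cont le]) (use a \<delta> in simp)
  have e: "exp (- s) * exp (- a * \<bar>x - \<delta> * s\<bar>) \<le> exp (- a * \<bar>x\<bar>) * exp (- (1 / 2) * s)" if "s \<ge> 0" for s x
  proof -
    have "a * \<bar>x\<bar> \<le> a * (\<bar>x - \<delta> * s\<bar> + \<bar>\<delta>\<bar> * s)"
      using a that abs_triangle_ineq2[of x "\<delta> * s"] by (intro mult_left_mono) (auto simp: abs_mult)
    moreover have "a * \<bar>\<delta>\<bar> * s \<le> 1 / 2 * s" using \<delta> that by (rule mult_right_mono)
    ultimately show ?thesis by (simp add: exp_add[symmetric] algebra_simps)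
  qed
  note hb = has_bochner_integral_exp_Ici[of "1 / 2" 0]
  have bound: "\<bar>LINT s|lborel. indicator {0..} s * f s\<bar> \<le> 2 * D"
    if "integrable lborel (\<lambda>s. indicator {0..} s * f s)" "\<And>s. s \<ge> 0 \<Longrightarrow> \<bar>f s\<bar> \<le> D * exp (- (1 / 2) * s)"
    for f :: "real \<Rightarrow> real" and D
  proof -
    have "\<bar>LINT s|lborel. indicator {0..} s * f s\<bar> \<le> (LINT s|lborel. D * (indicator {0..} s * exp (- (1 / 2) * s)))"
    proof (rule order.trans[OF integral_abs_bound], rule integral_mono)
      show "integrable lborel (\<lambda>s. \<bar>indicator {0..} s * f s\<bar>)"
        using that(1) by (rule integrable_abs)
      show "integrable lborel (\<lambda>s. D * (indicator {0..} s * exp (- (1 / 2) * s)))"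
        using hb by (intro integrable_mult_right) (auto intro: integrable.intros)
      show "\<bar>indicator {0..} s * f s\<bar> \<le> D * (indicator {0..} s * exp (- (1 / 2) * s))" for s
        using that(2)[of s] by (auto simp: indicator_def)
    qed
    also have "\<dots> = D * 2"
      using hb by (simp add: has_bochner_integral_iff)
    finally show ?thesis by simp
  qed
  have "\<bar>exp_smooth \<delta> G x\<bar> \<le> 2 * (C * exp (- a * \<bar>x\<bar>))" for x
    unfolding exp_smooth_def
  proof (rule bound[OF int])
    fix s :: real assume s: "s \<ge> 0"
    have "\<bar>exp (- s) * G (x - \<delta> * s)\<bar> \<le> exp (- s) * (C * exp (- a * \<bar>x - \<delta> * s\<bar>))"
      unfolding abs_mult using le by (auto intro: mult_left_mono)
    also have "\<dots> \<le> C * (exp (- a * \<bar>x\<bar>) * exp (- (1 / 2) * s))"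
      using mult_left_mono[OF e[OF s, of x], of C] C by (simp add: mult_ac)
    finally show "\<bar>exp (- s) * G (x - \<delta> * s)\<bar> \<le> C * exp (- a * \<bar>x\<bar>) * exp (- (1 / 2) * s)"
      by (simp add: mult_ac)
  qed
  moreover have "\<bar>exp_smooth \<delta> G x - exp_smooth \<delta> G y\<bar> \<le> 2 * (C * \<bar>x - y\<bar> * (exp (- a * \<bar>x\<bar>) + exp (- a * \<bar>y\<bar>)))" for x y
  proof -
    have eq: "(\<lambda>s. indicator {0..} s * (exp (- s) * G (x - \<delta> * s)) - indicator {0..} s * (exp (- s) * G (y - \<delta> * s)))
       = (\<lambda>s. indicator {0..} s * (exp (- s) * (G (x - \<delta> * s) - G (y - \<delta> * s))))"
      by (auto simp: algebra_simps)
    have "exp_smooth \<delta> G x - exp_smooth \<delta> G y =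
        (LINT s|lborel. indicator {0..} s * (exp (- s) * (G (x - \<delta> * s) - G (y - \<delta> * s))))"
      unfolding exp_smooth_def by (subst Bochner_Integration.integral_diff[symmetric, OF int int]) (simp only: eq)
    also have "\<bar>\<dots>\<bar> \<le> 2 * (C * \<bar>x - y\<bar> * (exp (- a * \<bar>x\<bar>) + exp (- a * \<bar>y\<bar>)))"
    proof (rule bound)
      show "integrable lborel (\<lambda>s. indicator {0..} s * (exp (- s) * (G (x - \<delta> * s) - G (y - \<delta> * s))))"
        using Bochner_Integration.integrable_diff[OF int[of x] int[of y]] unfolding eq .
      fix s :: real assume s: "s \<ge> 0"
      have "\<bar>exp (- s) * (G (x - \<delta> * s) - G (y - \<delta> * s))\<bar>
         \<le> exp (- s) * (C * \<bar>x - y\<bar> * (exp (- a * \<bar>x - \<delta> * s\<bar>) + exp (- a * \<bar>y - \<delta> * s\<bar>)))"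
        unfolding abs_mult using lip[of "x - \<delta> * s" "y - \<delta> * s"] by (auto intro: mult_left_mono)
      also have "\<dots> = C * \<bar>x - y\<bar> * (exp (- s) * exp (- a * \<bar>x - \<delta> * s\<bar>) + exp (- s) * exp (- a * \<bar>y - \<delta> * s\<bar>))"
        by (simp add: algebra_simps)
      also have "\<dots> \<le> C * \<bar>x - y\<bar> * (exp (- a * \<bar>x\<bar>) * exp (- (1 / 2) * s) + exp (- a * \<bar>y\<bar>) * exp (- (1 / 2) * s))"
        using C by (intro mult_left_mono add_mono e s) auto
      finally show "\<bar>exp (- s) * (G (x - \<delta> * s) - G (y - \<delta> * s))\<bar>
          \<le> C * \<bar>x - y\<bar> * (exp (- a * \<bar>x\<bar>) + exp (- a * \<bar>y\<bar>)) * exp (- (1 / 2) * s)"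
        by (simp add: algebra_simps)
    qed
    finally show ?thesis .
  qed
  ultimately show ?thesis using a C by (simp add: exp_decay_def mult.assoc)
qed

text \<open>Substituting \<open>s \<mapsto> s + (y - x) / \<delta>\<close> shows that both values are tails of one and the same integral.\<close>

lemma exp_smooth_rolle:
  fixes F :: "real \<Rightarrow> real"
  assumes cont: "continuous_on UNIV F" and le: "\<And>x. \<bar>F x\<bar> \<le> K * exp (b * \<bar>x\<bar>)" and b\<delta>: "\<bar>b\<bar> * \<bar>\<delta>\<bar> < 1"
    and \<delta>: "\<delta> \<noteq> 0" and "x < y" and zero: "exp_smooth \<delta> F x = 0" "exp_smooth \<delta> F y = 0"
  shows "\<exists>u>x. u < y \<and> F u = 0"
proof -
  define h where "h = (y - x) / \<delta>"
  define W where "W s = exp (- s) * F (x - \<delta> * s)" for s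
  define T where "T t = (LINT s|lborel. indicator {t..} s * W s)" for t
  have contW: "continuous_on A W" for A
    unfolding W_def by (intro continuous_intros continuous_on_compose2[OF cont, of A "\<lambda>s. x - \<delta> * s"]) auto
  have int: "integrable lborel (\<lambda>s. indicator {t..} s * W s)" for t
    unfolding W_def by (rule exp_smooth_integrable[OF cont le b\<delta>])
  have T0: "T 0 = 0" using zero(1) by (simp add: T_def W_def exp_smooth_def)
  have Th: "T (- h) = 0"
  proof -
    have "exp_smooth \<delta> F y = (LINT s|lborel. indicator {0..} (h + 1 * s) * (exp (- (h + 1 * s)) * F (y - \<delta> * (h + 1 * s))))"
      unfolding exp_smooth_def by (subst lborel_integral_real_affine[where c = 1 and t = h]) auto
    also have "\<dots> = (LINT s|lborel. exp (- h) * (indicator {- h..} s * W s))"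
    proof (rule Bochner_Integration.integral_cong)
      fix s
      have "\<delta> * h = y - x" using \<delta> by (simp add: h_def)
      then have "y - \<delta> * (h + s) = x - \<delta> * s" by (simp add: distrib_left)
      then show "indicator {0..} (h + 1 * s) * (exp (- (h + 1 * s)) * F (y - \<delta> * (h + 1 * s))) =
          exp (- h) * (indicator {- h..} s * W s)"
        by (auto simp: W_def indicator_def exp_add[symmetric])
    qed simp
    also have "\<dots> = exp (- h) * T (- h)" by (simp add: T_def)
    finally show ?thesis using zero(2) by simp
  qed
  \<comment> \<open>\<open>T p - T q\<close> is the integral of \<open>W\<close> from
    \<open>p\<close> to \<open>q\<close>. Equal tails therefore give the primitive \<open>I\<close>
    equal values at the endpoints, and the classical theorem of Rolle applies to
    \<open>I\<close>.\<close>
  have root: "\<exists>s>p. s < q \<and> W s = 0" if "p < q" "T p = 0" "T q = 0" for p q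
  proof -
    define I where "I t = integral {p..t} W" for t
    have "I q = T p - T q"
    proof -
      have "set_integrable lborel {p..q} W"
        unfolding real_scaleR_def by (rule borel_integrable_atLeastAtMost') (rule contW)
      then have "I q = (LINT s|lborel. indicator {p..q} s * W s)"
        unfolding I_def by (simp add: set_borel_integral_eq_integral(2)[symmetric] set_lebesgue_integral_def)
      also have "\<dots> = (LINT s|lborel. indicator {p..} s * W s - indicator {q..} s * W s)"
      proof (rule integral_cong_AE)
        show "(\<lambda>s. indicator {p..q} s * W s) \<in> borel_measurable lborel"
          using contW[of UNIV, THEN borel_measurable_continuous_onI] by measurable
        show "(\<lambda>s. indicator {p..} s * W s - indicator {q..} s * W s) \<in> borel_measurable lborel"
          using contW[of UNIV, THEN borel_measurable_continuous_onI] by measurable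
        have "AE s in lborel. s \<noteq> q" by (rule AE_lborel_singleton)
        then show "AE s in lborel. indicator {p..q} s * W s = indicator {p..} s * W s - indicator {q..} s * W s"
          by eventually_elim (use \<open>p < q\<close> in \<open>auto simp: indicator_def\<close>)
      qed
      also have "\<dots> = T p - T q"
        unfolding T_def by (rule Bochner_Integration.integral_diff[OF int int])
      finally show ?thesis .
    qed
    then have "I p = I q" using that by (simp add: I_def)
    moreover have der: "(I has_real_derivative W t) (at t within {p..q})" if "t \<in> {p..q}" for t
      unfolding I_def using that contW by (rule integral_has_real_derivative[rotated])
    have "continuous_on {p..q} I"
      by (rule DERIV_continuous_on) (rule der)
    moreover have der': "(I has_real_derivative W t) (at t)" if "p < t" "t < q" for t
    proof -
      have "t \<in> interior {p..q}" using that by simp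
      then show ?thesis using der[of t] that at_within_interior[of t "{p..q}"] by simp
    qed
    ultimately obtain s where s: "p < s" "s < q" "DERIV I s :> 0"
      using Rolle[OF \<open>p < q\<close>, of I] by (auto simp: real_differentiable_def)
    then have "W s = 0" using DERIV_unique[OF der'[OF s(1,2)] s(3)] by simp
    then show ?thesis using s by blast
  qed
  have "h \<noteq> 0" using \<delta> \<open>x < y\<close> by (simp add: h_def)
  then have "- h < 0 \<or> 0 < - h" by auto
  then obtain s where s: "W s = 0" "(- h < s \<and> s < 0) \<or> (0 < s \<and> s < - h)"
    using root[of "- h" 0] root[of 0 "- h"] T0 Th by blast
  have "\<delta> * h = y - x" using \<delta> by (simp add: h_def)
  have "x < x - \<delta> * s \<and> x - \<delta> * s < y"
  proof (cases "\<delta> > 0")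
    case True
    then have "h > 0" using \<open>x < y\<close> by (simp add: h_def)
    with s have "- h < s" "s < 0" by auto
    then have "\<delta> * (- h) < \<delta> * s" "\<delta> * s < 0"
      using True mult_strict_left_mono[of "- h" s \<delta>] by (auto simp: mult_less_0_iff)
    then show ?thesis using \<open>\<delta> * h = y - x\<close> by auto
  next
    case False
    with \<delta> have "\<delta> < 0" by simp
    then have "h < 0" using \<open>x < y\<close> by (simp add: h_def divide_pos_neg)
    with s have "s < - h" "0 < s" by auto
    then have "\<delta> * (- h) < \<delta> * s" "\<delta> * s < 0"
      using \<open>\<delta> < 0\<close> mult_strict_left_mono_neg[of s "- h" \<delta>] by (auto simp: mult_less_0_iff)
    then show ?thesis using \<open>\<delta> * h = y - x\<close> by auto
  qed
  then show ?thesis using s(1) by (intro exI[of _ "x - \<delta> * s"]) (auto simp: W_def)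
qed

text \<open>Each gap between consecutive points of \<open>S\<close> contains a zero of
  \<open>F\<close>, so one zero is lost and the interval is kept. The induction removes the largest
  point \<open>y\<close>: the zeros found for the rest lie at or below the next point
  \<open>x\<close>, the new one strictly between \<open>x\<close> and \<open>y\<close>. For
  \<open>\<delta> = 0\<close> the average is the identity and one point is dropped.\<close>

lemma exp_smooth_zeros:
  fixes F :: "real \<Rightarrow> real"
  assumes cont: "continuous_on UNIV F" and le: "\<And>x. \<bar>F x\<bar> \<le> K * exp (b * \<bar>x\<bar>)" and b\<delta>: "\<bar>b\<bar> * \<bar>\<delta>\<bar> < 1"
    and "finite S" "card S = Suc m" "S \<subseteq> {p..q}" "\<And>x. x \<in> S \<Longrightarrow> exp_smooth \<delta> F x = 0"
  shows "\<exists>S'. finite S' \<and> card S' = m \<and> S' \<subseteq> {p..q} \<and> (\<forall>x\<in>S'. F x = 0)"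
proof (cases "\<delta> = 0")
  case True
  have "exp_smooth 0 F z = F z" for z
    using has_bochner_integral_exp_Ici[of 1 0]
    by (simp add: exp_smooth_def mult.assoc[symmetric] has_bochner_integral_iff)
  moreover obtain S' where "S' \<subseteq> S" "card S' = m"
    using assms(5) obtain_subset_with_card_n[of m S] by auto
  moreover from this have "finite S'" using assms(4) finite_subset by blast
  ultimately show ?thesis
    using assms(6,7) True by (intro exI[of _ S']) auto
next
  case False
  show ?thesis
  using assms(4-)
proof (induction m arbitrary: S q)
  case 0
  then show ?case by (intro exI[of _ "{}"]) auto
next
  case (Suc m)
  define y where "y = Max S"
  have ne: "S \<noteq> {}" "S - {y} \<noteq> {}"
  proof -
    show "S \<noteq> {}" using Suc.prems by auto
    then have "card (S - {y}) = Suc m" using Suc.prems by (simp add: y_def)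
    then show "S - {y} \<noteq> {}" by (metis card.empty nat.distinct(1))
  qed
  have y: "y \<in> S" using ne Suc.prems by (simp add: y_def)
  define x where "x = Max (S - {y})"
  have x: "x \<in> S - {y}" using ne Suc.prems unfolding x_def by (intro Max_in) auto
  have "x \<le> y" using x Suc.prems by (simp add: y_def)
  with x have "x < y" by simp
  have "S - {y} \<subseteq> {p..x}"
  proof
    fix z assume z: "z \<in> S - {y}"
    then have "z \<le> x" unfolding x_def using Suc.prems(1) by (intro Max_ge) auto
    moreover have "z \<in> {p..q}" using z Suc.prems(3) by blast
    ultimately show "z \<in> {p..x}" by simp
  qed
  moreover have "card (S - {y}) = Suc m" using Suc.prems y by simp
  ultimately obtain S' where S': "finite S'" "card S' = m" "S' \<subseteq> {p..x}" "\<forall>x\<in>S'. F x = 0"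
    using Suc.IH[of "S - {y}" x] Suc.prems by auto
  have "exp_smooth \<delta> F x = 0" "exp_smooth \<delta> F y = 0" using Suc.prems(4) x y by auto
  from exp_smooth_rolle[OF cont le b\<delta> False \<open>x < y\<close> this]
  obtain u where u: "x < u" "u < y" "F u = 0" by blast
  have "u \<notin> S'" using S'(3) u(1) by auto
  moreover have "x \<in> {p..q}" "y \<in> {p..q}" using x y Suc.prems(3) by auto
  moreover from this have "u \<in> {p..q}" using u by auto
  moreover have "S' \<subseteq> {p..q}"
  proof
    fix z assume "z \<in> S'"
    with S'(3) have "p \<le> z" "z \<le> x" by auto
    with \<open>x \<in> {p..q}\<close> show "z \<in> {p..q}" by auto
  qed
  ultimately show ?case using S' u(3)
    by (intro exI[of _ "insert u S'"]) simp
qed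
qed

section \<open>Combinations of integer shifts of a kernel\<close>

text \<open>Normalised to have the Fourier transform \<open>exp (- c \<xi>^2)\<close>, see
  \<open>ft_gauss\<close>. The exponent in space is \<open>pi^2 / c\<close>, and this number takes
  the role of \<open>c\<close> in the Laurent series.\<close>

definition gauss :: "real \<Rightarrow> real \<Rightarrow> real" where
  "gauss c x = sqrt (pi / c) * exp (- (pi\<^sup>2 / c) * x\<^sup>2)"

definition tp_kernel :: "real \<Rightarrow> real list \<Rightarrow> real \<Rightarrow> real" where
  "tp_kernel c ds = foldr exp_smooth ds (gauss c)"

text \<open>Close points use the mean value theorem, where \<open>exp a\<close> pays for moving the
  decay from the intermediate point to an endpoint at distance at most 1. Distant points use the
  triangle inequality, since there \<open>\<bar>x - y\<bar> > 1\<close> may be inserted as a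
  factor.\<close>

lemma exp_decayI:
  assumes "a > 0" "C > 0" and le: "\<And>x. \<bar>G x\<bar> \<le> C * exp (- a * \<bar>x\<bar>)"
    and der: "\<And>x. (G has_real_derivative G' x) (at x)" and le': "\<And>x. \<bar>G' x\<bar> \<le> C * exp (- a * \<bar>x\<bar>)"
  shows "exp_decay a (C * exp a) G"
proof -
  have C': "C \<le> C * exp a" using assms(1,2) by simp
  have "\<bar>G x - G y\<bar> \<le> C * exp a * \<bar>x - y\<bar> * (exp (- a * \<bar>x\<bar>) + exp (- a * \<bar>y\<bar>))" (is "_ \<le> C * exp a * \<bar>x - y\<bar> * ?E") for x y
  proof (cases "\<bar>x - y\<bar> \<le> 1")
    case False
    have "\<bar>G x - G y\<bar> \<le> C * 1 * ?E"
      using le[of x] le[of y] by (simp add: distrib_left abs_if split: if_splits)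
    also have "\<dots> \<le> (C * exp a) * \<bar>x - y\<bar> * ?E"
      using C' False \<open>C > 0\<close> by (intro mult_right_mono mult_mono) auto
    finally show ?thesis .
  next
    case True
    have *: "\<bar>G x - G y\<bar> \<le> C * exp a * \<bar>x - y\<bar> * exp (- a * \<bar>x\<bar>)" if "x < y" "\<bar>x - y\<bar> \<le> 1" for x y
    proof -
      obtain z where z: "x < z" "z < y" "G y - G x = (y - x) * G' z"
        using MVT2[OF \<open>x < y\<close>, of G G'] der by blast
      have "a * \<bar>x\<bar> \<le> a * (\<bar>z\<bar> + 1)" using that z(1,2) \<open>a > 0\<close> by (intro mult_left_mono) auto
      then have "exp (- a * \<bar>z\<bar>) \<le> exp a * exp (- a * \<bar>x\<bar>)"
        by (simp add: exp_add[symmetric] algebra_simps)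
      then have "\<bar>G' z\<bar> \<le> C * (exp a * exp (- a * \<bar>x\<bar>))"
        using le'[of z] \<open>C > 0\<close> by (meson order.trans mult_left_mono less_imp_le)
      then have "\<bar>x - y\<bar> * \<bar>G' z\<bar> \<le> \<bar>x - y\<bar> * (C * (exp a * exp (- a * \<bar>x\<bar>)))"
        by (rule mult_left_mono) simp
      moreover have "\<bar>G x - G y\<bar> = \<bar>x - y\<bar> * \<bar>G' z\<bar>"
        by (metis z(3) abs_minus_commute abs_mult)
      ultimately show ?thesis by (simp add: mult_ac)
    qed
    have "C * exp a * \<bar>x - y\<bar> * exp (- a * \<bar>x\<bar>) \<le> C * exp a * \<bar>x - y\<bar> * ?E"
      "C * exp a * \<bar>x - y\<bar> * exp (- a * \<bar>y\<bar>) \<le> C * exp a * \<bar>x - y\<bar> * ?E"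
      using \<open>C > 0\<close> by (auto intro!: mult_left_mono)
    moreover have "\<bar>G x - G y\<bar> \<le> C * exp a * \<bar>x - y\<bar> * exp (- a * \<bar>x\<bar>) \<or> \<bar>G x - G y\<bar> \<le> C * exp a * \<bar>x - y\<bar> * exp (- a * \<bar>y\<bar>)"
      using *[of x y] *[of y x] True by (cases x y rule: linorder_cases) (auto simp: abs_minus_commute)
    ultimately show ?thesis by linarith
  qed
  moreover have "\<bar>G x\<bar> \<le> C * exp a * exp (- a * \<bar>x\<bar>)" for x
    using le[of x] mult_right_mono[OF C', of "exp (- a * \<bar>x\<bar>)"] by simp
  ultimately show ?thesis using assms(1,2) by (simp add: exp_decay_def)
qed

text \<open>The Gaussian admits every rate \<open>a\<close>, so the rate of a kernel is dictated
  only by the averages applied afterwards.\<close>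

lemma exp_decay_gauss:
  assumes "c > 0" "a > 0"
  shows "\<exists>C. exp_decay a C (gauss c)"
proof -
  define k where "k = pi\<^sup>2 / c"
  define q where "q = sqrt (pi / c)"
  have pos: "k > 0" "q > 0" using assms by (auto simp: k_def q_def)
  define D where "D = exp ((a + 1 + 1)\<^sup>2 / (4 * k))"
  have D: "exp ((a + 1) * \<bar>x\<bar> - k * x\<^sup>2) \<le> D" for x
  proof -
    have "exp ((a + 1) * \<bar>x\<bar> - k * \<bar>x\<bar>\<^sup>2) \<le> D * exp (- \<bar>\<bar>x\<bar>\<bar>)"
      using exp_linear_minus_square_le[OF pos(1), of "a + 1" "\<bar>x\<bar>"] assms by (simp add: D_def)
    also have "\<dots> \<le> D * 1" by (intro mult_left_mono) (auto simp: D_def)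
    finally show ?thesis by simp
  qed
  define C where "C = q * D * (1 + 2 * k)"
  have "D > 0" by (simp add: D_def)
  then have C: "C > 0" using pos by (simp add: C_def)
  \<comment> \<open>\<open>1 + 2 k \<bar>x\<bar>\<close> covers the function and its derivative at
    once. It is absorbed by \<open>exp \<bar>x\<bar>\<close>, which is why \<open>D\<close> bounds
    the Gaussian against slope \<open>a + 1\<close>.\<close>
  have e: "(1 + 2 * k * \<bar>x\<bar>) * exp (- k * x\<^sup>2) \<le> (1 + 2 * k) * D * exp (- a * \<bar>x\<bar>)" for x
  proof -
    have "1 + 2 * k * \<bar>x\<bar> \<le> (1 + 2 * k) * (1 + \<bar>x\<bar>)" using pos by (simp add: algebra_simps)
    also have "\<dots> \<le> (1 + 2 * k) * exp \<bar>x\<bar>" using pos exp_ge_add_one_self by (intro mult_left_mono) auto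
    finally have "(1 + 2 * k * \<bar>x\<bar>) * exp (- k * x\<^sup>2) \<le> (1 + 2 * k) * exp \<bar>x\<bar> * exp (- k * x\<^sup>2)"
      by (rule mult_right_mono) simp
    also have "\<dots> = (1 + 2 * k) * (exp ((a + 1) * \<bar>x\<bar> - k * x\<^sup>2) * exp (- a * \<bar>x\<bar>))"
      by (simp add: exp_add[symmetric] algebra_simps)
    also have "\<dots> \<le> (1 + 2 * k) * (D * exp (- a * \<bar>x\<bar>))"
      using pos by (intro mult_left_mono mult_right_mono D) auto
    finally show ?thesis by simp
  qed
  have "exp_decay a (C * exp a) (gauss c)"
  proof (rule exp_decayI[where G' = "\<lambda>x. - 2 * k * x * (q * exp (- k * x\<^sup>2))"])
    fix x
    have le1: "exp (- k * x\<^sup>2) \<le> (1 + 2 * k * \<bar>x\<bar>) * exp (- k * x\<^sup>2)"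
      "2 * k * \<bar>x\<bar> * exp (- k * x\<^sup>2) \<le> (1 + 2 * k * \<bar>x\<bar>) * exp (- k * x\<^sup>2)"
      using pos by (auto simp: algebra_simps)
    show "\<bar>gauss c x\<bar> \<le> C * exp (- a * \<bar>x\<bar>)"
      using mult_left_mono[OF order.trans[OF le1(1) e], of q] pos
      by (simp add: gauss_def C_def abs_mult k_def[symmetric] q_def[symmetric] mult_ac)
    have "\<bar>- 2 * k * x * (q * exp (- k * x\<^sup>2))\<bar> = q * (2 * k * \<bar>x\<bar> * exp (- k * x\<^sup>2))"
      using pos by (simp add: abs_mult)
    also have "\<dots> \<le> q * ((1 + 2 * k) * D * exp (- a * \<bar>x\<bar>))"
      using pos by (intro mult_left_mono order.trans[OF le1(2) e]) auto
    finally show "\<bar>- 2 * k * x * (q * exp (- k * x\<^sup>2))\<bar> \<le> C * exp (- a * \<bar>x\<bar>)"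
      by (simp add: C_def mult_ac)
    show "(gauss c has_real_derivative - 2 * k * x * (q * exp (- k * x\<^sup>2))) (at x)"
      unfolding gauss_def[abs_def] k_def[symmetric] q_def[symmetric]
      by (auto intro!: derivative_eq_intros simp: power2_eq_square)
  qed (use assms C in auto)
  then show ?thesis by blast
qed

lemma exp_decay_tp_kernel:
  assumes "c > 0" "a > 0" "\<forall>\<delta>\<in>set ds. a * \<bar>\<delta>\<bar> \<le> 1 / 2"
  shows "\<exists>C. exp_decay a C (tp_kernel c ds)"
  using assms(3)
proof (induction ds)
  case Nil
  then show ?case using exp_decay_gauss[OF assms(1,2)] by (simp add: tp_kernel_def)
next
  case (Cons \<delta> ds)
  then obtain C where "exp_decay a C (tp_kernel c ds)" by auto
  from exp_decay_exp_smooth[OF this, of \<delta>] Cons.prems show ?case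
    by (auto simp: tp_kernel_def)
qed

definition shift_sum :: "(int \<Rightarrow> real) \<Rightarrow> (real \<Rightarrow> real) \<Rightarrow> real \<Rightarrow> real" where
  "shift_sum d G x = (LINT k|count_space UNIV. d k * G (x + of_int k))"

text \<open>By \<open>\<bar>k\<bar> \<le> \<bar>x\<bar> + \<bar>x + k\<bar>\<close>, the growth
  \<open>b\<close> of the coefficients turns partly into growth of the sum in \<open>x\<close> and
  partly into a loss of decay, from \<open>a\<close> to \<open>a - b\<close>.\<close>

lemma shift_sum_nn:
  assumes G: "exp_decay a C G" and d: "\<And>k. \<bar>d k\<bar> \<le> D * exp (b * \<bar>real_of_int k\<bar>)" and b: "0 \<le> b" "b < a"
  shows "\<bar>d k * G (x + of_int k)\<bar> \<le> D * C * exp (b * \<bar>x\<bar>) * exp (- (a - b) * \<bar>x - (- real_of_int k)\<bar>)"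
    and "(\<integral>\<^sup>+k. ennreal \<bar>d k * G (x + of_int k)\<bar> \<partial>count_space UNIV) \<le> ennreal (D * C * exp (b * \<bar>x\<bar>) * sep_const (a - b) 1)"
proof -
  have C: "C > 0" and le: "\<bar>G x\<bar> \<le> C * exp (- a * \<bar>x\<bar>)" for x
    using G by (auto simp: exp_decay_def)
  have D: "D \<ge> 0" using d[of 0] abs_ge_zero[of "d 0"] by simp
  show *: "\<bar>d k * G (x + of_int k)\<bar> \<le> D * C * exp (b * \<bar>x\<bar>) * exp (- (a - b) * \<bar>x - (- real_of_int k)\<bar>)" for k
  proof -
    have "b * \<bar>real_of_int k\<bar> \<le> b * (\<bar>x\<bar> + \<bar>x + real_of_int k\<bar>)"
      using b by (intro mult_left_mono) auto
    then have e: "exp (b * \<bar>real_of_int k\<bar>) * exp (- a * \<bar>x + of_int k\<bar>) \<le> exp (b * \<bar>x\<bar>) * exp (- (a - b) * \<bar>x + real_of_int k\<bar>)"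
      by (simp add: exp_add[symmetric] algebra_simps)
    have "\<bar>d k * G (x + of_int k)\<bar> \<le> (D * exp (b * \<bar>real_of_int k\<bar>)) * (C * exp (- a * \<bar>x + of_int k\<bar>))"
      unfolding abs_mult using D by (intro mult_mono d le) auto
    also have "\<dots> = D * C * (exp (b * \<bar>real_of_int k\<bar>) * exp (- a * \<bar>x + of_int k\<bar>))" by simp
    also have "\<dots> \<le> D * C * (exp (b * \<bar>x\<bar>) * exp (- (a - b) * \<bar>x + real_of_int k\<bar>))"
      using C D by (intro mult_left_mono e) auto
    finally show ?thesis by (simp add: mult.assoc)
  qed
  let ?E = "D * C * exp (b * \<bar>x\<bar>)"
  have E: "?E \<ge> 0" using C D by simp
  have "(\<integral>\<^sup>+k. ennreal \<bar>d k * G (x + of_int k)\<bar> \<partial>count_space UNIV)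
     \<le> (\<integral>\<^sup>+k. ennreal ?E * ennreal (exp (- (a - b) * \<bar>x - (- real_of_int k)\<bar>)) \<partial>count_space UNIV)"
    using * E by (intro nn_integral_mono) (simp add: ennreal_mult[symmetric] ennreal_leI)
  also have "\<dots> = ennreal ?E * (\<integral>\<^sup>+k. ennreal (exp (- (a - b) * \<bar>x - (- real_of_int k)\<bar>)) \<partial>count_space UNIV)"
    by (rule nn_integral_cmult) simp
  also have "\<dots> \<le> ennreal ?E * ennreal (sep_const (a - b) 1)"
    using b by (intro mult_left_mono separated_exp_sum) auto
  also have "\<dots> = ennreal (?E * sep_const (a - b) 1)"
    using E sep_const_pos[of "a - b" 1] b by (simp add: ennreal_mult)
  finally show "(\<integral>\<^sup>+k. ennreal \<bar>d k * G (x + of_int k)\<bar> \<partial>count_space UNIV) \<le> ennreal (?E * sep_const (a - b) 1)" .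
qed

lemma shift_sum_integrable:
  assumes "exp_decay a C G" "\<And>k. \<bar>d k\<bar> \<le> D * exp (b * \<bar>real_of_int k\<bar>)" "0 \<le> b" "b < a"
  shows "integrable (count_space UNIV) (\<lambda>k. d k * G (x + of_int k))"
proof (rule integrableI_bounded)
  show "(\<integral>\<^sup>+k. ennreal (norm (d k * G (x + of_int k))) \<partial>count_space UNIV) < \<infinity>"
    using shift_sum_nn(2)[OF assms, of x] by (simp add: le_less_trans)
qed simp

lemma shift_sum_le:
  assumes "exp_decay a C G" "\<And>k. \<bar>d k\<bar> \<le> D * exp (b * \<bar>real_of_int k\<bar>)" "0 \<le> b" "b < a"
  shows "\<bar>shift_sum d G x\<bar> \<le> D * C * sep_const (a - b) 1 * exp (b * \<bar>x\<bar>)"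
proof -
  have D: "D \<ge> 0" using assms(2)[of 0] abs_ge_zero[of "d 0"] by simp
  have "ennreal \<bar>shift_sum d G x\<bar> \<le> ennreal (D * C * exp (b * \<bar>x\<bar>) * sep_const (a - b) 1)"
    unfolding shift_sum_def
    using order.trans[OF norm_integral_le_nn_integral[of "count_space UNIV" "\<lambda>k. d k * G (x + of_int k)"]] shift_sum_nn(2)[OF assms, of x]
    by simp
  moreover have "D * C * exp (b * \<bar>x\<bar>) * sep_const (a - b) 1 \<ge> 0"
    using D assms(1) sep_const_pos[of "a - b" 1] assms(4) by (auto simp: exp_decay_def)
  ultimately show ?thesis by (simp add: mult_ac)
qed

text \<open>Coefficients and argument move simultaneously, as they do in the compactness argument.
  The convergent sequence \<open>x\<close> is bounded by some \<open>X\<close>, and moving the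
  centre of decay by at most \<open>X\<close> gives the summable majorant \<open>w\<close>.\<close>

lemma shift_sum_tendsto:
  assumes G: "exp_decay a C G" and d: "\<And>n k. \<bar>d n k\<bar> \<le> D * exp (b * \<bar>real_of_int k\<bar>)" and b: "0 \<le> b" "b < a"
    and lim: "\<And>k. (\<lambda>n. d n k) \<longlonglongrightarrow> e k" "x \<longlonglongrightarrow> y"
  shows "(\<lambda>n. shift_sum (d n) G (x n)) \<longlonglongrightarrow> shift_sum e G y"
proof -
  have C: "C > 0" and a: "a > 0" using G by (auto simp: exp_decay_def)
  have D: "D \<ge> 0" using d[of 0 0] abs_ge_zero[of "d 0 0"] by simp
  obtain X where X: "\<And>n. \<bar>x n\<bar> \<le> X"
    using convergent_imp_Bseq[of x] lim(2) unfolding convergent_def Bseq_def by auto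
  define w where "w k = D * C * exp (b * X) * (exp ((a - b) * X) * exp (- (a - b) * \<bar>real_of_int k\<bar>))" for k :: int
  show ?thesis
    unfolding shift_sum_def
  proof (rule integral_dominated_convergence[where w = w])
    show "integrable (count_space UNIV) w"
    proof -
      have "integrable (count_space UNIV) (\<lambda>k. exp (- (a - b) * \<bar>0 - real_of_int k\<bar>))"
      proof (rule integrableI_bounded)
        have "(\<integral>\<^sup>+k. ennreal (exp (- (a - b) * \<bar>0 - real_of_int k\<bar>)) \<partial>count_space UNIV) \<le> ennreal (sep_const (a - b) 1)"
          by (rule separated_exp_sum) (use b in auto)
        from le_less_trans[OF this ennreal_less_top]
        show "(\<integral>\<^sup>+k. ennreal (norm (exp (- (a - b) * \<bar>0 - real_of_int k\<bar>))) \<partial>count_space UNIV) < \<infinity>" by simp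
      qed simp
      then show ?thesis unfolding w_def by (intro integrable_mult_right) simp
    qed
    have "isCont G y" using exp_decay_continuous[OF G] by (simp add: continuous_on_eq_continuous_at)
    then show "AE k in count_space UNIV. (\<lambda>n. d n k * G (x n + of_int k)) \<longlonglongrightarrow> e k * G (y + of_int k)"
      using exp_decay_continuous[OF G]
      by (intro AE_I2 tendsto_mult lim isCont_tendsto_compose[of _ G] tendsto_add tendsto_const)
        (auto simp: continuous_on_eq_continuous_at)
    show "AE k in count_space UNIV. norm (d n k * G (x n + of_int k)) \<le> w k" for n
    proof (rule AE_I2)
      fix k :: int
      have "\<bar>d n k * G (x n + of_int k)\<bar> \<le> D * C * exp (b * \<bar>x n\<bar>) * exp (- (a - b) * \<bar>x n - (- real_of_int k)\<bar>)"
        by (rule shift_sum_nn(1)[OF G d b])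
      also have "\<dots> \<le> D * C * exp (b * X) * (exp ((a - b) * X) * exp (- (a - b) * \<bar>real_of_int k\<bar>))"
      proof (intro mult_mono)
        have "(a - b) * \<bar>real_of_int k\<bar> \<le> (a - b) * (X + \<bar>x n - (- real_of_int k)\<bar>)"
          using b X[of n] by (intro mult_left_mono) auto
        then show "exp (- (a - b) * \<bar>x n - (- real_of_int k)\<bar>) \<le> exp ((a - b) * X) * exp (- (a - b) * \<bar>real_of_int k\<bar>)"
          by (simp add: exp_add[symmetric] algebra_simps)
      qed (use b X[of n] C D in \<open>auto intro!: mult_left_mono\<close>)
      finally show "norm (d n k * G (x n + of_int k)) \<le> w k" by (simp add: w_def)
    qed
  qed auto
qed

lemma shift_sum_continuous:
  assumes "exp_decay a C G" "\<And>k. \<bar>d k\<bar> \<le> D * exp (b * \<bar>real_of_int k\<bar>)" "0 \<le> b" "b < a"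
  shows "continuous_on UNIV (shift_sum d G)"
  unfolding continuous_on_sequentially comp_def
  using shift_sum_tendsto[OF assms(1), of "\<lambda>_. d" D b d] assms by simp

text \<open>Averaging commutes with translations and, by Fubini, with the infinite sum. The absolute
  integrability behind Fubini is integrability of the same sum formed with
  \<open>\<bar>d k\<bar>\<close> and \<open>\<bar>G\<bar>\<close>.\<close>

lemma shift_sum_exp_smooth:
  assumes G: "exp_decay a C G" and \<delta>: "a * \<bar>\<delta>\<bar> \<le> 1 / 2"
    and d: "\<And>k. \<bar>d k\<bar> \<le> D * exp (b * \<bar>real_of_int k\<bar>)" and b: "0 \<le> b" "b < a"
  shows "shift_sum d (exp_smooth \<delta> G) = exp_smooth \<delta> (shift_sum d G)"
proof
  fix x
  have cont: "continuous_on UNIV G" using G by (rule exp_decay_continuous)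
  then have [measurable]: "G \<in> borel_measurable borel" by (rule borel_measurable_continuous_onI)
  have Gabs: "exp_decay a C (\<lambda>x. \<bar>G x\<bar>)"
    using G unfolding exp_decay_def by (auto intro: order.trans[OF abs_triangle_ineq3])
  have le: "\<bar>\<bar>G x\<bar>\<bar> \<le> C * exp (- a * \<bar>x\<bar>)" "\<bar>G x\<bar> \<le> C * exp (- a * \<bar>x\<bar>)" for x using G by (auto simp: exp_decay_def)
  have ad: "\<bar>- a\<bar> * \<bar>\<delta>\<bar> < 1" using \<delta> G by (simp add: exp_decay_def)
  have contabs: "continuous_on UNIV (\<lambda>x. \<bar>G x\<bar>)" using cont by (intro continuous_intros)
  interpret pair_sigma_finite "count_space (UNIV :: int set)" "lborel :: real measure"
    by (intro pair_sigma_finite.intro sigma_finite_measure_count_space lborel.sigma_finite_measure_axioms)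
  define f where "f k s = d k * (indicator {0..} s * (exp (- s) * G (x + of_int k - \<delta> * s)))" for k s
  have fm: "f k \<in> borel_measurable lborel" for k unfolding f_def by measurable
  have "integrable (count_space UNIV \<Otimes>\<^sub>M lborel) (\<lambda>(k, s). f k s)"
  proof (rule Fubini_integrable)
    show "(\<lambda>(k, s). f k s) \<in> borel_measurable (count_space UNIV \<Otimes>\<^sub>M lborel)"
      using fm by (intro measurable_pair_measure_countable1) auto
    have "(LINT s|lborel. norm (f k s)) = \<bar>d k\<bar> * exp_smooth \<delta> (\<lambda>x. \<bar>G x\<bar>) (x + of_int k)" for k
      unfolding exp_smooth_def f_def by (simp add: abs_mult)
    then show "integrable (count_space UNIV) (\<lambda>k. LINT s|lborel. norm (case (k, s) of (k, s) \<Rightarrow> f k s))"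
      using shift_sum_integrable[OF exp_decay_exp_smooth[OF Gabs \<delta>], of "\<lambda>k. \<bar>d k\<bar>" D b x] d b by simp
    show "AE k in count_space UNIV. integrable lborel (\<lambda>s. case (k, s) of (k, s) \<Rightarrow> f k s)"
      unfolding f_def using exp_smooth_integrable[OF cont le(2) ad] by (intro AE_I2) simp
  qed
  from Fubini_integral[OF this]
  have "(LINT k|count_space UNIV. integral\<^sup>L lborel (f k)) = (LINT s|lborel. LINT k|count_space UNIV. f k s)"
    by simp
  moreover have "integral\<^sup>L lborel (f k) = d k * exp_smooth \<delta> G (x + of_int k)" for k
    unfolding f_def exp_smooth_def by simp
  moreover have "(LINT k|count_space UNIV. f k s) = indicator {0..} s * (exp (- s) * shift_sum d G (x - \<delta> * s))" for s
  proof -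
    have "f k s = indicator {0..} s * (exp (- s) * (d k * G ((x - \<delta> * s) + of_int k)))" for k
      by (simp add: f_def algebra_simps)
    then show ?thesis by (simp add: shift_sum_def)
  qed
  ultimately show "shift_sum d (exp_smooth \<delta> G) x = exp_smooth \<delta> (shift_sum d G) x"
    by (simp add: shift_sum_def[of d "exp_smooth \<delta> G"] exp_smooth_def[of \<delta> "shift_sum d G"])
qed

text \<open>Peels off one average at a time, each taking one zero from the interval independently of
  its length. The condition \<open>b < a\<close> also keeps the averages of the growing sums
  convergent, because it gives \<open>b \<bar>\<delta>\<bar> \<le> 1 / 2\<close>.\<close>

lemma tp_kernel_zeros_gauss:
  assumes "c > 0" "a > 0" "\<forall>\<delta>\<in>set ds. a * \<bar>\<delta>\<bar> \<le> 1 / 2"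
    and d: "\<And>k. \<bar>d k\<bar> \<le> D * exp (b * \<bar>real_of_int k\<bar>)" and b: "0 \<le> b" "b < a"
    and S: "finite S" "card S = N + length ds" "S \<subseteq> {p..q}" "\<And>x. x \<in> S \<Longrightarrow> shift_sum d (tp_kernel c ds) x = 0"
  shows "\<exists>S'. finite S' \<and> card S' = N \<and> S' \<subseteq> {p..q} \<and> (\<forall>x\<in>S'. shift_sum d (gauss c) x = 0)"
  using assms(3) S
proof (induction ds arbitrary: S)
  case Nil
  then show ?case by (intro exI[of _ S]) (auto simp: tp_kernel_def)
next
  case (Cons \<delta> ds)
  let ?F = "shift_sum d (tp_kernel c ds)"
  have ds: "\<forall>\<delta>\<in>set ds. a * \<bar>\<delta>\<bar> \<le> 1 / 2" using Cons.prems(1) by simp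
  obtain C where C: "exp_decay a C (tp_kernel c ds)"
    using exp_decay_tp_kernel[OF assms(1,2) ds] by blast
  have "shift_sum d (tp_kernel c (\<delta> # ds)) = exp_smooth \<delta> ?F"
    using shift_sum_exp_smooth[OF C _ d b, of \<delta>] Cons.prems by (simp add: tp_kernel_def)
  then have z: "exp_smooth \<delta> ?F x = 0" if "x \<in> S" for x
    using Cons.prems(5)[OF that] by simp
  have "\<bar>b\<bar> * \<bar>\<delta>\<bar> \<le> a * \<bar>\<delta>\<bar>" using b by (intro mult_right_mono) auto
  also have "\<dots> \<le> 1 / 2" using Cons.prems(1) by simp
  finally have bd: "\<bar>b\<bar> * \<bar>\<delta>\<bar> < 1" by simp
  have "card S = Suc (N + length ds)" using Cons.prems by simp
  from exp_smooth_zeros[OF shift_sum_continuous[OF C d b] shift_sum_le[OF C d b] bd Cons.prems(2) this Cons.prems(4) z]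
  obtain S' where "finite S'" "card S' = N + length ds" "S' \<subseteq> {p..q}" "\<forall>x\<in>S'. ?F x = 0" by blast
  then show ?case using Cons.IH[OF ds, of S'] by blast
qed

text \<open>The zeros are given in closed intervals of length \<open>B'\<close>, which are stable
  under limits; the gap \<open>B - B'\<close> places these inside the disjoint half-open cells used
  by \<open>gaussian_shifts_uniqueness\<close>. The inequality \<open>B < real N\<close> says that
  the density still exceeds 1 after \<open>length ds\<close> zeros per cell are lost.\<close>

theorem tp_kernel_uniqueness:
  assumes "c > 0" "a > 0" "\<forall>\<delta>\<in>set ds. a * \<bar>\<delta>\<bar> \<le> 1 / 2"
    and d: "\<And>k. \<bar>d k\<bar> \<le> D * exp (b * \<bar>real_of_int k\<bar>)" and b: "0 \<le> b" "b < a" and "d 0 = 1"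
    and B: "0 \<le> B'" "B' < B" "B < real N"
    and Z: "\<And>j. finite (Z j)" "\<And>j. card (Z j) = N + length ds"
      "\<And>j. Z j \<subseteq> {of_int j * B .. of_int j * B + B'}"
    and zero: "\<And>j x. x \<in> Z j \<Longrightarrow> shift_sum d (tp_kernel c ds) x = 0"
  shows False
proof -
  have "\<exists>S'. finite S' \<and> card S' = N \<and> S' \<subseteq> {of_int j * B .. of_int j * B + B'} \<and> (\<forall>x\<in>S'. shift_sum d (gauss c) x = 0)" for j
    by (rule tp_kernel_zeros_gauss[OF assms(1-3) d b Z zero])
  then obtain Z' where Z': "\<And>j. finite (Z' j)" "\<And>j. card (Z' j) = N" "\<And>j. Z' j \<subseteq> {of_int j * B .. of_int j * B + B'}"
    "\<And>j x. x \<in> Z' j \<Longrightarrow> shift_sum d (gauss c) x = 0"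
    by metis
  show False
  proof (rule gaussian_shifts_uniqueness[of "pi\<^sup>2 / c" b d D B N Z'])
    fix j x assume x: "x \<in> Z' j"
    show "of_int j * B \<le> x \<and> x < (of_int j + 1) * B"
      using Z'(3)[of j] x B by (auto simp: algebra_simps)
    have "shift_sum d (gauss c) x = (LINT k|count_space UNIV. sqrt (pi / c) * (d k * exp (- (pi\<^sup>2 / c) * (x + of_int k)\<^sup>2)))"
      unfolding shift_sum_def gauss_def by (simp add: mult_ac)
    also have "\<dots> = sqrt (pi / c) * (LINT k|count_space UNIV. d k * exp (- (pi\<^sup>2 / c) * (x + of_int k)\<^sup>2))"
      by simp
    finally show "(LINT k|count_space UNIV. d k * exp (- (pi\<^sup>2 / c) * (x + of_int k)\<^sup>2)) = 0"
      using Z'(4)[OF x] \<open>c > 0\<close> by simp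
  qed (use assms Z' in auto)
qed

section \<open>Sampling above the critical density\<close>

lemma bounded_diagonal_subsequence:
  fixes f :: "nat \<Rightarrow> 'i::countable \<Rightarrow> real"
  assumes "\<And>n i. \<bar>f n i\<bar> \<le> M i"
  shows "\<exists>r l. strict_mono r \<and> (\<forall>i. (\<lambda>n. f (r n) i) \<longlonglongrightarrow> l i)"
proof -
  let ?P = "\<lambda>m s. convergent (\<lambda>n. f (s n) (from_nat m))"
  interpret nat: subseqs ?P
  proof (unfold subseqs_def, intro allI impI)
    fix m and s :: "nat \<Rightarrow> nat" assume "strict_mono s"
    have "f (s n) (from_nat m) \<in> {- M (from_nat m)..M (from_nat m)}" for n
      using assms[of "s n" "from_nat m"] by (simp add: abs_le_iff)
    then obtain l s' where "strict_mono s'" "((\<lambda>n. f (s n) (from_nat m)) \<circ> s') \<longlonglongrightarrow> l"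
      using compact_Icc compact_imp_seq_compact seq_compactE by metis
    then show "\<exists>r'. strict_mono r' \<and> ?P m (s \<circ> r')"
      by (auto simp: comp_def convergent_def)
  qed
  have "convergent (\<lambda>n. f (nat.diagseq n) i)" for i
  proof -
    have "?P (to_nat i) (nat.diagseq \<circ> ((+) (Suc (to_nat i))))"
    proof (rule nat.diagseq_holds)
      fix r s :: "nat \<Rightarrow> nat" and m assume "strict_mono r" "?P m s"
      then show "?P m (s \<circ> r)"
        using convergent_subseq_convergent[of "\<lambda>n. f (s n) (from_nat m)" r] by (simp add: comp_def)
    qed
    then have "convergent (\<lambda>n. f (nat.diagseq (n + Suc (to_nat i))) i)"
      by (simp add: comp_def add.commute)
    then show ?thesis
      using convergent_ignore_initial_segment[where f = "\<lambda>n. f (nat.diagseq n) i"] by blast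
  qed
  then show ?thesis
    using nat.subseq_diagseq
    by (intro exI[of _ nat.diagseq] exI[of _ "\<lambda>i. lim (\<lambda>n. f (nat.diagseq n) i)"]) (simp add: convergent_LIMSEQ_iff)
qed

lemma separated_finite_Icc:
  fixes \<Lambda> :: "real set"
  assumes "d > 0" "\<And>x y. x \<in> \<Lambda> \<Longrightarrow> y \<in> \<Lambda> \<Longrightarrow> x \<noteq> y \<Longrightarrow> d \<le> \<bar>x - y\<bar>"
  shows "finite (\<Lambda> \<inter> {p..q})"
proof -
  have "inj_on (\<lambda>x. \<lfloor>x / d\<rfloor>) (\<Lambda> \<inter> {p..q})"
  proof (rule inj_onI, rule ccontr)
    fix x y assume *: "x \<in> \<Lambda> \<inter> {p..q}" "y \<in> \<Lambda> \<inter> {p..q}" "\<lfloor>x / d\<rfloor> = \<lfloor>y / d\<rfloor>" "x \<noteq> y"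
    have "\<bar>x / d - y / d\<bar> < 1" using *(3) by linarith
    then have "\<bar>x - y\<bar> < d" using \<open>d > 0\<close> by (simp add: diff_divide_distrib[symmetric])
    then show False using assms(2)[of x y] * by auto
  qed
  moreover have "(\<lambda>x. \<lfloor>x / d\<rfloor>) ` (\<Lambda> \<inter> {p..q}) \<subseteq> {\<lfloor>p / d\<rfloor>..\<lfloor>q / d\<rfloor>}"
    using \<open>d > 0\<close> by (auto intro!: floor_mono divide_right_mono)
  ultimately show ?thesis using finite_subset finite_imageD finite_atLeastAtMost_int by metis
qed

lemma separated_countable:
  fixes \<Lambda> :: "real set"
  assumes "d > 0" "\<And>x y. x \<in> \<Lambda> \<Longrightarrow> y \<in> \<Lambda> \<Longrightarrow> x \<noteq> y \<Longrightarrow> d \<le> \<bar>x - y\<bar>"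
  shows "countable \<Lambda>"
proof -
  have "\<Lambda> = (\<Union>n::nat. \<Lambda> \<inter> {- real n..real n})"
  proof -
    have "\<exists>n::nat. - real n \<le> x \<and> x \<le> real n" for x :: real
    proof -
      obtain n where "\<bar>x\<bar> \<le> real n" using real_arch_simple by blast
      then show ?thesis by (intro exI[of _ n]) auto
    qed
    then show ?thesis
      by (intro equalityI subsetI) (metis IntI UNIV_I UN_I atLeastAtMost_iff, blast)
  qed
  moreover have "countable (\<Lambda> \<inter> {- real n..real n})" for n
    by (rule countable_finite) (rule separated_finite_Icc[OF assms])
  then have "countable (\<Union>n::nat. \<Lambda> \<inter> {- real n..real n})" by blast
  ultimately show ?thesis by (rule ssubst[of _ _ countable])
qed

text \<open>Subsets of prescribed size, instead of a bound on \<open>card\<close>, give the right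
  meaning also for an interval with infinitely many points, where \<open>card\<close> is 0. Any
  \<theta> strictly between 1 and the density works, uniformly in the centre \<open>x\<close> once
  \<open>R\<close> is large.\<close>

lemma density_gt_1_imp_many_points:
  assumes "lower_beurling_density \<Lambda> > 1"
  shows "\<exists>\<theta>>1. \<exists>R0>0. \<forall>R\<ge>R0. \<forall>x. \<forall>m::nat. real m \<le> 2 * R * \<theta> \<longrightarrow>
    (\<exists>S\<subseteq>\<Lambda> \<inter> {x - R..x + R}. finite S \<and> card S = m)"
proof -
  let ?D = "\<lambda>R::real. INF x::real. emeasure (count_space UNIV) (\<Lambda> \<inter> {x - R..x + R}) / ennreal (2 * R)"
  obtain e where e: "1 < e" "e < lower_beurling_density \<Lambda>"
    using dense[OF assms] by blast
  obtain \<theta> where \<theta>: "e = ennreal \<theta>" "\<theta> \<ge> 0" using e by (cases e) auto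
  have "\<theta> > 1" using e(1) \<theta> by (metis ennreal_1 ennreal_less_iff zero_le_one)
  have "eventually (\<lambda>R. ennreal \<theta> < ?D R) at_top"
    using e(2) \<theta> unfolding lower_beurling_density_def by (simp add: less_LiminfD)
  then obtain R0 where R0: "\<And>R. R \<ge> R0 \<Longrightarrow> ennreal \<theta> < ?D R"
    by (auto simp: eventually_at_top_linorder)
  have main: "\<exists>S\<subseteq>\<Lambda> \<inter> {x - R..x + R}. finite S \<and> card S = m"
    if R: "R \<ge> max R0 1" and m: "real m \<le> 2 * R * \<theta>" for R x and m :: nat
  proof -
    let ?A = "\<Lambda> \<inter> {x - R..x + R}"
    have "ennreal \<theta> < ?D R" using R0 R by simp
    also have "\<dots> \<le> emeasure (count_space UNIV) ?A / ennreal (2 * R)"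
      by (rule INF_lower) simp
    finally have *: "ennreal \<theta> < emeasure (count_space UNIV) ?A / ennreal (2 * R)" .
    show ?thesis
    proof (cases "finite ?A")
      case True
      then have "emeasure (count_space UNIV) ?A / ennreal (2 * R) = ennreal (real (card ?A) / (2 * R))"
        using R by (simp add: divide_ennreal ennreal_of_nat_eq_real_of_nat)
      then have "\<theta> < real (card ?A) / (2 * R)"
        using * \<theta>(2) by (simp add: ennreal_less_iff)
      then have "2 * R * \<theta> < real (card ?A)" using R by (simp add: field_simps)
      then have "m \<le> card ?A" using m by linarith
      then obtain S where "S \<subseteq> ?A" "card S = m" using obtain_subset_with_card_n by metis
      then show ?thesis using True finite_subset by blast
    next
      case False
      then obtain S where "finite S" "card S = m" "S \<subseteq> ?A" using infinite_arbitrarily_large by metis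
      then show ?thesis by blast
    qed
  qed
  show ?thesis
  proof (intro exI conjI)
    show "\<theta> > 1" "max R0 1 > 0" using \<open>\<theta> > 1\<close> by auto
    show "\<forall>R\<ge>max R0 1. \<forall>x. \<forall>m::nat. real m \<le> 2 * R * \<theta> \<longrightarrow>
        (\<exists>S\<subseteq>\<Lambda> \<inter> {x - R..x + R}. finite S \<and> card S = m)"
      using main by blast
  qed
qed

section \<open>Compactness: from failing sampling inequalities to a limit combination with many
  zeros\<close>

definition sample_norm :: "real set \<Rightarrow> (real \<Rightarrow> real) \<Rightarrow> real \<Rightarrow> (int \<Rightarrow> complex) \<Rightarrow> ennreal" where
  "sample_norm \<Lambda> G t c =
     (\<integral>\<^sup>+l. ennreal ((cmod (LINT k|count_space UNIV. c k * of_real (G (t + of_int k - l))))\<^sup>2) \<partial>count_space \<Lambda>)"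

definition coeff_norm :: "(int \<Rightarrow> complex) \<Rightarrow> ennreal" where
  "coeff_norm c = (\<integral>\<^sup>+k. ennreal ((cmod (c k))\<^sup>2) \<partial>count_space UNIV)"

text \<open>Averaging over all centres \<open>m\<close> finds one around which the coefficients are dominated by \<open>c m\<close>
  while the samples are small.\<close>

lemma exists_good_centre:
  fixes c :: "int \<Rightarrow> complex" and v :: "real \<Rightarrow> ennreal"
  assumes "b > 0" and \<Lambda>: "countable \<Lambda>" and fin: "coeff_norm c < \<infinity>"
    and small: "ennreal N * (\<integral>\<^sup>+l. v l \<partial>count_space \<Lambda>) < coeff_norm c"
  shows "\<exists>m. (\<integral>\<^sup>+k. ennreal (exp (- b * \<bar>real_of_int m - real_of_int k\<bar>)) * ennreal ((cmod (c k))\<^sup>2) \<partial>count_space UNIV)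
     + ennreal N * (\<integral>\<^sup>+l. ennreal (exp (- b * \<bar>(l - t) - real_of_int m\<bar>)) * v l \<partial>count_space \<Lambda>)
     < ennreal (2 * sep_const b 1) * ennreal ((cmod (c m))\<^sup>2)"
proof (rule ccontr)
  define K where "K = sep_const b 1"
  have K: "K > 0" using sep_const_pos[of b 1] \<open>b > 0\<close> by (simp add: K_def)
  let ?C = "\<lambda>m. \<integral>\<^sup>+k. ennreal (exp (- b * \<bar>real_of_int m - real_of_int k\<bar>)) * ennreal ((cmod (c k))\<^sup>2) \<partial>count_space UNIV"
  let ?V = "\<lambda>m. \<integral>\<^sup>+l. ennreal (exp (- b * \<bar>(l - t) - real_of_int m\<bar>)) * v l \<partial>count_space \<Lambda>"
  assume "\<not> ?thesis"
  \<comment> \<open>If every centre fails, summing over all \<open>m\<close> is contradictory: at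
    each fixed \<open>k\<close> or \<open>l\<close> the weights add up to at most \<open>K\<close>,
    so the right-hand side falls below \<open>K + K\<close> times \<open>coeff_norm c\<close>, while
    the left-hand side is \<open>2 * K\<close> times it. Finiteness of \<open>coeff_norm c\<close>
    keeps the inequality strict.\<close>
  then have le: "ennreal (2 * K) * ennreal ((cmod (c m))\<^sup>2) \<le> ?C m + ennreal N * ?V m" for m
    by (auto simp: not_less K_def)
  have sumK: "(\<integral>\<^sup>+m. ennreal (exp (- b * \<bar>y - real_of_int m\<bar>)) \<partial>count_space UNIV) \<le> ennreal K" for y
    unfolding K_def by (rule separated_exp_sum) (use \<open>b > 0\<close> in auto)
  have C: "(\<integral>\<^sup>+m. ?C m \<partial>count_space UNIV) \<le> ennreal K * coeff_norm c"
  proof -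
    have "(\<integral>\<^sup>+m. ?C m \<partial>count_space UNIV)
      = (\<integral>\<^sup>+k. (\<integral>\<^sup>+m. ennreal (exp (- b * \<bar>real_of_int m - real_of_int k\<bar>)) * ennreal ((cmod (c k))\<^sup>2) \<partial>count_space UNIV) \<partial>count_space UNIV)"
      by (rule nn_integral_count_space_nn_integral) auto
    also have "\<dots> = (\<integral>\<^sup>+k. (\<integral>\<^sup>+m. ennreal (exp (- b * \<bar>real_of_int k - real_of_int m\<bar>)) \<partial>count_space UNIV) * ennreal ((cmod (c k))\<^sup>2) \<partial>count_space UNIV)"
      by (simp add: nn_integral_multc abs_minus_commute)
    also have "\<dots> \<le> (\<integral>\<^sup>+k. ennreal K * ennreal ((cmod (c k))\<^sup>2) \<partial>count_space UNIV)"
      by (intro nn_integral_mono mult_right_mono sumK) simp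
    also have "\<dots> = ennreal K * coeff_norm c"
      unfolding coeff_norm_def by (rule nn_integral_cmult) simp
    finally show ?thesis .
  qed
  have V: "(\<integral>\<^sup>+m. ?V m \<partial>count_space UNIV) \<le> ennreal K * (\<integral>\<^sup>+l. v l \<partial>count_space \<Lambda>)"
  proof -
    have "(\<integral>\<^sup>+m. ?V m \<partial>count_space UNIV)
      = (\<integral>\<^sup>+l. (\<integral>\<^sup>+m. ennreal (exp (- b * \<bar>(l - t) - real_of_int m\<bar>)) * v l \<partial>count_space UNIV) \<partial>count_space \<Lambda>)"
      by (rule nn_integral_count_space_nn_integral) (use \<Lambda> in auto)
    also have "\<dots> = (\<integral>\<^sup>+l. (\<integral>\<^sup>+m. ennreal (exp (- b * \<bar>(l - t) - real_of_int m\<bar>)) \<partial>count_space UNIV) * v l \<partial>count_space \<Lambda>)"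
      by (simp add: nn_integral_multc)
    also have "\<dots> \<le> (\<integral>\<^sup>+l. ennreal K * v l \<partial>count_space \<Lambda>)"
      by (intro nn_integral_mono mult_right_mono sumK) simp
    also have "\<dots> = ennreal K * (\<integral>\<^sup>+l. v l \<partial>count_space \<Lambda>)"
      by (rule nn_integral_cmult) simp
    finally show ?thesis .
  qed
  have "ennreal (2 * K) * coeff_norm c = (\<integral>\<^sup>+m. ennreal (2 * K) * ennreal ((cmod (c m))\<^sup>2) \<partial>count_space UNIV)"
    unfolding coeff_norm_def by (rule nn_integral_cmult[symmetric]) simp
  also have "\<dots> \<le> (\<integral>\<^sup>+m. ?C m + ennreal N * ?V m \<partial>count_space UNIV)"
    by (intro nn_integral_mono le)
  also have "\<dots> = (\<integral>\<^sup>+m. ?C m \<partial>count_space UNIV) + ennreal N * (\<integral>\<^sup>+m. ?V m \<partial>count_space UNIV)"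
    by (simp add: nn_integral_add nn_integral_cmult)
  also have "\<dots> \<le> ennreal K * coeff_norm c + ennreal K * (ennreal N * (\<integral>\<^sup>+l. v l \<partial>count_space \<Lambda>))"
    using C mult_left_mono[OF V, of "ennreal N"] by (intro add_mono) (simp_all add: mult.left_commute)
  also have "\<dots> < ennreal K * coeff_norm c + ennreal K * coeff_norm c"
  proof (intro ennreal_add_left_cancel_less[THEN iffD2] conjI)
    show "ennreal K * coeff_norm c \<noteq> \<infinity>" using fin by (simp add: ennreal_mult_eq_top_iff)
    show "ennreal K * (ennreal N * (\<integral>\<^sup>+l. v l \<partial>count_space \<Lambda>)) < ennreal K * coeff_norm c"
      using small K by (intro ennreal_mult_strict_left_mono) auto
  qed
  also have "\<dots> = ennreal (2 * K) * coeff_norm c"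
    using K by (simp add: distrib_right[symmetric] ennreal_plus[symmetric] del: ennreal_plus)
  finally show False by simp
qed

lemma exists_decay_rate: "\<exists>a>0. \<forall>\<delta>\<in>set (ds :: real list). a * \<bar>\<delta>\<bar> \<le> 1 / 2"
proof -
  define s where "s = sum_list (map abs ds)"
  have le: "\<bar>\<delta>\<bar> \<le> s" if "\<delta> \<in> set ds" for \<delta>
    unfolding s_def using that by (intro member_le_sum_list) auto
  have "s \<ge> 0" unfolding s_def by (intro sum_list_nonneg) auto
  then have "1 / (2 * (1 + s)) > 0" "\<forall>\<delta>\<in>set ds. 1 / (2 * (1 + s)) * \<bar>\<delta>\<bar> \<le> 1 / 2"
  proof -
    show "\<forall>\<delta>\<in>set ds. 1 / (2 * (1 + s)) * \<bar>\<delta>\<bar> \<le> 1 / 2"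
    proof
      fix \<delta> assume "\<delta> \<in> set ds"
      with le have "\<bar>\<delta>\<bar> \<le> 1 + s" by force
      then show "1 / (2 * (1 + s)) * \<bar>\<delta>\<bar> \<le> 1 / 2" using \<open>s \<ge> 0\<close> by (simp add: divide_simps)
    qed
  qed (use \<open>s \<ge> 0\<close> in simp)
  then show ?thesis by blast
qed

text \<open>Recentring at the good index \<open>m\<close> turns the shift into
  \<open>\<tau> = t + m\<close>, and dividing by \<open>c m\<close> gives \<open>d 0 = 1\<close>,
  which prevents a zero limit. The bounds are read off from single terms of weighted sums of
  squares, so the square root halves the rate \<open>a\<close>. As the kernel is real, taking real
  parts of the coefficients does not increase the samples.\<close>

lemma normalised_almost_zero:
  fixes c :: "int \<Rightarrow> complex"
  assumes G: "exp_decay a C G" and \<Lambda>: "countable \<Lambda>" and fin: "coeff_norm c < \<infinity>" and "N > 0"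
    and small: "ennreal N * sample_norm \<Lambda> G t c < coeff_norm c"
  defines "K \<equiv> sep_const a 1"
  shows "\<exists>\<tau> d. d 0 = 1 \<and> (\<forall>k. \<bar>d k\<bar> \<le> sqrt (2 * K) * exp (a / 2 * \<bar>real_of_int k\<bar>)) \<and>
    (\<forall>l\<in>\<Lambda>. \<bar>shift_sum d G (\<tau> - l)\<bar> \<le> sqrt (2 * K / N) * exp (a / 2 * \<bar>\<tau> - l\<bar>))"
proof -
  have a: "a > 0" using G by (simp add: exp_decay_def)
  have K: "K > 0" using sep_const_pos[of a 1] a by (simp add: K_def)
  define S where "S l = (LINT k|count_space UNIV. c k * of_real (G (t + of_int k - l)))" for l
  let ?v = "\<lambda>l. ennreal ((cmod (S l))\<^sup>2)"
  let ?C = "\<lambda>m. \<integral>\<^sup>+k. ennreal (exp (- a * \<bar>real_of_int m - real_of_int k\<bar>)) * ennreal ((cmod (c k))\<^sup>2) \<partial>count_space UNIV"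
  let ?V = "\<lambda>m. \<integral>\<^sup>+l. ennreal (exp (- a * \<bar>(l - t) - real_of_int m\<bar>)) * ?v l \<partial>count_space \<Lambda>"
  have "ennreal N * (\<integral>\<^sup>+l. ?v l \<partial>count_space \<Lambda>) < coeff_norm c"
    using small by (simp add: sample_norm_def S_def)
  from exists_good_centre[OF a \<Lambda> fin this, of t]
  obtain m where m: "?C m + ennreal N * ?V m < ennreal (2 * K) * ennreal ((cmod (c m))\<^sup>2)"
    unfolding K_def by blast
  define w where "w = c m"
  have w: "w \<noteq> 0" using m by (auto simp: w_def)
  have m': "?C m + ennreal N * ?V m \<le> ennreal (2 * K * (cmod w)\<^sup>2)"
    using m K by (simp add: w_def ennreal_mult)
  have ck: "cmod (c k) \<le> sqrt (2 * K) * exp (a / 2 * \<bar>real_of_int m - real_of_int k\<bar>) * cmod w" for k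
  proof (rule power2_le_imp_le)
    have "ennreal (exp (- a * \<bar>real_of_int m - real_of_int k\<bar>)) * ennreal ((cmod (c k))\<^sup>2) \<le> ?C m"
      by (rule nn_integral_ge_point) simp
    also have "\<dots> \<le> ?C m + ennreal N * ?V m" by simp
    also note m'
    finally have "exp (- a * \<bar>real_of_int m - real_of_int k\<bar>) * (cmod (c k))\<^sup>2 \<le> 2 * K * (cmod w)\<^sup>2"
      using K by (simp add: ennreal_mult[symmetric])
    then have "(cmod (c k))\<^sup>2 \<le> 2 * K * exp (a * \<bar>real_of_int m - real_of_int k\<bar>) * (cmod w)\<^sup>2"
      by (simp add: exp_minus field_simps)
    also have "\<dots> = (sqrt (2 * K) * exp (a / 2 * \<bar>real_of_int m - real_of_int k\<bar>) * cmod w)\<^sup>2"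
      using K by (simp add: power_mult_distrib exp_double[symmetric])
    finally show "(cmod (c k))\<^sup>2 \<le> (sqrt (2 * K) * exp (a / 2 * \<bar>real_of_int m - real_of_int k\<bar>) * cmod w)\<^sup>2" .
  qed (use K in auto)
  have Sl: "cmod (S l) \<le> sqrt (2 * K / N) * exp (a / 2 * \<bar>(t + of_int m) - l\<bar>) * cmod w" if "l \<in> \<Lambda>" for l
  proof (rule power2_le_imp_le)
    have "ennreal N * (ennreal (exp (- a * \<bar>(l - t) - real_of_int m\<bar>)) * ?v l) \<le> ennreal N * ?V m"
      by (intro mult_left_mono nn_integral_ge_point that) simp
    also have "\<dots> \<le> ?C m + ennreal N * ?V m" by simp
    also note m'
    finally have "N * (exp (- a * \<bar>(l - t) - real_of_int m\<bar>) * (cmod (S l))\<^sup>2) \<le> 2 * K * (cmod w)\<^sup>2"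
      using K \<open>N > 0\<close> by (simp add: ennreal_mult[symmetric])
    moreover have "\<bar>(l - t) - real_of_int m\<bar> = \<bar>(t + of_int m) - l\<bar>" by simp
    ultimately have "N * (exp (- a * \<bar>(t + of_int m) - l\<bar>) * (cmod (S l))\<^sup>2) \<le> 2 * K * (cmod w)\<^sup>2"
      by (simp only:)
    then have "(cmod (S l))\<^sup>2 \<le> 2 * K / N * exp (a * \<bar>(t + of_int m) - l\<bar>) * (cmod w)\<^sup>2"
      using \<open>N > 0\<close> by (simp add: exp_minus field_simps)
    also have "\<dots> = (sqrt (2 * K / N) * exp (a / 2 * \<bar>(t + of_int m) - l\<bar>) * cmod w)\<^sup>2"
      using K \<open>N > 0\<close> by (simp add: power_mult_distrib exp_double[symmetric])
    finally show "(cmod (S l))\<^sup>2 \<le> (sqrt (2 * K / N) * exp (a / 2 * \<bar>(t + of_int m) - l\<bar>) * cmod w)\<^sup>2" .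
  qed (use K \<open>N > 0\<close> in auto)
  define e where "e k = c (k + m) / w" for k
  define d where "d k = Re (e k)" for k
  have e_le: "cmod (e k) \<le> sqrt (2 * K) * exp (a / 2 * \<bar>real_of_int k\<bar>)" for k
    using ck[of "k + m"] w by (simp add: e_def norm_divide divide_le_eq)
  have "d 0 = 1" using w by (simp add: d_def e_def w_def)
  moreover have "\<bar>d k\<bar> \<le> sqrt (2 * K) * exp (a / 2 * \<bar>real_of_int k\<bar>)" for k
    using e_le[of k] abs_Re_le_cmod[of "e k"] by (simp add: d_def)
  moreover have "\<bar>shift_sum d G (t + of_int m - l)\<bar> \<le> sqrt (2 * K / N) * exp (a / 2 * \<bar>t + of_int m - l\<bar>)"
    if "l \<in> \<Lambda>" for l
  proof -
    let ?x = "t + of_int m - l"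
    have bij: "bij_betw (\<lambda>k::int. k + m) UNIV UNIV"
      by (rule bij_betwI[where g = "\<lambda>k. k - m"]) auto
    have S: "S l = (LINT k|count_space UNIV. w * (e k * of_real (G (?x + of_int k))))"
      unfolding S_def using w by (subst integral_bij_count_space[OF bij, symmetric]) (simp add: e_def algebra_simps)
    have "integrable (count_space UNIV) (\<lambda>k. cmod (e k) * G (?x + of_int k))"
      by (rule shift_sum_integrable[OF G, where D = "sqrt (2 * K)" and b = "a / 2"]) (use e_le a in auto)
    then have int: "integrable (count_space UNIV) (\<lambda>k. e k * of_real (G (?x + of_int k)))"
      by (rule Bochner_Integration.integrable_bound) (auto simp: norm_mult)
    have "shift_sum d G ?x = Re (LINT k|count_space UNIV. e k * of_real (G (?x + of_int k)))"
      unfolding shift_sum_def d_def using integral_Re[OF int] by simp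
    also have "(LINT k|count_space UNIV. e k * of_real (G (?x + of_int k))) = S l / w"
      unfolding S using w by simp
    finally have "\<bar>shift_sum d G ?x\<bar> \<le> cmod (S l / w)"
      using abs_Re_le_cmod by simp
    also have "\<dots> \<le> sqrt (2 * K / N) * exp (a / 2 * \<bar>?x\<bar>)"
      using Sl[OF that] w by (simp add: norm_divide divide_le_eq)
    finally show ?thesis .
  qed
  ultimately show ?thesis by (intro exI[of _ "t + of_int m"] exI[of _ d]) blast
qed

theorem sampling_if_dense:
  fixes \<Lambda> :: "real set"
  assumes sep: "d0 > 0" "\<And>x y. x \<in> \<Lambda> \<Longrightarrow> y \<in> \<Lambda> \<Longrightarrow> x \<noteq> y \<Longrightarrow> d0 \<le> \<bar>x - y\<bar>"
    and dens: "lower_beurling_density \<Lambda> > 1" and "\<gamma> > 0"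
  shows "\<exists>A>0. \<forall>t c. coeff_norm c < \<infinity> \<longrightarrow> ennreal A * coeff_norm c \<le> sample_norm \<Lambda> (tp_kernel \<gamma> ds) t c"
proof (rule ccontr)
  assume neg: "\<not> ?thesis"
  let ?G = "tp_kernel \<gamma> ds"
  obtain a where a: "a > 0" "\<forall>\<delta>\<in>set ds. a * \<bar>\<delta>\<bar> \<le> 1 / 2" using exists_decay_rate by blast
  obtain C where G: "exp_decay a C ?G" using exp_decay_tp_kernel[OF \<open>\<gamma> > 0\<close> a] by blast
  define K where "K = sep_const a 1"
  have K: "K > 0" using sep_const_pos[of a 1] a by (simp add: K_def)
  have "countable \<Lambda>" by (rule separated_countable[OF sep])
  have "\<exists>\<tau> d. d 0 = 1 \<and> (\<forall>k. \<bar>d k\<bar> \<le> sqrt (2 * K) * exp (a / 2 * \<bar>real_of_int k\<bar>)) \<and>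
    (\<forall>l\<in>\<Lambda>. \<bar>shift_sum d ?G (\<tau> - l)\<bar> \<le> sqrt (2 * K / real (Suc n)) * exp (a / 2 * \<bar>\<tau> - l\<bar>))" for n
  proof -
    have "1 / real (Suc n) > 0" by simp
    with neg obtain t c where tc: "coeff_norm c < \<infinity>" "sample_norm \<Lambda> ?G t c < ennreal (1 / real (Suc n)) * coeff_norm c"
      by (meson not_le)
    have "ennreal (real (Suc n)) * sample_norm \<Lambda> ?G t c < ennreal (real (Suc n)) * (ennreal (1 / real (Suc n)) * coeff_norm c)"
      using tc(2) by (intro ennreal_mult_strict_left_mono) (auto simp del: of_nat_Suc)
    also have "\<dots> = coeff_norm c"
      by (simp add: mult.assoc[symmetric] ennreal_mult[symmetric] del: of_nat_Suc)
    finally show ?thesis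
      unfolding K_def by (intro normalised_almost_zero[OF G \<open>countable \<Lambda>\<close> tc(1)]) auto
  qed
  then obtain \<tau> d where d0: "\<And>n. d n 0 = 1"
    and d_le: "\<And>n k. \<bar>d n k\<bar> \<le> sqrt (2 * K) * exp (a / 2 * \<bar>real_of_int k\<bar>)"
    and small: "\<And>n l. l \<in> \<Lambda> \<Longrightarrow> \<bar>shift_sum (d n) ?G (\<tau> n - l)\<bar> \<le> sqrt (2 * K / real (Suc n)) * exp (a / 2 * \<bar>\<tau> n - l\<bar>)"
    by metis
  obtain \<theta> R0 where \<theta>: "\<theta> > 1" "R0 > 0"
    and pts: "\<And>R x m. R \<ge> R0 \<Longrightarrow> real m \<le> 2 * R * \<theta> \<Longrightarrow> \<exists>S\<subseteq>\<Lambda> \<inter> {x - R..x + R}. finite S \<and> card S = m"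
    using density_gt_1_imp_many_points[OF dens] by blast
  \<comment> \<open>So large that the surplus \<open>2 R (\<theta> - 1)\<close> covers the
    \<open>length ds\<close> zeros lost to Rolle and the at most 2 units by which \<open>N\<close>
    exceeds \<open>2 R\<close>.\<close>
  define R where "R = max R0 ((2 + real (length ds)) / (2 * (\<theta> - 1)))"
  have R: "R \<ge> R0" "R > 0" "2 + real (length ds) \<le> 2 * R * (\<theta> - 1)"
  proof -
    show "R \<ge> R0" "R > 0" using \<theta> by (auto simp: R_def)
    have "(2 + real (length ds)) / (2 * (\<theta> - 1)) \<le> R" by (simp add: R_def)
    then show "2 + real (length ds) \<le> 2 * R * (\<theta> - 1)" using \<theta> by (simp add: divide_le_eq mult_ac)
  qed
  \<comment> \<open>\<open>N\<close> is an integer above the cell length \<open>B = 2 R + 1\<close>;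
    the 1 in \<open>B\<close> is the gap between neighbouring cells.\<close>
  define N where "N = nat \<lfloor>2 * R\<rfloor> + 2"
  define B where "B = 2 * R + 1"
  define M where "M = N + length ds"
  have N: "B < real N" "real N \<le> 2 * R + 2"
    using R(2) unfolding N_def B_def by linarith+
  have M: "real M \<le> 2 * R * \<theta>"
    using N(2) R(3) by (simp add: M_def algebra_simps)
  define P where "P n j q \<longleftrightarrow> (\<forall>i<M. q i \<in> {of_int j * B..of_int j * B + 2 * R} \<and>
        \<bar>shift_sum (d n) ?G (q i)\<bar> \<le> sqrt (2 * K / real (Suc n)) * exp (a / 2 * \<bar>q i\<bar>)) \<and>
      (\<forall>i<M. \<forall>i'<M. i \<noteq> i' \<longrightarrow> d0 \<le> \<bar>q i - q i'\<bar>)" for n and j :: int and q :: "nat \<Rightarrow> real"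
  have "\<exists>q. P n j q" for n j
  proof -
    \<comment> \<open>The samples sit at \<open>\<tau> - l\<close>, so the points \<open>l\<close>
      are taken from the reflected cell, whose centre is \<open>\<tau> - j B - R\<close>.\<close>
    obtain S where S: "S \<subseteq> \<Lambda> \<inter> {(\<tau> n - of_int j * B - R) - R..(\<tau> n - of_int j * B - R) + R}" "finite S" "card S = M"
      using pts[OF R(1) M] by blast
    obtain h where h: "bij_betw h {0..<M} S" using ex_bij_betw_nat_finite[OF S(2)] S(3) by auto
    have hS: "h i \<in> S" if "i < M" for i using h that by (auto simp: bij_betw_def)
    show ?thesis
      unfolding P_def
    proof (intro exI[of _ "\<lambda>i. \<tau> n - h i"] conjI allI impI)
      fix i assume i: "i < M"
      then have "h i \<in> \<Lambda>" using hS S(1) by blast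
      then show "\<bar>shift_sum (d n) ?G (\<tau> n - h i)\<bar> \<le> sqrt (2 * K / real (Suc n)) * exp (a / 2 * \<bar>\<tau> n - h i\<bar>)"
        by (rule small)
      have "h i \<in> {(\<tau> n - of_int j * B - R) - R..(\<tau> n - of_int j * B - R) + R}" using hS[OF i] S(1) by blast
      then show "\<tau> n - h i \<in> {of_int j * B..of_int j * B + 2 * R}" by auto
    next
      fix i i' assume i: "i < M" "i' < M" "i \<noteq> i'"
      then have "h i \<noteq> h i'" using h by (auto simp: bij_betw_def inj_on_def)
      moreover have "h i \<in> \<Lambda>" "h i' \<in> \<Lambda>" using hS S(1) i by blast+
      ultimately show "d0 \<le> \<bar>\<tau> n - h i - (\<tau> n - h i')\<bar>"
        using sep(2)[of "h i" "h i'"] by simp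
    qed
  qed
  then obtain q where qP: "\<And>n j. P n j (q n j)" by metis
  have q: "q n j i \<in> {of_int j * B..of_int j * B + 2 * R}"
    and qs: "\<bar>shift_sum (d n) ?G (q n j i)\<bar> \<le> sqrt (2 * K / real (Suc n)) * exp (a / 2 * \<bar>q n j i\<bar>)"
    if "i < M" for n j i
    using qP[of n j] that by (simp_all add: P_def)
  have qd: "d0 \<le> \<bar>q n j i - q n j i'\<bar>" if "i < M" "i' < M" "i \<noteq> i'" for n j i i'
    using qP[of n j] that by (simp add: P_def)
  have q_le: "\<bar>q n j i\<bar> \<le> \<bar>of_int j * B\<bar> + 2 * R" if "i < M" for n j i
    using q[OF that, of n j] R(2) by auto
  \<comment> \<open>Coefficients and sample points share one countable index type, so that a single
    diagonal subsequence makes all of them converge; the value 0 for \<open>i \<ge> M\<close> is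
    padding.\<close>
  define f where "f n = case_sum (d n) (\<lambda>(j, i). if i < M then q n j i else 0)" for n
  have "\<exists>r l. strict_mono r \<and> (\<forall>i. (\<lambda>n. f (r n) i) \<longlonglongrightarrow> l i)"
  proof (rule bounded_diagonal_subsequence)
    show "\<bar>f n i\<bar> \<le> case_sum (\<lambda>k. sqrt (2 * K) * exp (a / 2 * \<bar>real_of_int k\<bar>)) (\<lambda>(j, i). \<bar>of_int j * B\<bar> + 2 * R) i" for n i
      using d_le q_le R(2) by (auto simp: f_def split: sum.split)
  qed
  then obtain r l where r: "strict_mono r" and l: "\<And>i. (\<lambda>n. f (r n) i) \<longlonglongrightarrow> l i" by blast
  define e where "e k = l (Inl k)" for k
  define z where "z j i = l (Inr (j, i))" for j i
  have e: "(\<lambda>n. d (r n) k) \<longlonglongrightarrow> e k" for k using l[of "Inl k"] by (simp add: f_def e_def)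
  have z: "(\<lambda>n. q (r n) j i) \<longlonglongrightarrow> z j i" if "i < M" for j i
    using l[of "Inr (j, i)"] that by (simp add: f_def z_def)
  have "e 0 = 1" using e[of 0] d0 by (simp add: LIMSEQ_const_iff)
  moreover have e_le: "\<bar>e k\<bar> \<le> sqrt (2 * K) * exp (a / 2 * \<bar>real_of_int k\<bar>)" for k
    using tendsto_rabs[OF e[of k]] d_le by (intro LIMSEQ_le_const2) auto
  \<comment> \<open>Separation passes to the limit, so no two of the \<open>M\<close> zeros in a
    cell merge.\<close>
  have z_sep: "d0 \<le> \<bar>z j i - z j i'\<bar>" if "i < M" "i' < M" "i \<noteq> i'" for j i i'
    using tendsto_rabs[OF tendsto_diff[OF z[OF that(1), of j] z[OF that(2), of j]]] qd that
    by (intro LIMSEQ_le_const) auto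
  have z_in: "z j i \<in> {of_int j * B..of_int j * B + 2 * R}" if "i < M" for j i
    using closed_sequentially[OF closed_atLeastAtMost _ z[OF that]] q[OF that] by blast
  have z_zero: "shift_sum e ?G (z j i) = 0" if "i < M" for j i
  proof -
    have "(\<lambda>n. shift_sum (d (r n)) ?G (q (r n) j i)) \<longlonglongrightarrow> shift_sum e ?G (z j i)"
      by (rule shift_sum_tendsto[OF G d_le _ _ e z[OF that]]) (use a in auto)
    moreover have "(\<lambda>n. shift_sum (d (r n)) ?G (q (r n) j i)) \<longlonglongrightarrow> 0"
    proof (rule Lim_null_comparison)
      let ?E = "exp (a / 2 * (\<bar>of_int j * B\<bar> + 2 * R))"
      have "(\<lambda>n. sqrt (2 * K / real (Suc n)) * E) \<longlonglongrightarrow> 0" for E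
        using K by real_asymp
      then show "(\<lambda>n. sqrt (2 * K / real (Suc (r n))) * ?E) \<longlonglongrightarrow> 0"
        using LIMSEQ_subseq_LIMSEQ[OF _ r, of "\<lambda>n. sqrt (2 * K / real (Suc n)) * ?E" 0] by (simp add: comp_def)
      show "\<forall>\<^sub>F n in sequentially. norm (shift_sum (d (r n)) ?G (q (r n) j i)) \<le> sqrt (2 * K / real (Suc (r n))) * ?E"
      proof (intro always_eventually allI)
        fix n
        have "exp (a / 2 * \<bar>q (r n) j i\<bar>) \<le> ?E" using q_le[OF that] a by simp
        then have "sqrt (2 * K / real (Suc (r n))) * exp (a / 2 * \<bar>q (r n) j i\<bar>) \<le> sqrt (2 * K / real (Suc (r n))) * ?E"
          using K by (intro mult_left_mono) auto
        with qs[OF that] show "norm (shift_sum (d (r n)) ?G (q (r n) j i)) \<le> sqrt (2 * K / real (Suc (r n))) * ?E"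
          unfolding real_norm_def by (rule order.trans)
      qed
    qed
    ultimately show ?thesis by (rule LIMSEQ_unique)
  qed
  show False
  proof (rule tp_kernel_uniqueness[OF \<open>\<gamma> > 0\<close> a e_le])
    show "finite (z j ` {..<M})" for j by simp
    have "inj_on (z j) {..<M}" for j
      using z_sep[of _ _ j] sep(1) by (intro inj_onI) (metis abs_zero diff_self lessThan_iff not_le)
    then show "card (z j ` {..<M}) = N + length ds" for j
      by (simp add: card_image M_def)
    show "z j ` {..<M} \<subseteq> {of_int j * B..of_int j * B + 2 * R}" for j using z_in by auto
  qed (use \<open>e 0 = 1\<close> a N R(2) z_zero in \<open>auto simp: B_def\<close>)
qed

section \<open>Density of sampling sets\<close>

text \<open>Gaussian elimination: a row that does not vanish on \<open>K\<close> is solved for a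
  pivot unknown \<open>p\<close>, which is substituted into the remaining rows.\<close>

lemma underdetermined_system:
  fixes M :: "'l \<Rightarrow> 'k \<Rightarrow> complex"
  assumes "finite L" "finite K" "card L < card K"
  shows "\<exists>c. (\<forall>k. k \<notin> K \<longrightarrow> c k = 0) \<and> (\<exists>k. c k \<noteq> 0) \<and> (\<forall>l\<in>L. (\<Sum>k\<in>K. M l k * c k) = 0)"
  using assms
proof (induction L arbitrary: K M rule: finite_induct)
  case empty
  then obtain k where "k \<in> K" by fastforce
  then show ?case by (intro exI[of _ "\<lambda>j. if j = k then 1 else 0"]) auto
next
  case (insert l L)
  show ?case
  proof (cases "\<forall>k\<in>K. M l k = 0")
    case True
    obtain c where "\<forall>k. k \<notin> K \<longrightarrow> c k = 0" "\<exists>k. c k \<noteq> 0" "\<forall>l\<in>L. (\<Sum>k\<in>K. M l k * c k) = 0"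
      using insert.IH[of K M] insert.prems insert.hyps by auto
    then show ?thesis using True by (intro exI[of _ c]) auto
  next
    case False
    then obtain p where p: "p \<in> K" "M l p \<noteq> 0" by blast
    define K' where "K' = K - {p}"
    have K: "finite K'" "K = insert p K'" "p \<notin> K'" using p insert.prems by (auto simp: K'_def)
    have "card L < card K'" using insert.prems insert.hyps K by simp
    from insert.IH[OF K(1) this, of "\<lambda>i k. M i k - M i p * M l k / M l p"]
    obtain c' where c': "\<forall>k. k \<notin> K' \<longrightarrow> c' k = 0" "\<exists>k. c' k \<noteq> 0"
      "\<forall>i\<in>L. (\<Sum>k\<in>K'. (M i k - M i p * M l k / M l p) * c' k) = 0" by blast
    define s where "s = (\<Sum>k\<in>K'. M l k * c' k)"
    define c where "c = c'(p := - s / M l p)"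
    have sum: "(\<Sum>k\<in>K. M i k * c k) = M i p * (- s / M l p) + (\<Sum>k\<in>K'. M i k * c' k)" for i
    proof -
      have "(\<Sum>k\<in>K'. M i k * c k) = (\<Sum>k\<in>K'. M i k * c' k)"
        using K(3) by (intro sum.cong) (auto simp: c_def)
      then show ?thesis using K by (simp add: c_def)
    qed
    have "(\<Sum>k\<in>K. M i k * c k) = 0" if "i \<in> insert l L" for i
    proof (cases "i = l")
      case True
      then show ?thesis unfolding sum using p by (simp add: s_def)
    next
      case False
      then have "0 = (\<Sum>k\<in>K'. (M i k - M i p * M l k / M l p) * c' k)" using c'(3) that by simp
      also have "\<dots> = (\<Sum>k\<in>K'. M i k * c' k) - (\<Sum>k\<in>K'. M i p / M l p * (M l k * c' k))"
        by (simp add: sum_subtractf left_diff_distrib mult.assoc)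
      also have "\<dots> = (\<Sum>k\<in>K'. M i k * c' k) - M i p / M l p * s"
        by (simp add: s_def sum_distrib_left)
      finally show ?thesis unfolding sum by simp
    qed
    moreover have "\<exists>k. c k \<noteq> 0" using c'(1,2) K(3) unfolding c_def by (metis fun_upd_apply)
    moreover have "\<forall>k. k \<notin> K \<longrightarrow> c k = 0" using c'(1) K(2) by (auto simp: c_def)
    ultimately show ?thesis by blast
  qed
qed

text \<open>The ratio of the weights is \<open>exp u\<close> with
  \<open>\<bar>u\<bar> \<le> b \<bar>x - y\<bar>\<close>, and
  \<open>\<bar>1 - exp u\<bar> \<le> \<bar>u\<bar> exp \<bar>u\<bar>\<close>. The relative error
  thus carries a factor \<open>b\<close>; its growth in \<open>\<bar>x - y\<bar>\<close> will be
  absorbed by the decay of the kernel.\<close>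

lemma exp_weight_diff:
  fixes b x y z :: real
  assumes "b \<ge> 0"
  shows "\<bar>exp (- b * \<bar>x - z\<bar>) - exp (- b * \<bar>y - z\<bar>)\<bar> \<le> exp (- b * \<bar>x - z\<bar>) * (b * \<bar>x - y\<bar> * exp (b * \<bar>x - y\<bar>))"
proof -
  define u where "u = b * \<bar>x - z\<bar> - b * \<bar>y - z\<bar>"
  have "\<bar>u\<bar> \<le> b * \<bar>x - y\<bar>"
  proof -
    have "\<bar>u\<bar> = b * \<bar>\<bar>x - z\<bar> - \<bar>y - z\<bar>\<bar>" using assms by (simp add: u_def right_diff_distrib[symmetric] abs_mult)
    also have "\<dots> \<le> b * \<bar>x - y\<bar>" using assms by (intro mult_left_mono) auto
    finally show ?thesis .
  qed
  have "\<bar>1 - exp u\<bar> \<le> \<bar>u\<bar> * exp \<bar>u\<bar>"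
  proof (cases "u \<ge> 0")
    case True
    have "exp u * (1 + - u) \<le> exp u * exp (- u)" by (intro mult_left_mono exp_ge_add_one_self) auto
    then have "exp u - 1 \<le> u * exp u" by (simp add: exp_minus algebra_simps)
    then show ?thesis using True by simp
  next
    case False
    have "1 - exp u \<le> - u" using exp_ge_add_one_self[of u] by linarith
    also have "\<dots> \<le> - u * exp (- u)" using False by (simp add: mult_le_cancel_left1)
    finally show ?thesis using False by simp
  qed
  also have "\<dots> \<le> (b * \<bar>x - y\<bar>) * exp (b * \<bar>x - y\<bar>)"
    using \<open>\<bar>u\<bar> \<le> b * \<bar>x - y\<bar>\<close> by (intro mult_mono) auto
  finally have 1: "exp (- b * \<bar>x - z\<bar>) * \<bar>1 - exp u\<bar> \<le> exp (- b * \<bar>x - z\<bar>) * (b * \<bar>x - y\<bar> * exp (b * \<bar>x - y\<bar>))"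
    by (intro mult_left_mono) auto
  have 2: "exp (- b * \<bar>x - z\<bar>) * \<bar>1 - exp u\<bar> = \<bar>exp (- b * \<bar>x - z\<bar>) * (1 - exp u)\<bar>"
    by (simp add: abs_mult)
  have 3: "exp (- b * \<bar>x - z\<bar>) * (1 - exp u) = exp (- b * \<bar>x - z\<bar>) - exp (- b * \<bar>y - z\<bar>)"
    by (simp add: u_def right_diff_distrib exp_add[symmetric])
  show ?thesis using 1 unfolding 2 3 .
qed

lemma weighted_nn_integral_sum:
  assumes "countable I" "\<And>i. i \<in> I \<Longrightarrow> (\<integral>\<^sup>+m. W m i \<partial>count_space UNIV) \<le> K"
  shows "(\<integral>\<^sup>+(m::int). (\<integral>\<^sup>+i. W m i * f i \<partial>count_space I) \<partial>count_space UNIV) \<le> K * (\<integral>\<^sup>+i. f i \<partial>count_space I)"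
proof -
  have "(\<integral>\<^sup>+m. (\<integral>\<^sup>+i. W m i * f i \<partial>count_space I) \<partial>count_space UNIV)
      = (\<integral>\<^sup>+i. (\<integral>\<^sup>+m. W m i * f i \<partial>count_space UNIV) \<partial>count_space I)"
    by (rule nn_integral_count_space_nn_integral) (use assms in auto)
  also have "\<dots> = (\<integral>\<^sup>+i. (\<integral>\<^sup>+m. W m i \<partial>count_space UNIV) * f i \<partial>count_space I)"
    by (simp add: nn_integral_multc)
  also have "\<dots> \<le> (\<integral>\<^sup>+i. K * f i \<partial>count_space I)"
    using assms(2) by (intro nn_integral_mono mult_right_mono) auto
  also have "\<dots> = K * (\<integral>\<^sup>+i. f i \<partial>count_space I)" by (rule nn_integral_cmult) simp
  finally show ?thesis .
qed

section \<open>Deformation: replacing the integers by the multiples of \<theta>\<close>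

definition deformed_norm :: "real set \<Rightarrow> (real \<Rightarrow> real) \<Rightarrow> real \<Rightarrow> (int \<Rightarrow> complex) \<Rightarrow> ennreal" where
  "deformed_norm \<Lambda> G \<theta> c =
     (\<integral>\<^sup>+l. ennreal ((cmod (LINT k|count_space UNIV. c k * of_real (G (\<theta> * of_int k - l))))\<^sup>2) \<partial>count_space \<Lambda>)"

lemma integrable_finite_support:
  fixes f :: "'a \<Rightarrow> 'b::{banach, second_countable_topology}"
  assumes "finite {k. c k \<noteq> 0}" "\<And>k. c k = 0 \<Longrightarrow> f k = 0"
  shows "integrable (count_space UNIV) f"
proof (rule integrableI_bounded)
  have "(\<integral>\<^sup>+k. ennreal (norm (f k)) \<partial>count_space UNIV) = (\<Sum>k | c k \<noteq> 0. ennreal (norm (f k)))"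
    using assms by (intro nn_integral_count_space') auto
  also have "\<dots> < \<infinity>" by (simp add: sum_ennreal)
  finally show "(\<integral>\<^sup>+k. ennreal (norm (f k)) \<partial>count_space UNIV) < \<infinity>" .
qed simp

text \<open>The hypothesis is applied to the weighted sequence \<open>u\<close> and the shift
  \<open>t = \<theta> m - m\<close>, for which \<open>t + k\<close> and \<open>\<theta> k\<close>
  differ by \<open>(1 - \<theta>) (k - m)\<close> and so agree at \<open>k = m\<close>. Two errors
  arise: this mismatch, controlled by the Lipschitz clause, and the commutator of the weight with
  the sampling matrix, of relative size \<open>4 * b / a\<close>. In \<open>K\<close> the mesh sizes
  \<open>d0\<close>, 1 and 1/2 belong to \<Lambda>, to the points \<open>t + k\<close> and to the
  points \<open>\<theta> k\<close>.\<close>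

lemma local_sampling_inequality:
  fixes \<Lambda> :: "real set" and c :: "int \<Rightarrow> complex"
  assumes sep: "d0 > 0" "\<And>x y. x \<in> \<Lambda> \<Longrightarrow> y \<in> \<Lambda> \<Longrightarrow> x \<noteq> y \<Longrightarrow> d0 \<le> \<bar>x - y\<bar>"
    and G: "exp_decay a C G"
    and samp: "\<And>t c. finite {k. c k \<noteq> 0} \<Longrightarrow> ennreal A * coeff_norm c \<le> sample_norm \<Lambda> G t c"
    and fin: "finite {k. c k \<noteq> 0}" and \<theta>: "1 / 2 \<le> \<theta>" "\<theta> \<le> 1" and b: "0 \<le> b" "b \<le> a / 4"
  defines "K \<equiv> 2 * (sep_const (a / 2) d0 + sep_const (a / 2) 1 + sep_const (a / 2) (1 / 2))"
    and "W \<equiv> \<lambda>m x. ennreal (exp (- (2 * b) * \<bar>x - \<theta> * real_of_int m\<bar>))"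
    and "S \<equiv> \<lambda>l. LINT k|count_space UNIV. c k * of_real (G (\<theta> * of_int k - l))"
  shows "ennreal A * (\<integral>\<^sup>+k. W m (\<theta> * of_int k) * ennreal ((cmod (c k))\<^sup>2) \<partial>count_space UNIV)
    \<le> 2 * (\<integral>\<^sup>+l. W m l * ennreal ((cmod (S l))\<^sup>2) \<partial>count_space \<Lambda>)
     + ennreal (4 * K\<^sup>2 * C\<^sup>2) * (\<integral>\<^sup>+k. W m (\<theta> * of_int k) * ennreal ((((1 - \<theta>) * (of_int k - of_int m))\<^sup>2 + (4 * b / a)\<^sup>2) * (cmod (c k))\<^sup>2) \<partial>count_space UNIV)"
proof -
  have a: "a > 0" and C: "C > 0" and G_le: "\<bar>G x\<bar> \<le> C * exp (- a * \<bar>x\<bar>)"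
    and G_lip: "\<bar>G x - G y\<bar> \<le> C * \<bar>x - y\<bar> * (exp (- a * \<bar>x\<bar>) + exp (- a * \<bar>y\<bar>))" for x y
    using G by (auto simp: exp_decay_def)
  have K: "K > 0"
    unfolding K_def using sep_const_pos[of "a / 2"] a sep(1) by (simp add: add_pos_pos)
  define w where "w x = exp (- b * \<bar>x - \<theta> * real_of_int m\<bar>)" for x
  have w_pos: "w x > 0" for x by (simp add: w_def)
  have W: "W m x = ennreal ((w x)\<^sup>2)" for x
    by (simp add: W_def w_def exp_double[symmetric])
  define u where "u k = of_real (w (\<theta> * of_int k)) * c k" for k
  have fin_u: "finite {k. u k \<noteq> 0}" using fin by (elim finite_subset[rotated]) (auto simp: u_def)
  define t where "t = \<theta> * of_int m - of_int m"
  define U where "U l = (LINT k|count_space UNIV. u k * of_real (G (t + of_int k - l)))" for l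
  define e where "e l k = exp (- (a / 2) * \<bar>\<theta> * of_int k - l\<bar>) + exp (- (a / 2) * \<bar>t + of_int k - l\<bar>)" for l and k :: int
  define r where "r k = w (\<theta> * of_int k) * cmod (c k) * (C * (\<bar>(1 - \<theta>) * (of_int k - of_int m)\<bar> + 4 * b / a))" for k
  have r_nn: "r k \<ge> 0" for k
    unfolding r_def using w_pos[of "\<theta> * of_int k"] C a b by (intro mult_nonneg_nonneg add_nonneg_nonneg) (auto simp: less_imp_le)
  define D where "D l k = u k * of_real (G (t + of_int k - l)) - of_real (w l) * (c k * of_real (G (\<theta> * of_int k - l)))" for l k
  have D: "cmod (D l k) \<le> e l k * r k" for l k
  proof -
    let ?y = "t + of_int k - l" and ?x = "\<theta> * of_int k - l"
    \<comment> \<open>Adding and subtracting \<open>w (\<theta> k) G (\<theta> k - l)\<close>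
      separates the mismatch of the nodes from the variation of the weight.\<close>
    have "D l k = c k * of_real (w (\<theta> * of_int k) * (G ?y - G ?x) + (w (\<theta> * of_int k) - w l) * G ?x)"
      by (simp add: D_def u_def algebra_simps)
    then have "cmod (D l k) = cmod (c k) * \<bar>w (\<theta> * of_int k) * (G ?y - G ?x) + (w (\<theta> * of_int k) - w l) * G ?x\<bar>"
      by (simp only: norm_mult norm_of_real)
    also have "\<bar>w (\<theta> * of_int k) * (G ?y - G ?x) + (w (\<theta> * of_int k) - w l) * G ?x\<bar>
        \<le> w (\<theta> * of_int k) * (C * \<bar>(1 - \<theta>) * (of_int k - of_int m)\<bar> * e l k) + w (\<theta> * of_int k) * (C * (4 * b / a) * e l k)"
    proof (rule order.trans[OF abs_triangle_ineq], rule add_mono)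
      have exy: "exp (- a * \<bar>?y\<bar>) + exp (- a * \<bar>?x\<bar>) \<le> e l k"
      proof -
        have h: "exp (- a * \<bar>z\<bar>) \<le> exp (- (a / 2) * \<bar>z\<bar>)" for z :: real using a by simp
        show ?thesis unfolding e_def using h[of ?x] h[of ?y] by linarith
      qed
      have "?y - ?x = (1 - \<theta>) * (of_int k - of_int m)" by (simp add: t_def algebra_simps)
      then have "\<bar>G ?y - G ?x\<bar> \<le> C * \<bar>(1 - \<theta>) * (of_int k - of_int m)\<bar> * (exp (- a * \<bar>?y\<bar>) + exp (- a * \<bar>?x\<bar>))"
        using G_lip[of ?y ?x] by (simp only:)
      also have "\<dots> \<le> C * \<bar>(1 - \<theta>) * (of_int k - of_int m)\<bar> * e l k"
        using C by (intro mult_left_mono exy) auto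
      finally show "\<bar>w (\<theta> * of_int k) * (G ?y - G ?x)\<bar> \<le> w (\<theta> * of_int k) * (C * \<bar>(1 - \<theta>) * (of_int k - of_int m)\<bar> * e l k)"
        unfolding abs_mult[of "w _"] abs_of_pos[OF w_pos] using w_pos[of "\<theta> * of_int k"] by (intro mult_left_mono) auto
      have "\<bar>w (\<theta> * of_int k) - w l\<bar> \<le> w (\<theta> * of_int k) * (b * \<bar>?x\<bar> * exp (b * \<bar>?x\<bar>))"
        unfolding w_def by (rule exp_weight_diff[OF b(1)])
      then have "\<bar>(w (\<theta> * of_int k) - w l) * G ?x\<bar> \<le> (w (\<theta> * of_int k) * (b * \<bar>?x\<bar> * exp (b * \<bar>?x\<bar>))) * (C * exp (- a * \<bar>?x\<bar>))"
        unfolding abs_mult using w_pos[of "\<theta> * of_int k"] b(1) by (intro mult_mono G_le) auto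
      also have "\<dots> = w (\<theta> * of_int k) * (C * b * (\<bar>?x\<bar> * (exp (b * \<bar>?x\<bar>) * exp (- a * \<bar>?x\<bar>))))"
        by simp
      \<comment> \<open>The rate \<open>a\<close> is divided: \<open>a / 4\<close> absorbs the
        linear factor, at most \<open>a / 4\<close> the growth \<open>exp (b \<bar>x\<bar>)\<close>,
        and \<open>a / 2\<close> is left for Schur's test. Absorbing the linear factor costs
        \<open>4 / a\<close>, the origin of \<open>4 * b / a\<close>.\<close>
      also have "\<bar>?x\<bar> * (exp (b * \<bar>?x\<bar>) * exp (- a * \<bar>?x\<bar>)) \<le> 4 / a * exp (- (a / 2) * \<bar>?x\<bar>)"
      proof -
        have "a / 4 * \<bar>?x\<bar> \<le> exp (a / 4 * \<bar>?x\<bar>)" using exp_ge_add_one_self[of "a / 4 * \<bar>?x\<bar>"] by linarith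
        then have "\<bar>?x\<bar> \<le> 4 / a * exp (a / 4 * \<bar>?x\<bar>)" using a by (simp add: field_simps)
        moreover have "exp (b * \<bar>?x\<bar>) * exp (- a * \<bar>?x\<bar>) \<le> exp (- (3 * a / 4) * \<bar>?x\<bar>)"
        proof -
          have "b * \<bar>?x\<bar> \<le> a / 4 * \<bar>?x\<bar>" using b(2) by (rule mult_right_mono) simp
          then show ?thesis by (simp add: exp_add[symmetric])
        qed
        ultimately have "\<bar>?x\<bar> * (exp (b * \<bar>?x\<bar>) * exp (- a * \<bar>?x\<bar>)) \<le> (4 / a * exp (a / 4 * \<bar>?x\<bar>)) * exp (- (3 * a / 4) * \<bar>?x\<bar>)"
          using a by (intro mult_mono) auto
        then show ?thesis by (simp add: mult.assoc exp_add[symmetric])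
      qed
      then have "w (\<theta> * of_int k) * (C * b * (\<bar>?x\<bar> * (exp (b * \<bar>?x\<bar>) * exp (- a * \<bar>?x\<bar>))))
         \<le> w (\<theta> * of_int k) * (C * b * (4 / a * exp (- (a / 2) * \<bar>?x\<bar>)))"
        using w_pos[of "\<theta> * of_int k"] C b(1) by (intro mult_left_mono) auto
      also have "\<dots> \<le> w (\<theta> * of_int k) * (C * b * (4 / a * e l k))"
        using w_pos[of "\<theta> * of_int k"] C b(1) a by (intro mult_left_mono) (auto simp: e_def)
      finally show "\<bar>(w (\<theta> * of_int k) - w l) * G ?x\<bar> \<le> w (\<theta> * of_int k) * (C * (4 * b / a) * e l k)"
        by (simp add: mult_ac)
    qed
    then have "cmod (c k) * \<bar>w (\<theta> * of_int k) * (G ?y - G ?x) + (w (\<theta> * of_int k) - w l) * G ?x\<bar>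
        \<le> cmod (c k) * (w (\<theta> * of_int k) * (C * \<bar>(1 - \<theta>) * (of_int k - of_int m)\<bar> * e l k) + w (\<theta> * of_int k) * (C * (4 * b / a) * e l k))"
      by (rule mult_left_mono) simp
    also have "\<dots> = e l k * r k" unfolding r_def by (simp add: algebra_simps)
    finally show ?thesis .
  qed
  have U: "cmod (U l) \<le> w l * cmod (S l) + cmod (LINT k|count_space UNIV. D l k)" for l
  proof -
    have "integrable (count_space UNIV) (\<lambda>k. u k * of_real (G (t + of_int k - l)))"
      "integrable (count_space UNIV) (\<lambda>k. of_real (w l) * (c k * of_real (G (\<theta> * of_int k - l))))"
      by (rule integrable_finite_support[OF fin]; simp add: u_def)+
    then have "(LINT k|count_space UNIV. D l k) = U l - of_real (w l) * S l"
      unfolding D_def U_def S_def by simp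
    then have "U l = of_real (w l) * S l + (LINT k|count_space UNIV. D l k)" by simp
    then show ?thesis
      using norm_triangle_ineq[of "of_real (w l) * S l" "LINT k|count_space UNIV. D l k"] w_pos[of l] by (simp add: norm_mult)
  qed
  have U2: "ennreal ((cmod (U l))\<^sup>2) \<le> 2 * (W m l * ennreal ((cmod (S l))\<^sup>2)) + 2 * (\<integral>\<^sup>+k. ennreal (e l k * r k) \<partial>count_space UNIV)\<^sup>2" for l
  proof -
    have "(cmod (U l))\<^sup>2 \<le> (w l * cmod (S l) + cmod (LINT k|count_space UNIV. D l k))\<^sup>2"
      using U by (rule power_mono) simp
    also have "\<dots> \<le> 2 * ((w l)\<^sup>2 * (cmod (S l))\<^sup>2) + 2 * (cmod (LINT k|count_space UNIV. D l k))\<^sup>2"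
      using sum_squares_ge_zero[of "w l * cmod (S l) - cmod (LINT k|count_space UNIV. D l k)" 0]
      by (simp add: power2_eq_square algebra_simps)
    finally have "ennreal ((cmod (U l))\<^sup>2) \<le> 2 * (W m l * ennreal ((cmod (S l))\<^sup>2)) + 2 * (ennreal (cmod (LINT k|count_space UNIV. D l k)))\<^sup>2"
      by (subst (asm) ennreal_le_iff[symmetric]) (auto simp: W ennreal_mult ennreal_power)
    also have "ennreal (cmod (LINT k|count_space UNIV. D l k)) \<le> (\<integral>\<^sup>+k. ennreal (e l k * r k) \<partial>count_space UNIV)"
      by (rule order.trans[OF norm_integral_le_nn_integral]) (intro nn_integral_mono ennreal_leI D)
    finally show ?thesis by (simp add: mult_left_mono power_mono)
  qed
  have schur: "(\<integral>\<^sup>+l. (\<integral>\<^sup>+k. ennreal (e l k * r k) \<partial>count_space UNIV)\<^sup>2 \<partial>count_space \<Lambda>)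
      \<le> ennreal K * ennreal K * (\<integral>\<^sup>+k. ennreal ((r k)\<^sup>2) \<partial>count_space UNIV)"
  proof (rule schur_test)
    show "countable \<Lambda>" by (rule separated_countable[OF sep])
    have add: "(\<integral>\<^sup>+i. ennreal (f i + g i) \<partial>count_space I) \<le> ennreal K"
      if "\<And>i. f i \<ge> 0" "\<And>i. g i \<ge> 0" "(\<integral>\<^sup>+i. ennreal (f i) \<partial>count_space I) \<le> ennreal p" "(\<integral>\<^sup>+i. ennreal (g i) \<partial>count_space I) \<le> ennreal q"
        "p \<ge> 0" "q \<ge> 0" "p + q \<le> K" for f g I p q
    proof -
      have "(\<integral>\<^sup>+i. ennreal (f i + g i) \<partial>count_space I) = (\<integral>\<^sup>+i. ennreal (f i) \<partial>count_space I) + (\<integral>\<^sup>+i. ennreal (g i) \<partial>count_space I)"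
        using that(1,2) by (subst nn_integral_add[symmetric]) (auto simp: ennreal_plus)
      also have "\<dots> \<le> ennreal p + ennreal q" using that(3,4) by (rule add_mono)
      also have "\<dots> = ennreal (p + q)" using that(5,6) by (rule ennreal_plus[symmetric])
      also have "\<dots> \<le> ennreal K" using that(7) by (rule ennreal_leI)
      finally show ?thesis .
    qed
    have pos: "sep_const (a / 2) d0 > 0" "sep_const (a / 2) 1 > 0" "sep_const (a / 2) (1 / 2) > 0"
      using a sep(1) by (auto intro: sep_const_pos)
    have abs: "\<bar>\<theta> * of_int k - l\<bar> = \<bar>l - \<theta> * real_of_int k\<bar>" "\<bar>t + of_int k - l\<bar> = \<bar>(l - t) - real_of_int k\<bar>"
       "\<bar>t + of_int k - l\<bar> = \<bar>(t + real_of_int k) - l\<bar>" for k l by auto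
    show "(\<integral>\<^sup>+k. ennreal (e l k) \<partial>count_space UNIV) \<le> ennreal K" for l
      unfolding e_def abs(1,2)
    proof (rule add)
      show "(\<integral>\<^sup>+k. ennreal (exp (- (a / 2) * \<bar>l - \<theta> * real_of_int k\<bar>)) \<partial>count_space UNIV) \<le> ennreal (sep_const (a / 2) (1 / 2))"
      proof (rule separated_exp_sum)
        fix i j :: int assume "i \<noteq> j"
        then have "1 \<le> \<bar>real_of_int i - real_of_int j\<bar>" by linarith
        then have "(1 / 2) * 1 \<le> \<theta> * \<bar>real_of_int i - real_of_int j\<bar>" using \<theta> by (intro mult_mono) auto
        then show "1 / 2 \<le> \<bar>\<theta> * real_of_int i - \<theta> * real_of_int j\<bar>"
          using \<theta> by (simp add: right_diff_distrib[symmetric] abs_mult)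
      qed (use a in auto)
      show "(\<integral>\<^sup>+k. ennreal (exp (- (a / 2) * \<bar>(l - t) - real_of_int k\<bar>)) \<partial>count_space UNIV) \<le> ennreal (sep_const (a / 2) 1)"
        by (rule separated_exp_sum) (use a in auto)
    qed (use pos in \<open>auto simp: K_def\<close>)
    show "(\<integral>\<^sup>+l. ennreal (e l k) \<partial>count_space \<Lambda>) \<le> ennreal K" for k
      unfolding e_def
    proof (rule add)
      show "(\<integral>\<^sup>+l. ennreal (exp (- (a / 2) * \<bar>\<theta> * real_of_int k - l\<bar>)) \<partial>count_space \<Lambda>) \<le> ennreal (sep_const (a / 2) d0)"
        by (rule separated_exp_sum) (use a sep in auto)
      show "(\<integral>\<^sup>+l. ennreal (exp (- (a / 2) * \<bar>t + real_of_int k - l\<bar>)) \<partial>count_space \<Lambda>) \<le> ennreal (sep_const (a / 2) d0)"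
        by (rule separated_exp_sum) (use a sep in auto)
    qed (use pos in \<open>auto simp: K_def\<close>)
  qed (auto simp: e_def r_nn)
  have "ennreal A * (\<integral>\<^sup>+k. W m (\<theta> * of_int k) * ennreal ((cmod (c k))\<^sup>2) \<partial>count_space UNIV) = ennreal A * coeff_norm u"
    unfolding coeff_norm_def u_def W using w_pos by (simp add: norm_mult power_mult_distrib ennreal_mult)
  also have "\<dots> \<le> sample_norm \<Lambda> G t u" by (rule samp[OF fin_u])
  also have "\<dots> = (\<integral>\<^sup>+l. ennreal ((cmod (U l))\<^sup>2) \<partial>count_space \<Lambda>)"
    by (simp add: sample_norm_def U_def)
  also have "\<dots> \<le> (\<integral>\<^sup>+l. 2 * (W m l * ennreal ((cmod (S l))\<^sup>2)) + 2 * (\<integral>\<^sup>+k. ennreal (e l k * r k) \<partial>count_space UNIV)\<^sup>2 \<partial>count_space \<Lambda>)"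
    by (intro nn_integral_mono U2)
  also have "\<dots> = 2 * (\<integral>\<^sup>+l. W m l * ennreal ((cmod (S l))\<^sup>2) \<partial>count_space \<Lambda>) + 2 * (\<integral>\<^sup>+l. (\<integral>\<^sup>+k. ennreal (e l k * r k) \<partial>count_space UNIV)\<^sup>2 \<partial>count_space \<Lambda>)"
    by (simp add: nn_integral_add nn_integral_cmult)
  also have "\<dots> \<le> 2 * (\<integral>\<^sup>+l. W m l * ennreal ((cmod (S l))\<^sup>2) \<partial>count_space \<Lambda>) + 2 * (ennreal K * ennreal K * (\<integral>\<^sup>+k. ennreal ((r k)\<^sup>2) \<partial>count_space UNIV))"
    by (intro add_mono mult_left_mono schur) auto
  also have "(\<integral>\<^sup>+k. ennreal ((r k)\<^sup>2) \<partial>count_space UNIV)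
      \<le> (\<integral>\<^sup>+k. ennreal (2 * C\<^sup>2) * (W m (\<theta> * of_int k) * ennreal ((((1 - \<theta>) * (of_int k - of_int m))\<^sup>2 + (4 * b / a)\<^sup>2) * (cmod (c k))\<^sup>2)) \<partial>count_space UNIV)"
  proof (rule nn_integral_mono)
    fix k :: int
    let ?z = "\<bar>(1 - \<theta>) * (of_int k - of_int m)\<bar>" and ?q = "4 * b / a"
    have "(p + q)\<^sup>2 \<le> 2 * (p\<^sup>2 + q\<^sup>2)" for p q :: real
      using sum_squares_bound[of p q] by (simp add: power2_sum)
    from this[of ?z ?q] have "(?z + ?q)\<^sup>2 \<le> 2 * (?z\<^sup>2 + ?q\<^sup>2)" .
    then have le: "(w (\<theta> * of_int k) * cmod (c k) * C)\<^sup>2 * (?z + ?q)\<^sup>2 \<le> (w (\<theta> * of_int k) * cmod (c k) * C)\<^sup>2 * (2 * (?z\<^sup>2 + ?q\<^sup>2))"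
      by (rule mult_left_mono) simp
    have 1: "(w (\<theta> * of_int k) * cmod (c k) * C)\<^sup>2 * (?z + ?q)\<^sup>2 = (r k)\<^sup>2"
      by (simp only: r_def power_mult_distrib mult_ac)
    have 2: "(w (\<theta> * of_int k) * cmod (c k) * C)\<^sup>2 * (2 * P) = 2 * C\<^sup>2 * ((w (\<theta> * of_int k))\<^sup>2 * (P * (cmod (c k))\<^sup>2))" for P
      by (simp add: power_mult_distrib mult_ac)
    have "(r k)\<^sup>2 \<le> 2 * C\<^sup>2 * ((w (\<theta> * of_int k))\<^sup>2 * ((?z\<^sup>2 + ?q\<^sup>2) * (cmod (c k))\<^sup>2))"
      using le unfolding 1 2 .
    then have "ennreal ((r k)\<^sup>2) \<le> ennreal (2 * C\<^sup>2 * ((w (\<theta> * of_int k))\<^sup>2 * ((?z\<^sup>2 + ?q\<^sup>2) * (cmod (c k))\<^sup>2)))"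
      by (rule ennreal_leI)
    also have "\<dots> = ennreal (2 * C\<^sup>2) * (W m (\<theta> * of_int k) * ennreal ((?z\<^sup>2 + ?q\<^sup>2) * (cmod (c k))\<^sup>2))"
      unfolding W by (subst ennreal_mult, simp, simp, subst ennreal_mult) auto
    finally show "ennreal ((r k)\<^sup>2) \<le> ennreal (2 * C\<^sup>2) * (W m (\<theta> * of_int k) * ennreal ((((1 - \<theta>) * (of_int k - of_int m))\<^sup>2 + (4 * b / a)\<^sup>2) * (cmod (c k))\<^sup>2))"
      by simp
  qed
  also have "\<dots> = ennreal (2 * C\<^sup>2) * (\<integral>\<^sup>+k. W m (\<theta> * of_int k) * ennreal ((((1 - \<theta>) * (of_int k - of_int m))\<^sup>2 + (4 * b / a)\<^sup>2) * (cmod (c k))\<^sup>2) \<partial>count_space UNIV)"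
    by (rule nn_integral_cmult) simp
  finally have "ennreal A * (\<integral>\<^sup>+k. W m (\<theta> * of_int k) * ennreal ((cmod (c k))\<^sup>2) \<partial>count_space UNIV)
    \<le> 2 * (\<integral>\<^sup>+l. W m l * ennreal ((cmod (S l))\<^sup>2) \<partial>count_space \<Lambda>) + 2 * (ennreal K * ennreal K * (ennreal (2 * C\<^sup>2) * (\<integral>\<^sup>+k. W m (\<theta> * of_int k) * ennreal ((((1 - \<theta>) * (of_int k - of_int m))\<^sup>2 + (4 * b / a)\<^sup>2) * (cmod (c k))\<^sup>2) \<partial>count_space UNIV)))"
    by (simp add: add_left_mono mult_left_mono)
  also have "2 * (ennreal K * ennreal K * (ennreal (2 * C\<^sup>2) * X)) = ennreal (4 * K\<^sup>2 * C\<^sup>2) * X" for X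
  proof -
    have "ennreal (4 * K\<^sup>2 * C\<^sup>2) = ennreal (2 * (K * K * (2 * C\<^sup>2)))"
      by (simp add: power2_eq_square mult_ac)
    also have "\<dots> = 2 * (ennreal K * ennreal K * ennreal (2 * C\<^sup>2))"
      using K C ennreal_mult[of 2 "K * K * (2 * C\<^sup>2)"] ennreal_mult[of "K * K" "2 * C\<^sup>2"] ennreal_mult[of K K]
      by (simp only: ennreal_numeral) simp
    finally show ?thesis by (simp only: mult.assoc)
  qed
  finally show ?thesis .
qed

text \<open>Summing the local inequalities over all centres \<open>m\<close> turns the weighted
  norms into global ones. The order of choices matters: \<open>b\<close> makes the commutator error
  at most \<open>A / 4\<close> relative to the total weight \<open>E\<close>, a comparison that is
  the same for every \<theta>. Then \<open>\<epsilon> = 1 - \<theta>\<close> is chosen small against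
  the bound \<open>L\<close> for the second moment of the weights, which is finite for the fixed
  \<open>b\<close> but blows up as \<open>b\<close> tends to 0.\<close>

lemma deformed_sampling:
  fixes \<Lambda> :: "real set"
  assumes sep: "d0 > 0" "\<And>x y. x \<in> \<Lambda> \<Longrightarrow> y \<in> \<Lambda> \<Longrightarrow> x \<noteq> y \<Longrightarrow> d0 \<le> \<bar>x - y\<bar>"
    and G: "exp_decay a C G" and "A > 0"
    and samp: "\<And>t c. finite {k. c k \<noteq> 0} \<Longrightarrow> ennreal A * coeff_norm c \<le> sample_norm \<Lambda> G t c"
  shows "\<exists>\<theta> A'. 1 / 2 \<le> \<theta> \<and> \<theta> < 1 \<and> A' > 0 \<and>
    (\<forall>c. finite {k. c k \<noteq> 0} \<longrightarrow> ennreal A' * coeff_norm c \<le> deformed_norm \<Lambda> G \<theta> c)"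
proof -
  have a: "a > 0" and C: "C > 0" using G by (auto simp: exp_decay_def)
  define K where "K = 2 * (sep_const (a / 2) d0 + sep_const (a / 2) 1 + sep_const (a / 2) (1 / 2))"
  have K: "K > 0"
    unfolding K_def using sep_const_pos[of "a / 2"] a sep(1) by (simp add: add_pos_pos)
  define Q where "Q = 4 * K\<^sup>2 * C\<^sup>2"
  have Q: "Q > 0" using K C by (simp add: Q_def)
  define b where "b = min (a / 4) (a / 4 * sqrt (A / (4 * Q)))"
  have b: "b > 0" "b \<le> a / 4" using a \<open>A > 0\<close> Q by (auto simp: b_def)
  have bA: "Q * (4 * b / a)\<^sup>2 \<le> A / 4"
  proof -
    have "4 * b / a \<le> sqrt (A / (4 * Q))" using a by (simp add: b_def min_def field_simps)
    then have "(4 * b / a)\<^sup>2 \<le> (sqrt (A / (4 * Q)))\<^sup>2" using a b by (intro power_mono) auto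
    also have "\<dots> = A / (4 * Q)" using \<open>A > 0\<close> Q by simp
    finally show ?thesis using Q by (simp add: field_simps)
  qed
  \<comment> \<open>Valid for every \<open>\<theta> \<ge> 1 / 2\<close>, since then the weights
    decay in \<open>k - m\<close> at rate at least \<open>b\<close>; half of that rate is spent on
    \<open>x^2 \<le> 8 / b^2 exp (b x / 2)\<close>.\<close>
  define L where "L = 8 / b\<^sup>2 * sep_const (b / 2) 1"
  have L: "L > 0" using b sep_const_pos[of "b / 2" 1] by (simp add: L_def)
  define \<epsilon> where "\<epsilon> = min (1 / 2) (sqrt (A / (4 * Q * L)))"
  have \<epsilon>: "\<epsilon> > 0" "\<epsilon> \<le> 1 / 2" using \<open>A > 0\<close> Q L by (auto simp: \<epsilon>_def)
  have \<epsilon>A: "Q * (\<epsilon>\<^sup>2 * L) \<le> A / 4"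
  proof -
    have "\<epsilon>\<^sup>2 \<le> (sqrt (A / (4 * Q * L)))\<^sup>2" using \<epsilon> by (intro power_mono) (auto simp: \<epsilon>_def)
    also have "\<dots> = A / (4 * Q * L)" using \<open>A > 0\<close> Q L by simp
    finally show ?thesis using Q L by (simp add: field_simps)
  qed
  define \<theta> where "\<theta> = 1 - \<epsilon>"
  have \<theta>: "1 / 2 \<le> \<theta>" "\<theta> < 1" using \<epsilon> by (auto simp: \<theta>_def)
  define W where "W = (\<lambda>m x. ennreal (exp (- (2 * b) * \<bar>x - \<theta> * real_of_int m\<bar>)))"
  define E where "E = (\<integral>\<^sup>+j. ennreal (exp (- (2 * b * \<theta>) * \<bar>real_of_int j\<bar>)) \<partial>count_space UNIV)"
  define T where "T = sep_const (2 * b) (1 / 2)"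
  have T: "T > 0" unfolding T_def using b by (intro sep_const_pos) auto
  have WT: "(\<integral>\<^sup>+m. W m x \<partial>count_space UNIV) \<le> ennreal T" for x
    unfolding W_def T_def
  proof (rule separated_exp_sum)
    fix i j :: int assume "i \<noteq> j"
    then have "1 \<le> \<bar>real_of_int i - real_of_int j\<bar>" by linarith
    then have "(1 / 2) * 1 \<le> \<theta> * \<bar>real_of_int i - real_of_int j\<bar>" using \<theta> by (intro mult_mono) auto
    then show "1 / 2 \<le> \<bar>\<theta> * real_of_int i - \<theta> * real_of_int j\<bar>"
      using \<theta> by (simp add: right_diff_distrib[symmetric] abs_mult)
  qed (use b in auto)
  have shift: "(\<integral>\<^sup>+m. f (k - m) \<partial>count_space UNIV) = (\<integral>\<^sup>+j. f j \<partial>count_space UNIV)" for f :: "int \<Rightarrow> ennreal" and k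
    by (rule nn_integral_bij_count_space) (rule bij_betwI[where g = "\<lambda>m. k - m"], auto)
  have Wk: "W m (\<theta> * of_int k) = ennreal (exp (- (2 * b * \<theta>) * \<bar>real_of_int (k - m)\<bar>))" for m k
    using \<theta> by (simp add: W_def right_diff_distrib[symmetric] abs_mult mult.assoc)
  have WE: "(\<integral>\<^sup>+m. W m (\<theta> * of_int k) \<partial>count_space UNIV) = E" for k
    unfolding Wk E_def by (rule shift)
  have E_le: "E \<le> ennreal T" using WT[of "\<theta> * of_int 0"] WE[of 0] by simp
  then obtain e where e: "E = ennreal e" "e \<ge> 0" by (cases E) (auto simp: top_unique)
  \<comment> \<open>The term \<open>j = 0\<close> alone contributes 1. This lets the mismatch error,
    which is relative to \<open>x\<close> only, be absorbed by the left-hand side, which is a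
    multiple of \<open>e * x\<close>.\<close>
  have "e \<ge> 1"
  proof -
    have "ennreal (exp (- (2 * b * \<theta>) * \<bar>real_of_int 0\<bar>)) \<le> E"
      unfolding E_def by (rule nn_integral_ge_point) simp
    then show ?thesis using e by simp
  qed
  have WL: "(\<integral>\<^sup>+m. W m (\<theta> * of_int k) * ennreal ((of_int k - of_int m)\<^sup>2) \<partial>count_space UNIV) \<le> ennreal L" for k
  proof -
    have pt: "W m (\<theta> * of_int k) * ennreal ((of_int k - of_int m)\<^sup>2)
        \<le> ennreal (8 / b\<^sup>2) * ennreal (exp (- (b / 2) * \<bar>real_of_int k - of_int m\<bar>))" for m
    proof -
      define x where "x = \<bar>real_of_int k - of_int m\<bar>"
      have "x \<ge> 0" by (simp add: x_def)
      have "b * x \<le> 2 * b * \<theta> * x" using b \<theta> \<open>x \<ge> 0\<close> by (intro mult_right_mono) auto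
      moreover have "(b / 2 * x)\<^sup>2 / 2 \<le> exp (b / 2 * x)"
      proof -
        have "0 \<le> b / 2 * x" using b \<open>x \<ge> 0\<close> by simp
        then show ?thesis using exp_lower_Taylor_quadratic[of "b / 2 * x"] by linarith
      qed
      then have "x\<^sup>2 \<le> 8 / b\<^sup>2 * exp (b / 2 * x)"
        using b by (simp add: field_simps power2_eq_square)
      ultimately have "exp (- (2 * b * \<theta>) * x) * x\<^sup>2 \<le> exp (- (b * x)) * (8 / b\<^sup>2 * exp (b / 2 * x))"
        by (intro mult_mono) auto
      also have "\<dots> = 8 / b\<^sup>2 * exp (- (b / 2) * x)"
        by (simp add: exp_add[symmetric])
      finally show ?thesis
        unfolding Wk by (simp add: ennreal_mult[symmetric] x_def ennreal_leI)
    qed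
    have "(\<integral>\<^sup>+m. W m (\<theta> * of_int k) * ennreal ((of_int k - of_int m)\<^sup>2) \<partial>count_space UNIV)
       \<le> (\<integral>\<^sup>+m. ennreal (8 / b\<^sup>2) * ennreal (exp (- (b / 2) * \<bar>real_of_int k - of_int m\<bar>)) \<partial>count_space UNIV)"
      by (intro nn_integral_mono pt)
    also have "\<dots> = ennreal (8 / b\<^sup>2) * (\<integral>\<^sup>+m. ennreal (exp (- (b / 2) * \<bar>real_of_int k - of_int m\<bar>)) \<partial>count_space UNIV)"
      by (rule nn_integral_cmult) simp
    also have "\<dots> \<le> ennreal (8 / b\<^sup>2) * ennreal (sep_const (b / 2) 1)"
      by (intro mult_left_mono separated_exp_sum) (use b in auto)
    also have "\<dots> = ennreal L"
      unfolding L_def using b sep_const_pos[of "b / 2" 1] by (subst ennreal_mult) auto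
    finally show ?thesis .
  qed
  have "ennreal (A / (4 * T)) * coeff_norm c \<le> deformed_norm \<Lambda> G \<theta> c" if fin: "finite {k. c k \<noteq> 0}" for c
  proof -
    define S where "S = (\<lambda>l. LINT k|count_space UNIV. c k * of_real (G (\<theta> * of_int k - l)))"
    define X where "X = coeff_norm c"
    define Y where "Y = deformed_norm \<Lambda> G \<theta> c"
    have Y: "Y = (\<integral>\<^sup>+l. ennreal ((cmod (S l))\<^sup>2) \<partial>count_space \<Lambda>)" by (simp add: Y_def deformed_norm_def S_def)
    have X: "X = (\<integral>\<^sup>+k. ennreal ((cmod (c k))\<^sup>2) \<partial>count_space UNIV)" by (simp add: X_def coeff_norm_def)
    have "X = ennreal (\<Sum>k | c k \<noteq> 0. (cmod (c k))\<^sup>2)"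
      unfolding X using fin by (subst nn_integral_count_space'[OF fin]) auto
    moreover have "(\<Sum>k | c k \<noteq> 0. (cmod (c k))\<^sup>2) \<ge> 0" by (intro sum_nonneg) simp
    ultimately obtain x where x: "X = ennreal x" "x \<ge> 0" by blast
    let ?P = "\<lambda>m. \<integral>\<^sup>+k. W m (\<theta> * of_int k) * ennreal ((cmod (c k))\<^sup>2) \<partial>count_space UNIV"
    let ?R = "\<lambda>m. \<integral>\<^sup>+l. W m l * ennreal ((cmod (S l))\<^sup>2) \<partial>count_space \<Lambda>"
    let ?D = "\<lambda>m. \<integral>\<^sup>+k. W m (\<theta> * of_int k) * ennreal ((((1 - \<theta>) * (of_int k - of_int m))\<^sup>2 + (4 * b / a)\<^sup>2) * (cmod (c k))\<^sup>2) \<partial>count_space UNIV"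
    have local: "ennreal A * ?P m \<le> 2 * ?R m + ennreal Q * ?D m" for m
      using local_sampling_inequality[OF sep G samp fin \<theta>(1) less_imp_le[OF \<theta>(2)] less_imp_le[OF b(1)] b(2), of m]
      unfolding K_def[symmetric] Q_def[symmetric] W_def S_def by blast
    have D: "?D m = (\<integral>\<^sup>+k. W m (\<theta> * of_int k) * ennreal ((of_int k - of_int m)\<^sup>2) * (ennreal (\<epsilon>\<^sup>2) * ennreal ((cmod (c k))\<^sup>2))
        + W m (\<theta> * of_int k) * (ennreal ((4 * b / a)\<^sup>2) * ennreal ((cmod (c k))\<^sup>2)) \<partial>count_space UNIV)" for m
    proof (rule nn_integral_cong)
      fix k :: int
      have "(((1 - \<theta>) * (of_int k - of_int m))\<^sup>2 + (4 * b / a)\<^sup>2) * (cmod (c k))\<^sup>2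
         = (of_int k - of_int m)\<^sup>2 * (\<epsilon>\<^sup>2 * (cmod (c k))\<^sup>2) + (4 * b / a)\<^sup>2 * (cmod (c k))\<^sup>2"
        by (simp add: \<theta>_def power_mult_distrib distrib_right)
      then show "W m (\<theta> * of_int k) * ennreal ((((1 - \<theta>) * (of_int k - of_int m))\<^sup>2 + (4 * b / a)\<^sup>2) * (cmod (c k))\<^sup>2) =
         W m (\<theta> * of_int k) * ennreal ((of_int k - of_int m)\<^sup>2) * (ennreal (\<epsilon>\<^sup>2) * ennreal ((cmod (c k))\<^sup>2))
        + W m (\<theta> * of_int k) * (ennreal ((4 * b / a)\<^sup>2) * ennreal ((cmod (c k))\<^sup>2))"
        by (simp only: ennreal_plus ennreal_mult zero_le_power2 mult_nonneg_nonneg distrib_left mult.assoc)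
    qed
    have sumD: "(\<integral>\<^sup>+m. ?D m \<partial>count_space UNIV) \<le> ennreal L * (ennreal (\<epsilon>\<^sup>2) * X) + E * (ennreal ((4 * b / a)\<^sup>2) * X)"
    proof -
      have "(\<integral>\<^sup>+m. ?D m \<partial>count_space UNIV)
        = (\<integral>\<^sup>+m. (\<integral>\<^sup>+k. W m (\<theta> * of_int k) * ennreal ((of_int k - of_int m)\<^sup>2) * (ennreal (\<epsilon>\<^sup>2) * ennreal ((cmod (c k))\<^sup>2)) \<partial>count_space UNIV) \<partial>count_space UNIV)
        + (\<integral>\<^sup>+m. (\<integral>\<^sup>+k. W m (\<theta> * of_int k) * (ennreal ((4 * b / a)\<^sup>2) * ennreal ((cmod (c k))\<^sup>2)) \<partial>count_space UNIV) \<partial>count_space UNIV)"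
        unfolding D by (subst nn_integral_add[symmetric]) (auto intro!: nn_integral_cong nn_integral_add)
      also have "\<dots> \<le> ennreal L * (\<integral>\<^sup>+k. ennreal (\<epsilon>\<^sup>2) * ennreal ((cmod (c k))\<^sup>2) \<partial>count_space UNIV)
          + E * (\<integral>\<^sup>+k. ennreal ((4 * b / a)\<^sup>2) * ennreal ((cmod (c k))\<^sup>2) \<partial>count_space UNIV)"
        by (intro add_mono weighted_nn_integral_sum) (auto simp: WL WE)
      also have "\<dots> = ennreal L * (ennreal (\<epsilon>\<^sup>2) * X) + E * (ennreal ((4 * b / a)\<^sup>2) * X)"
        unfolding X by (simp add: nn_integral_cmult)
      finally show ?thesis .
    qed
    have sumR: "(\<integral>\<^sup>+m. ?R m \<partial>count_space UNIV) \<le> ennreal T * Y"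
      unfolding Y by (rule weighted_nn_integral_sum) (use separated_countable[OF sep] WT in auto)
    have sumP: "(\<integral>\<^sup>+m. ?P m \<partial>count_space UNIV) = E * X"
    proof -
      have "(\<integral>\<^sup>+m. ?P m \<partial>count_space UNIV)
          = (\<integral>\<^sup>+k. (\<integral>\<^sup>+m. W m (\<theta> * of_int k) * ennreal ((cmod (c k))\<^sup>2) \<partial>count_space UNIV) \<partial>count_space UNIV)"
        by (rule nn_integral_count_space_nn_integral) auto
      also have "\<dots> = (\<integral>\<^sup>+k. E * ennreal ((cmod (c k))\<^sup>2) \<partial>count_space UNIV)"
        by (simp add: nn_integral_multc WE)
      also have "\<dots> = E * X" unfolding X by (rule nn_integral_cmult) simp
      finally show ?thesis .
    qed
    have "ennreal A * (E * X) = (\<integral>\<^sup>+m. ennreal A * ?P m \<partial>count_space UNIV)"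
      unfolding sumP[symmetric] by (rule nn_integral_cmult[symmetric]) simp
    also have "\<dots> \<le> (\<integral>\<^sup>+m. 2 * ?R m + ennreal Q * ?D m \<partial>count_space UNIV)"
      by (intro nn_integral_mono local)
    also have "\<dots> = 2 * (\<integral>\<^sup>+m. ?R m \<partial>count_space UNIV) + ennreal Q * (\<integral>\<^sup>+m. ?D m \<partial>count_space UNIV)"
      by (simp add: nn_integral_add nn_integral_cmult)
    also have "\<dots> \<le> 2 * (ennreal T * Y) + ennreal Q * (ennreal L * (ennreal (\<epsilon>\<^sup>2) * X) + E * (ennreal ((4 * b / a)\<^sup>2) * X))"
      by (intro add_mono mult_left_mono sumR sumD) auto
    finally have main: "ennreal A * (E * X) \<le> 2 * (ennreal T * Y) + ennreal Q * (ennreal L * (ennreal (\<epsilon>\<^sup>2) * X) + E * (ennreal ((4 * b / a)\<^sup>2) * X))" .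
    show ?thesis
    proof (cases Y)
      case (real y)
      have "2 * (ennreal T * Y) + ennreal Q * (ennreal L * (ennreal (\<epsilon>\<^sup>2) * X) + E * (ennreal ((4 * b / a)\<^sup>2) * X))
        = ennreal (2 * (T * y) + Q * (L * (\<epsilon>\<^sup>2 * x) + e * ((4 * b / a)\<^sup>2 * x)))"
        using T Q L x e real by (simp add: ennreal_mult ennreal_plus)
      moreover have "ennreal A * (E * X) = ennreal (A * (e * x))"
        using \<open>A > 0\<close> x e by (simp add: ennreal_mult)
      moreover have "2 * (T * y) + Q * (L * (\<epsilon>\<^sup>2 * x) + e * ((4 * b / a)\<^sup>2 * x)) \<ge> 0"
        using T Q L x e real by simp
      ultimately have "A * (e * x) \<le> 2 * (T * y) + Q * (L * (\<epsilon>\<^sup>2 * x) + e * ((4 * b / a)\<^sup>2 * x))"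
        using main by simp
      also have "\<dots> = 2 * (T * y) + (Q * (\<epsilon>\<^sup>2 * L)) * x + (Q * (4 * b / a)\<^sup>2) * (e * x)"
        by (simp add: algebra_simps)
      also have "\<dots> \<le> 2 * (T * y) + A / 4 * x + A / 4 * (e * x)"
        using \<epsilon>A bA x e by (intro add_mono order_refl mult_right_mono) auto
      finally have "A * (e * x) \<le> 2 * (T * y) + A / 4 * x + A / 4 * (e * x)" .
      moreover have "A * x \<le> A * (e * x)"
        using \<open>e \<ge> 1\<close> x \<open>A > 0\<close> by (intro mult_left_mono) (auto simp: mult_le_cancel_right1)
      ultimately have "A / 2 * x \<le> 2 * (T * y)" by simp
      then have "A / (4 * T) * x \<le> y" using T by (simp add: field_simps)
      then have "ennreal (A / (4 * T) * x) \<le> ennreal y" by (rule ennreal_leI)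
      moreover have "ennreal (A / (4 * T) * x) = ennreal (A / (4 * T)) * ennreal x"
        using x(2) \<open>A > 0\<close> T by (intro ennreal_mult) auto
      ultimately show ?thesis
        using real x(1) by (simp only: X_def[symmetric] Y_def[symmetric])
    qed (simp add: Y_def)
  qed
  then show ?thesis
    using \<theta> \<open>A > 0\<close> T by (intro exI[of _ \<theta>] exI[of _ "A / (4 * T)"]) auto
qed

text \<open>If \<Lambda> had fewer points in the interval than there are nodes
  \<open>\<theta> k\<close> in the interval shortened by \<open>r\<close> at both ends, a nonzero
  combination of these nodes would vanish at all those points. Its other samples are taken at
  distance at least \<open>r\<close> from the nodes and are too small for the lower bound
  \<open>A\<close>. The 1 subtracted is the rounding loss in counting integers in an interval of
  length \<open>2 (R - r) / \<theta>\<close>.\<close>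

lemma deformed_sampling_many_points:
  fixes \<Lambda> :: "real set"
  assumes sep: "d0 > 0" "\<And>x y. x \<in> \<Lambda> \<Longrightarrow> y \<in> \<Lambda> \<Longrightarrow> x \<noteq> y \<Longrightarrow> d0 \<le> \<bar>x - y\<bar>"
    and G: "exp_decay a C G" and "A > 0" and \<theta>: "1 / 2 \<le> \<theta>" "\<theta> < 1"
    and samp: "\<And>c. finite {k. c k \<noteq> 0} \<Longrightarrow> ennreal A * coeff_norm c \<le> deformed_norm \<Lambda> G \<theta> c"
  shows "\<exists>r>0. \<forall>R>r. \<forall>x. 2 * (R - r) / \<theta> - 1 \<le> real (card (\<Lambda> \<inter> {x - R..x + R}))"
proof -
  have a: "a > 0" and C: "C > 0" and G_le: "\<bar>G x\<bar> \<le> C * exp (- a * \<bar>x\<bar>)" for x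
    using G by (auto simp: exp_decay_def)
  define K where "K = sep_const (a / 2) d0 + sep_const (a / 2) (1 / 2)"
  have pos: "sep_const (a / 2) d0 > 0" "sep_const (a / 2) (1 / 2) > 0"
    using a sep(1) by (auto intro: sep_const_pos)
  then have K: "K > 0" by (simp add: K_def)
  \<comment> \<open>Half of the decay rate becomes smallness through the distance \<open>r\<close>;
    the other half feeds Schur's test, whose constant is \<open>K\<close>.\<close>
  have "((\<lambda>r. exp (- (a / 2) * r)) \<longlongrightarrow> 0) at_top"
    using a by real_asymp
  then have "((\<lambda>r. (C * exp (- (a / 2) * r))\<^sup>2 * (K * K)) \<longlongrightarrow> (C * 0)\<^sup>2 * (K * K)) at_top"
    by (intro tendsto_intros)
  then have "((\<lambda>r. (C * exp (- (a / 2) * r))\<^sup>2 * (K * K)) \<longlongrightarrow> 0) at_top" by simp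
  then have "eventually (\<lambda>r. (C * exp (- (a / 2) * r))\<^sup>2 * (K * K) < A) at_top"
    using \<open>A > 0\<close> by (rule order_tendstoD(2))
  then have "eventually (\<lambda>r. r > 0 \<and> (C * exp (- (a / 2) * r))\<^sup>2 * (K * K) < A) at_top"
    using eventually_gt_at_top[of 0] by eventually_elim auto
  then obtain r where r: "r > 0" "(C * exp (- (a / 2) * r))\<^sup>2 * (K * K) < A"
    unfolding eventually_at_top_linorder by blast
  have "2 * (R - r) / \<theta> - 1 \<le> real (card (\<Lambda> \<inter> {x - R..x + R}))" if "R > r" for R x
  proof (rule ccontr)
    assume neg: "\<not> ?thesis"
    let ?L = "\<Lambda> \<inter> {x - R..x + R}"
    define J where "J = {\<lceil>(x - (R - r)) / \<theta>\<rceil>..\<lfloor>(x + (R - r)) / \<theta>\<rfloor>}"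
    have J: "\<bar>\<theta> * of_int k - x\<bar> \<le> R - r" if "k \<in> J" for k
    proof -
      have "(x - (R - r)) / \<theta> \<le> of_int k" "of_int k \<le> (x + (R - r)) / \<theta>"
        using that by (auto simp: J_def ceiling_le_iff le_floor_iff)
      then have "x - (R - r) \<le> of_int k * \<theta>" "of_int k * \<theta> \<le> x + (R - r)"
        using \<theta> by (auto simp: field_simps)
      then show ?thesis by (simp add: abs_le_iff mult.commute)
    qed
    have "2 * (R - r) / \<theta> - 1 \<le> real (card J)"
    proof -
      have "(x + (R - r)) / \<theta> - (x - (R - r)) / \<theta> = 2 * (R - r) / \<theta>"
        by (simp add: diff_divide_distrib[symmetric])
      then show ?thesis unfolding J_def by simp linarith
    qed
    then have "card ?L < card J" using neg by linarith
    moreover have "finite ?L" by (rule separated_finite_Icc[OF sep])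
    ultimately obtain c where c: "\<forall>k. k \<notin> J \<longrightarrow> c k = 0" "\<exists>k. c k \<noteq> 0"
      "\<forall>l\<in>?L. (\<Sum>k\<in>J. of_real (G (\<theta> * of_int k - l)) * c k) = (0 :: complex)"
      using underdetermined_system[of ?L J "\<lambda>l k. of_real (G (\<theta> * of_int k - l))"] by (auto simp: J_def)
    have finJ: "finite J" by (simp add: J_def)
    have fin: "finite {k. c k \<noteq> 0}" using c(1) by (intro finite_subset[OF _ finJ]) auto
    define S where "S l = (LINT k|count_space UNIV. c k * of_real (G (\<theta> * of_int k - l)))" for l
    have S_sum: "S l = (\<Sum>k\<in>J. of_real (G (\<theta> * of_int k - l)) * c k)" for l
    proof -
      have "S l = (\<Sum>k | k \<in> UNIV \<and> c k * of_real (G (\<theta> * of_int k - l)) \<noteq> 0. c k * of_real (G (\<theta> * of_int k - l)))"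
        unfolding S_def by (rule lebesgue_integral_count_space_finite_support) (rule finite_subset[OF _ fin], auto)
      also have "\<dots> = (\<Sum>k\<in>J. c k * of_real (G (\<theta> * of_int k - l)))"
        using c(1) finJ by (intro sum.mono_neutral_left) auto
      finally show ?thesis by (simp add: mult.commute)
    qed
    define D where "D = C * exp (- (a / 2) * r)"
    have D: "D > 0" using C by (simp add: D_def)
    define e where "e l k = exp (- (a / 2) * \<bar>\<theta> * of_int k - l\<bar>)" for l and k :: int
    have S_le: "(ennreal (cmod (S l)))\<^sup>2 \<le> ennreal (D\<^sup>2) * (\<integral>\<^sup>+k. ennreal (e l k * cmod (c k)) \<partial>count_space UNIV)\<^sup>2" if "l \<in> \<Lambda>" for l
    proof (cases "l \<in> ?L")
      case True
      then have "S l = 0" using c(3) by (simp add: S_sum)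
      then show ?thesis by simp
    next
      case False
      have "ennreal (cmod (S l)) \<le> (\<integral>\<^sup>+k. ennreal (cmod (c k * of_real (G (\<theta> * of_int k - l)))) \<partial>count_space UNIV)"
        unfolding S_def by (rule norm_integral_le_nn_integral)
      also have "\<dots> \<le> (\<integral>\<^sup>+k. ennreal D * ennreal (e l k * cmod (c k)) \<partial>count_space UNIV)"
      proof (rule nn_integral_mono)
        fix k
        show "ennreal (cmod (c k * of_real (G (\<theta> * of_int k - l)))) \<le> ennreal D * ennreal (e l k * cmod (c k))"
        proof (cases "k \<in> J")
          case True
          have "r \<le> \<bar>\<theta> * of_int k - l\<bar>" using J[OF True] False that by auto
          then have "a / 2 * r \<le> a / 2 * \<bar>\<theta> * of_int k - l\<bar>" using a by (intro mult_left_mono) auto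
          then have "exp (- a * \<bar>\<theta> * of_int k - l\<bar>) \<le> exp (- (a / 2) * r) * e l k"
            unfolding e_def by (simp add: exp_add[symmetric])
          then have "C * exp (- a * \<bar>\<theta> * of_int k - l\<bar>) \<le> C * (exp (- (a / 2) * r) * e l k)"
            using C by (intro mult_left_mono) auto
          with G_le[of "\<theta> * of_int k - l"] have "\<bar>G (\<theta> * of_int k - l)\<bar> \<le> D * e l k"
            unfolding D_def by (simp only: mult.assoc)
          then have "cmod (c k) * \<bar>G (\<theta> * of_int k - l)\<bar> \<le> cmod (c k) * (D * e l k)"
            by (rule mult_left_mono) simp
          then show ?thesis using D by (simp add: norm_mult ennreal_mult[symmetric] e_def mult_ac ennreal_leI)
        next
          case False
          then show ?thesis using c(1) by simp
        qed
      qed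
      also have "\<dots> = ennreal D * (\<integral>\<^sup>+k. ennreal (e l k * cmod (c k)) \<partial>count_space UNIV)"
        by (rule nn_integral_cmult) simp
      finally have "(ennreal (cmod (S l)))\<^sup>2 \<le> (ennreal D * (\<integral>\<^sup>+k. ennreal (e l k * cmod (c k)) \<partial>count_space UNIV))\<^sup>2"
        by (rule power_mono) simp
      then show ?thesis using D by (simp add: power_mult_distrib ennreal_power)
    qed
    have "deformed_norm \<Lambda> G \<theta> c \<le> (\<integral>\<^sup>+l. ennreal (D\<^sup>2) * (\<integral>\<^sup>+k. ennreal (e l k * cmod (c k)) \<partial>count_space UNIV)\<^sup>2 \<partial>count_space \<Lambda>)"
      unfolding deformed_norm_def S_def[symmetric] using S_le by (intro nn_integral_mono) (simp add: ennreal_power)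
    also have "\<dots> = ennreal (D\<^sup>2) * (\<integral>\<^sup>+l. (\<integral>\<^sup>+k. ennreal (e l k * cmod (c k)) \<partial>count_space UNIV)\<^sup>2 \<partial>count_space \<Lambda>)"
      by (rule nn_integral_cmult) simp
    also have "\<dots> \<le> ennreal (D\<^sup>2) * (ennreal K * ennreal K * (\<integral>\<^sup>+k. ennreal ((cmod (c k))\<^sup>2) \<partial>count_space UNIV))"
    proof (intro mult_left_mono schur_test)
      show "countable \<Lambda>" by (rule separated_countable[OF sep])
      have le: "ennreal (sep_const (a / 2) d0) \<le> ennreal K" "ennreal (sep_const (a / 2) (1 / 2)) \<le> ennreal K"
        using pos by (auto simp: K_def intro!: ennreal_leI)
      have "(\<integral>\<^sup>+k. ennreal (exp (- (a / 2) * \<bar>l - \<theta> * real_of_int k\<bar>)) \<partial>count_space UNIV) \<le> ennreal (sep_const (a / 2) (1 / 2))" for l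
      proof (rule separated_exp_sum)
        fix i j :: int assume "i \<noteq> j"
        then have "1 \<le> \<bar>real_of_int i - real_of_int j\<bar>" by linarith
        then have "(1 / 2) * 1 \<le> \<theta> * \<bar>real_of_int i - real_of_int j\<bar>" using \<theta> by (intro mult_mono) auto
        then show "1 / 2 \<le> \<bar>\<theta> * real_of_int i - \<theta> * real_of_int j\<bar>"
          using \<theta> by (simp add: right_diff_distrib[symmetric] abs_mult)
      qed (use a in auto)
      then show "(\<integral>\<^sup>+k. ennreal (e l k) \<partial>count_space UNIV) \<le> ennreal K" for l
        unfolding e_def using order.trans le(2) by (simp only: abs_minus_commute[of "\<theta> * _" l]) blast
      have "(\<integral>\<^sup>+l. ennreal (exp (- (a / 2) * \<bar>\<theta> * real_of_int k - l\<bar>)) \<partial>count_space \<Lambda>) \<le> ennreal (sep_const (a / 2) d0)" for k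
        by (rule separated_exp_sum) (use a sep in auto)
      then show "(\<integral>\<^sup>+l. ennreal (e l k) \<partial>count_space \<Lambda>) \<le> ennreal K" for k
        unfolding e_def using le(1) order.trans by blast
    qed (auto simp: e_def)
    also have "\<dots> = ennreal (D\<^sup>2 * (K * K)) * coeff_norm c"
      using K by (simp add: coeff_norm_def ennreal_mult mult.assoc)
    finally have "ennreal A * coeff_norm c \<le> ennreal (D\<^sup>2 * (K * K)) * coeff_norm c"
      using samp[OF fin] by (rule order.trans[rotated])
    moreover have "ennreal (D\<^sup>2 * (K * K)) * coeff_norm c < ennreal A * coeff_norm c"
    proof -
      have X: "coeff_norm c = ennreal (\<Sum>k | c k \<noteq> 0. (cmod (c k))\<^sup>2)"
        unfolding coeff_norm_def by (subst nn_integral_count_space'[OF fin]) auto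
      obtain k where k: "c k \<noteq> 0" using c(2) by blast
      have "(\<Sum>k | c k \<noteq> 0. (cmod (c k))\<^sup>2) > 0"
        by (rule sum_pos2[OF fin, of k]) (use k in auto)
      moreover have "D\<^sup>2 * (K * K) < A" using r(2) unfolding D_def .
      ultimately show ?thesis unfolding X using K D \<open>A > 0\<close>
        by (simp add: ennreal_mult[symmetric] ennreal_less_iff)
    qed
    ultimately show False by simp
  qed
  then show ?thesis using r(1) by blast
qed

theorem dense_if_sampling:
  fixes \<Lambda> :: "real set"
  assumes sep: "d0 > 0" "\<And>x y. x \<in> \<Lambda> \<Longrightarrow> y \<in> \<Lambda> \<Longrightarrow> x \<noteq> y \<Longrightarrow> d0 \<le> \<bar>x - y\<bar>"
    and G: "exp_decay a C G" and "A > 0"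
    and samp: "\<And>t c. finite {k. c k \<noteq> 0} \<Longrightarrow> ennreal A * coeff_norm c \<le> sample_norm \<Lambda> G t c"
  shows "lower_beurling_density \<Lambda> > 1"
proof -
  obtain \<theta> A' where \<theta>: "1 / 2 \<le> \<theta>" "\<theta> < 1" and A': "A' > 0"
    and def: "\<And>c. finite {k. c k \<noteq> 0} \<Longrightarrow> ennreal A' * coeff_norm c \<le> deformed_norm \<Lambda> G \<theta> c"
    using deformed_sampling[OF sep G \<open>A > 0\<close> samp] by blast
  obtain r where r: "r > 0" "\<And>R x. R > r \<Longrightarrow> 2 * (R - r) / \<theta> - 1 \<le> real (card (\<Lambda> \<inter> {x - R..x + R}))"
    using deformed_sampling_many_points[OF sep G A' \<theta> def] by blast
  \<comment> \<open>The midpoint of 1 and \<open>1 / \<theta>\<close>. For large \<open>R\<close>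
    the loss of \<open>r\<close> at the ends and the rounding loss no longer matter.\<close>
  define q where "q = (1 + 1 / \<theta>) / 2"
  have q: "1 < q" "q < inverse \<theta>" using \<theta> by (auto simp: q_def field_simps)
  have "((\<lambda>R. (2 * (R - r) / \<theta> - 1) / (2 * R)) \<longlongrightarrow> inverse \<theta>) at_top"
    using \<theta> by (real_asymp simp: inverse_eq_divide)
  then have "eventually (\<lambda>R. q < (2 * (R - r) / \<theta> - 1) / (2 * R)) at_top"
    using q(2) by (rule order_tendstoD(1))
  then have "eventually (\<lambda>R. ennreal q \<le> (INF x::real. emeasure (count_space UNIV) (\<Lambda> \<inter> {x - R..x + R}) / ennreal (2 * R))) at_top"
    using eventually_gt_at_top[of r]
  proof eventually_elim
    case (elim R)
    show ?case
    proof (rule INF_greatest)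
      fix x :: real
      have "finite (\<Lambda> \<inter> {x - R..x + R})" by (rule separated_finite_Icc[OF sep])
      then have "emeasure (count_space UNIV) (\<Lambda> \<inter> {x - R..x + R}) / ennreal (2 * R) = ennreal (real (card (\<Lambda> \<inter> {x - R..x + R})) / (2 * R))"
        using elim r(1) by (simp add: divide_ennreal ennreal_of_nat_eq_real_of_nat)
      moreover have "q \<le> real (card (\<Lambda> \<inter> {x - R..x + R})) / (2 * R)"
        using elim(1) divide_right_mono[OF r(2)[OF elim(2)], of "2 * R" x] elim(2) r(1) by linarith
      ultimately show "ennreal q \<le> emeasure (count_space UNIV) (\<Lambda> \<inter> {x - R..x + R}) / ennreal (2 * R)"
        by (simp add: ennreal_leI)
    qed
  qed
  then have "ennreal q \<le> lower_beurling_density \<Lambda>"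
    unfolding lower_beurling_density_def by (rule Liminf_bounded)
  moreover have "1 < ennreal q" using q(1) by simp
  ultimately show ?thesis by (rule less_le_trans[rotated])
qed

section \<open>Parseval's identity on the circle\<close>

text \<open>Lebesgue measure on \<open>[0, 1)\<close> as a density on the whole line: functions
  remain defined on the reals, and the integer translates of the half-open interval form a
  partition.\<close>

definition unit_measure :: "real measure" where
  "unit_measure = density lborel (indicator {0..<1})"

lemma unit_measure_sets [simp, measurable_cong]: "sets unit_measure = sets borel"
  by (simp add: unit_measure_def)

lemma unit_measure_space [simp]: "space unit_measure = UNIV"
  by (simp add: unit_measure_def)

lemma nn_integral_unit: "f \<in> borel_measurable borel \<Longrightarrow> (\<integral>\<^sup>+t. f t \<partial>unit_measure) = (\<integral>\<^sup>+t. f t * indicator {0..<1} t \<partial>lborel)"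
  by (simp add: unit_measure_def nn_integral_density mult.commute)

lemma AE_unit: "(\<And>t. 0 \<le> t \<Longrightarrow> t < 1 \<Longrightarrow> P t) \<Longrightarrow> AE t in unit_measure. P t"
  unfolding unit_measure_def by (subst AE_density) (auto simp: indicator_def)

interpretation unit_measure: prob_space unit_measure
proof
  have "(\<integral>\<^sup>+(t::real). 1 * indicator {0..<1} t \<partial>lborel) = 1"
    by (simp add: nn_integral_indicator)
  then show "emeasure unit_measure (space unit_measure) = 1"
    using nn_integral_unit[of "\<lambda>_. 1"] by (simp only: nn_integral_const) simp
qed

lemma unit_measure_UNIV [simp]: "emeasure unit_measure UNIV = 1" "measure unit_measure UNIV = 1"
  using unit_measure.emeasure_space_1 unit_measure.prob_space by simp_all

lemma borel_measurable_unit [simp]: "borel_measurable unit_measure = borel_measurable borel"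
  by (rule measurable_cong_sets) simp_all

definition circ :: "int \<Rightarrow> real \<Rightarrow> complex" where
  "circ k t = exp (2 * of_real pi * \<i> * of_int k * of_real t)"

lemma circ_measurable [measurable]: "circ k \<in> borel_measurable borel"
  unfolding circ_def[abs_def] by (intro borel_measurable_continuous_onI continuous_intros)

lemma norm_circ [simp]: "cmod (circ k t) = 1"
  by (simp add: circ_def norm_exp_eq_Re)

lemma circ_mult: "circ k t * circ m t = circ (k + m) t"
  by (simp add: circ_def exp_add[symmetric] algebra_simps)

lemma circ_cnj: "cnj (circ k t) = circ (- k) t"
  by (simp add: circ_def exp_cnj)

lemma circ_0 [simp]: "circ 0 t = 1"
  by (simp add: circ_def)

lemma integral_circ: "(LINT t|unit_measure. circ k t) = (if k = 0 then 1 else 0)"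
proof (cases "k = 0")
  case True
  then show ?thesis by simp
next
  case False
  define w where "w = 2 * of_real pi * \<i> * of_int k"
  have w: "w \<noteq> 0" using False by (simp add: w_def)
  have "(LINT t|unit_measure. circ k t) = (LINT t|lborel. indicator {0..<1} t *\<^sub>R circ k t)"
    unfolding unit_measure_def ennreal_indicator[symmetric]
    by (rule integral_density) auto
  also have "\<dots> = (LINT t|lborel. indicator {0..1} t *\<^sub>R circ k t)"
  proof (rule integral_cong_AE)
    have "AE t in lborel. t \<noteq> (1 :: real)" by (rule AE_lborel_singleton)
    then show "AE t in lborel. indicator {0..<1} t *\<^sub>R circ k t = indicator {0..1} t *\<^sub>R circ k t"
      by eventually_elim (auto simp: indicator_def)
  qed measurable
  also have "\<dots> = exp (w * of_real 1) / w - exp (w * of_real 0) / w"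
  proof (rule integral_FTC_Icc)
    fix x :: real
    have "((\<lambda>t. exp (w * of_real t) / w) has_vector_derivative (exp (w * of_real x) * (w * 1)) / w) (at x within {0..1})"
      by (rule has_vector_derivative_real_field) (auto intro!: derivative_eq_intros simp: w)
    then show "((\<lambda>t. exp (w * of_real t) / w) has_vector_derivative circ k x) (at x within {0..1})"
      using w by (simp add: circ_def w_def)
    show "continuous_on {0..1} (circ k)"
      unfolding circ_def[abs_def] by (intro continuous_intros)
  qed simp
  also have "exp (w * of_real 1) = 1"
    using exp_integer_2pi[of "of_int k"] by (simp add: w_def mult_ac)
  finally show ?thesis using False by simp
qed

definition L2u :: "(real \<Rightarrow> complex) \<Rightarrow> bool" where
  "L2u h \<longleftrightarrow> h \<in> borel_measurable borel \<and> (\<integral>\<^sup>+t. ennreal ((cmod (h t))\<^sup>2) \<partial>unit_measure) < \<infinity>"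

lemma L2u_integrable_sq: "L2u h \<Longrightarrow> integrable unit_measure (\<lambda>t. (cmod (h t))\<^sup>2)"
  unfolding L2u_def by (intro integrableI_bounded) auto

lemma L2u_integrable: 
  assumes "L2u h"
  shows "integrable unit_measure h"
proof (rule Bochner_Integration.integrable_bound)
  show "integrable unit_measure (\<lambda>t. 1 + (cmod (h t))\<^sup>2)"
    using L2u_integrable_sq[OF assms] by simp
  show "h \<in> borel_measurable unit_measure" using assms by (simp add: L2u_def)
  have "x \<le> 1 + x\<^sup>2" for x :: real
    using sum_squares_bound[of x 1] zero_le_power2[of x] by (simp only: one_power2 mult_1_right)
  then show "AE t in unit_measure. norm (h t) \<le> norm (1 + (cmod (h t))\<^sup>2)" by simp
qed

lemma cmod_diff_sq_le: "(cmod (x - y))\<^sup>2 \<le> 2 * (cmod x)\<^sup>2 + 2 * (cmod y)\<^sup>2"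
proof -
  have "(cmod (x - y))\<^sup>2 \<le> (cmod x + cmod y)\<^sup>2" by (intro power_mono norm_triangle_ineq4) simp
  also have "\<dots> \<le> 2 * (cmod x)\<^sup>2 + 2 * (cmod y)\<^sup>2"
    using sum_squares_bound[of "cmod x" "cmod y"] by (simp add: power2_sum)
  finally show ?thesis .
qed

lemma nn_diff_sq_le:
  assumes [measurable]: "f \<in> borel_measurable M" "g \<in> borel_measurable M"
  shows "(\<integral>\<^sup>+t. ennreal ((cmod (f t - g t))\<^sup>2) \<partial>M) \<le> 2 * (\<integral>\<^sup>+t. ennreal ((cmod (f t))\<^sup>2) \<partial>M) + 2 * (\<integral>\<^sup>+t. ennreal ((cmod (g t))\<^sup>2) \<partial>M)"
proof -
  have "(\<integral>\<^sup>+t. ennreal ((cmod (f t - g t))\<^sup>2) \<partial>M) \<le> (\<integral>\<^sup>+t. 2 * ennreal ((cmod (f t))\<^sup>2) + 2 * ennreal ((cmod (g t))\<^sup>2) \<partial>M)"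
  proof (rule nn_integral_mono)
    fix t
    have "ennreal ((cmod (f t - g t))\<^sup>2) \<le> ennreal (2 * (cmod (f t))\<^sup>2 + 2 * (cmod (g t))\<^sup>2)"
      by (intro ennreal_leI cmod_diff_sq_le)
    then show "ennreal ((cmod (f t - g t))\<^sup>2) \<le> 2 * ennreal ((cmod (f t))\<^sup>2) + 2 * ennreal ((cmod (g t))\<^sup>2)"
      by (simp add: ennreal_mult)
  qed
  also have "\<dots> = 2 * (\<integral>\<^sup>+t. ennreal ((cmod (f t))\<^sup>2) \<partial>M) + 2 * (\<integral>\<^sup>+t. ennreal ((cmod (g t))\<^sup>2) \<partial>M)"
    by (simp add: nn_integral_add nn_integral_cmult)
  finally show ?thesis .
qed

lemma L2u_diff:
  assumes "L2u f" "L2u g"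
  shows "L2u (\<lambda>t. f t - g t)"
proof -
  have [measurable]: "f \<in> borel_measurable borel" "g \<in> borel_measurable borel"
    using assms by (auto simp: L2u_def)
  have "(\<integral>\<^sup>+t. ennreal ((cmod (f t - g t))\<^sup>2) \<partial>unit_measure)
      \<le> 2 * (\<integral>\<^sup>+t. ennreal ((cmod (f t))\<^sup>2) \<partial>unit_measure) + 2 * (\<integral>\<^sup>+t. ennreal ((cmod (g t))\<^sup>2) \<partial>unit_measure)"
    by (rule nn_diff_sq_le) auto
  also have "\<dots> < \<infinity>"
    using assms by (simp add: L2u_def ennreal_mult_less_top)
  finally show ?thesis by (simp add: L2u_def)
qed

lemma L2u_circ: "L2u (\<lambda>t. c * circ k t)"
  unfolding L2u_def by (auto simp: norm_mult)

definition fcoeff :: "(real \<Rightarrow> complex) \<Rightarrow> int \<Rightarrow> complex" where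
  "fcoeff h k = (LINT t|unit_measure. h t * cnj (circ k t))"

lemma integrable_mult_circ:
  assumes "integrable unit_measure h"
  shows "integrable unit_measure (\<lambda>t. h t * circ k t)"
  using assms by (rule Bochner_Integration.integrable_bound) (use assms in \<open>auto simp: norm_mult\<close>)

lemma fcoeff_diff_circ:
  assumes "L2u h"
  shows "fcoeff (\<lambda>t. h t - c * circ k t) m = fcoeff h m - (if m = k then c else 0)"
proof -
  have "(LINT t|unit_measure. (h t - c * circ k t) * cnj (circ m t)) =
        (LINT t|unit_measure. h t * circ (- m) t - c * circ (k - m) t)"
    by (intro Bochner_Integration.integral_cong) (auto simp: circ_cnj left_diff_distrib mult.assoc circ_mult)
  also have "\<dots> = (LINT t|unit_measure. h t * circ (- m) t) - (LINT t|unit_measure. c * circ (k - m) t)"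
    using L2u_integrable[OF assms] L2u_integrable[OF L2u_circ]
    by (intro Bochner_Integration.integral_diff integrable_mult_circ) auto
  also have "(LINT t|unit_measure. c * circ (k - m) t) = (if m = k then c else 0)"
    by (simp add: integral_circ)
  finally show ?thesis by (simp add: fcoeff_def circ_cnj)
qed

definition nsq :: "(real \<Rightarrow> complex) \<Rightarrow> real" where
  "nsq h = (LINT t|unit_measure. (cmod (h t))\<^sup>2)"

lemma nsq_eq: "L2u h \<Longrightarrow> (\<integral>\<^sup>+t. ennreal ((cmod (h t))\<^sup>2) \<partial>unit_measure) = ennreal (nsq h)"
  unfolding nsq_def by (intro nn_integral_eq_integral L2u_integrable_sq) auto

lemma nsq_diff_circ:
  assumes "L2u h"
  shows "nsq (\<lambda>t. h t - c * circ k t) = nsq h + ((cmod (fcoeff h k - c))\<^sup>2 - (cmod (fcoeff h k))\<^sup>2)"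
proof -
  have int: "integrable unit_measure (\<lambda>t. cnj c * (h t * circ (- k) t))"
    using integrable_mult_circ[OF L2u_integrable[OF assms]] by simp
  define r where "r t = Re (cnj c * (h t * circ (- k) t))" for t
  have r: "integrable unit_measure r" "integral\<^sup>L unit_measure r = Re (LINT t|unit_measure. cnj c * (h t * circ (- k) t))"
    unfolding r_def[abs_def] by (rule integrable_Re[OF int], rule integral_Re[OF int])
  have "nsq (\<lambda>t. h t - c * circ k t) = (LINT t|unit_measure. (cmod (h t))\<^sup>2 - 2 * r t + (cmod c)\<^sup>2)"
    unfolding nsq_def
  proof (intro Bochner_Integration.integral_cong refl)
    fix t
    have "(cmod (h t - c * circ k t))\<^sup>2 = (cmod (h t))\<^sup>2 - 2 * Re (h t * cnj (c * circ k t)) + (cmod (c * circ k t))\<^sup>2"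
      by (simp only: cmod_power2) (simp add: power2_eq_square algebra_simps)
    also have "h t * cnj (c * circ k t) = cnj c * (h t * circ (- k) t)"
      by (simp add: circ_cnj)
    finally show "(cmod (h t - c * circ k t))\<^sup>2 = (cmod (h t))\<^sup>2 - 2 * r t + (cmod c)\<^sup>2"
      by (simp add: norm_mult r_def)
  qed
  also have "\<dots> = nsq h - 2 * Re (LINT t|unit_measure. cnj c * (h t * circ (- k) t)) + (cmod c)\<^sup>2"
    unfolding r(2)[symmetric] using r(1) L2u_integrable_sq[OF assms] by (simp add: nsq_def)
  also have "(LINT t|unit_measure. cnj c * (h t * circ (- k) t)) = cnj c * fcoeff h k"
    by (simp add: fcoeff_def circ_cnj)
  also have "nsq h - 2 * Re (cnj c * fcoeff h k) + (cmod c)\<^sup>2 = nsq h + ((cmod (fcoeff h k - c))\<^sup>2 - (cmod (fcoeff h k))\<^sup>2)"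
    by (simp only: cmod_power2) (simp add: power2_eq_square algebra_simps)
  finally show ?thesis .
qed

text \<open>One identity serves both halves of Parseval: with \<open>a = fcoeff h\<close> it yields
  Bessel's inequality, with the coefficients of an approximating trigonometric polynomial the
  reverse one. Subtracting a multiple of one character changes only its own coefficient, so the
  induction over \<open>F\<close> closes.\<close>

lemma nsq_diff_sum_circ:
  assumes "finite F" "L2u h"
  shows "L2u (\<lambda>t. h t - (\<Sum>k\<in>F. a k * circ k t)) \<and>
    nsq (\<lambda>t. h t - (\<Sum>k\<in>F. a k * circ k t)) = nsq h + (\<Sum>k\<in>F. (cmod (fcoeff h k - a k))\<^sup>2 - (cmod (fcoeff h k))\<^sup>2)"
  using assms
proof (induction F arbitrary: h rule: finite_induct)
  case (insert k F)
  let ?h = "\<lambda>t. h t - a k * circ k t"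
  have h: "L2u ?h" using insert.prems L2u_circ by (rule L2u_diff)
  have eq: "(\<lambda>t. h t - (\<Sum>k\<in>insert k F. a k * circ k t)) = (\<lambda>t. ?h t - (\<Sum>k\<in>F. a k * circ k t))"
    using insert.hyps by (simp add: algebra_simps)
  have "(\<Sum>m\<in>F. (cmod (fcoeff ?h m - a m))\<^sup>2 - (cmod (fcoeff ?h m))\<^sup>2) = (\<Sum>m\<in>F. (cmod (fcoeff h m - a m))\<^sup>2 - (cmod (fcoeff h m))\<^sup>2)"
    using insert.hyps by (intro sum.cong) (auto simp: fcoeff_diff_circ[OF insert.prems])
  then show ?case
    unfolding eq using insert.IH[OF h] nsq_diff_circ[OF insert.prems, of "a k" k] insert.hyps by simp
qed simp

lemma bessel:
  assumes "L2u h" "finite F"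
  shows "(\<Sum>k\<in>F. (cmod (fcoeff h k))\<^sup>2) \<le> nsq h"
proof -
  have "0 \<le> nsq (\<lambda>t. h t - (\<Sum>k\<in>F. fcoeff h k * circ k t))" by (simp add: nsq_def)
  also have "\<dots> = nsq h - (\<Sum>k\<in>F. (cmod (fcoeff h k))\<^sup>2)"
    using nsq_diff_sum_circ[OF assms(2,1), of "fcoeff h"] by (simp add: sum_negf)
  finally show ?thesis by simp
qed

section \<open>Density of the trigonometric polynomials in L2 of the circle\<close>

inductive trig :: "(real \<Rightarrow> complex) \<Rightarrow> bool" where
  trig_circ: "trig (\<lambda>t. c * circ k t)"
| trig_add: "trig p \<Longrightarrow> trig q \<Longrightarrow> trig (\<lambda>t. p t + q t)"

lemma trig_sum:
  assumes "trig p"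
  shows "\<exists>F a. finite F \<and> p = (\<lambda>t. \<Sum>k\<in>F. a k * circ k t)"
  using assms
proof induction
  case (trig_circ c k)
  show ?case by (intro exI[of _ "{k}"] exI[of _ "\<lambda>_. c"]) simp
next
  case (trig_add p q)
  then obtain F a F' a' where F: "finite F" "p = (\<lambda>t. \<Sum>k\<in>F. a k * circ k t)"
    "finite F'" "q = (\<lambda>t. \<Sum>k\<in>F'. a' k * circ k t)" by blast
  have "p t + q t = (\<Sum>k\<in>F \<union> F'. ((if k \<in> F then a k else 0) + (if k \<in> F' then a' k else 0)) * circ k t)" for t
  proof -
    have "(\<Sum>k\<in>F \<union> F'. ((if k \<in> F then a k else 0) + (if k \<in> F' then a' k else 0)) * circ k t)
      = (\<Sum>k\<in>F \<union> F'. (if k \<in> F then a k * circ k t else 0)) + (\<Sum>k\<in>F \<union> F'. (if k \<in> F' then a' k * circ k t else 0))"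
      unfolding sum.distrib[symmetric] by (intro sum.cong) (auto simp: distrib_right)
    also have "(\<Sum>k\<in>F \<union> F'. (if k \<in> F then a k * circ k t else 0)) = p t"
      unfolding F using F(1,3) by (intro sum.mono_neutral_cong_right) auto
    also have "(\<Sum>k\<in>F \<union> F'. (if k \<in> F' then a' k * circ k t else 0)) = q t"
      unfolding F using F(1,3) by (intro sum.mono_neutral_cong_right) auto
    finally show ?thesis by simp
  qed
  then show ?case using F(1,3)
    by (intro exI[of _ "F \<union> F'"] exI[of _ "\<lambda>k. (if k \<in> F then a k else 0) + (if k \<in> F' then a' k else 0)"] conjI ext) auto
qed

lemma trig_mult:
  assumes "trig p" "trig q"
  shows "trig (\<lambda>t. p t * q t)"
  using assms(1)
proof induction
  case (trig_circ c k)
  show ?case using assms(2)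
  proof induction
    case (trig_circ c' k')
    have "(\<lambda>t. c * circ k t * (c' * circ k' t)) = (\<lambda>t. (c * c') * circ (k + k') t)"
      by (auto simp: circ_mult[symmetric])
    then show ?case by (simp add: trig.trig_circ)
  qed (simp add: distrib_left trig.trig_add)
qed (simp add: distrib_right trig.trig_add)

lemma trig_const: "trig (\<lambda>t. c)"
  using trig_circ[of c 0] by simp

lemma L2u_trig:
  assumes "trig p"
  shows "L2u p"
proof -
  obtain F a where F: "finite F" "p = (\<lambda>t. \<Sum>k\<in>F. a k * circ k t)" using trig_sum[OF assms] by blast
  have "L2u (\<lambda>t. 0 - (\<Sum>k\<in>F. a k * circ k t))"
    by (rule nsq_diff_sum_circ[OF F(1), THEN conjunct1]) (simp add: L2u_def)
  then show ?thesis unfolding F(2) by (simp add: L2u_def)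
qed

text \<open>Real polynomials in the plane are generated by linear functionals, and on the circle
  \<open>Re z\<close> and \<open>Im z\<close> are combinations of \<open>z\<close> and
  \<open>cnj z\<close>, that is of \<open>circ 1\<close> and \<open>circ (- 1)\<close>. This
  connects the real Stone-Weierstrass theorem with trigonometric polynomials.\<close>

lemma trig_real_polynomial:
  assumes "real_polynomial_function g"
  shows "trig (\<lambda>t. of_real (g (circ 1 t)))"
  using assms
proof induction
  case (linear f)
  have fz: "f z = f 1 * Re z + f \<i> * Im z" for z
  proof -
    have "z = Re z *\<^sub>R 1 + Im z *\<^sub>R \<i>" by (simp add: complex_eq_iff)
    then have "f z = f (Re z *\<^sub>R 1 + Im z *\<^sub>R \<i>)" by (rule arg_cong)
    also have "\<dots> = Re z * f 1 + Im z * f \<i>"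
      using linear by (simp add: bounded_linear.linear linear_add linear_cmul)
    finally show ?thesis by (simp add: mult.commute)
  qed
  define A where "A = complex_of_real (f 1) / 2"
  define B where "B = complex_of_real (f \<i>) / (2 * \<i>)"
  have "complex_of_real (f (circ 1 t)) = (A + B) * circ 1 t + (A - B) * circ (- 1) t" for t
  proof -
    define z where "z = circ 1 t"
    have "complex_of_real (Re z) = (z + cnj z) / 2" "complex_of_real (Im z) = (z - cnj z) / (2 * \<i>)"
      by (auto simp: complex_eq_iff)
    then have "complex_of_real (f z) = of_real (f 1) * ((z + cnj z) / 2) + of_real (f \<i>) * ((z - cnj z) / (2 * \<i>))"
      by (simp only: fz[of z] of_real_add of_real_mult)
    also have "\<dots> = A * (z + cnj z) + B * (z - cnj z)" by (simp add: A_def B_def)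
    also have "\<dots> = (A + B) * z + (A - B) * cnj z" by (simp add: algebra_simps)
    finally show ?thesis by (simp add: z_def circ_cnj)
  qed
  then have "(\<lambda>t. complex_of_real (f (circ 1 t))) = (\<lambda>t. (A + B) * circ 1 t + (A - B) * circ (- 1) t)" by blast
  then show ?case by (simp add: trig_add trig_circ)
qed (auto intro: trig_const trig_add trig_mult)

text \<open>The L2 closure of the trigonometric polynomials. It will absorb continuous functions on
  the circle, indicators of Borel sets, simple functions, and finally every \<open>L2u\<close>
  function.\<close>

definition trig_approx :: "(real \<Rightarrow> complex) \<Rightarrow> bool" where
  "trig_approx h \<longleftrightarrow> L2u h \<and> (\<forall>\<epsilon>>0. \<exists>p. trig p \<and> (\<integral>\<^sup>+t. ennreal ((cmod (h t - p t))\<^sup>2) \<partial>unit_measure) < ennreal \<epsilon>)"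

lemma trig_approx_trig: "trig p \<Longrightarrow> trig_approx p"
  unfolding trig_approx_def using L2u_trig by (auto intro!: exI[of _ p])

lemma trig_approx_limit:
  assumes h: "L2u h" and app: "\<And>n. trig_approx (f n)"
    and lim: "(\<lambda>n. \<integral>\<^sup>+t. ennreal ((cmod (h t - f n t))\<^sup>2) \<partial>unit_measure) \<longlonglongrightarrow> 0"
  shows "trig_approx h"
  unfolding trig_approx_def
proof (intro conjI allI impI h)
  fix \<epsilon> :: real assume "\<epsilon> > 0"
  then have "eventually (\<lambda>n. (\<integral>\<^sup>+t. ennreal ((cmod (h t - f n t))\<^sup>2) \<partial>unit_measure) < ennreal (\<epsilon> / 8)) sequentially"
    by (intro order_tendstoD(2)[OF lim]) simp
  then obtain n where n: "(\<integral>\<^sup>+t. ennreal ((cmod (h t - f n t))\<^sup>2) \<partial>unit_measure) < ennreal (\<epsilon> / 8)"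
    by (auto simp: eventually_sequentially)
  have "\<epsilon> / 8 > 0" using \<open>\<epsilon> > 0\<close> by simp
  then obtain p where p: "trig p" "(\<integral>\<^sup>+t. ennreal ((cmod (f n t - p t))\<^sup>2) \<partial>unit_measure) < ennreal (\<epsilon> / 8)"
    using app[of n] unfolding trig_approx_def by blast
  have meas: "h \<in> borel_measurable borel" "f n \<in> borel_measurable borel" "p \<in> borel_measurable borel"
    using h app[of n] L2u_trig[OF p(1)] by (auto simp: trig_approx_def L2u_def)
  have "(\<integral>\<^sup>+t. ennreal ((cmod (h t - p t))\<^sup>2) \<partial>unit_measure) = (\<integral>\<^sup>+t. ennreal ((cmod ((h t - f n t) - (p t - f n t)))\<^sup>2) \<partial>unit_measure)"
    by simp
  also have "\<dots> \<le> 2 * (\<integral>\<^sup>+t. ennreal ((cmod (h t - f n t))\<^sup>2) \<partial>unit_measure) + 2 * (\<integral>\<^sup>+t. ennreal ((cmod (p t - f n t))\<^sup>2) \<partial>unit_measure)"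
    using meas by (intro nn_diff_sq_le) auto
  also have "\<dots> \<le> 2 * ennreal (\<epsilon> / 8) + 2 * ennreal (\<epsilon> / 8)"
    using n p(2) by (intro add_mono mult_left_mono) (auto simp: norm_minus_commute)
  also have "\<dots> < ennreal \<epsilon>"
  proof -
    have "2 * ennreal (\<epsilon> / 8) = ennreal (\<epsilon> / 4)"
      using \<open>\<epsilon> > 0\<close> ennreal_mult[of 2 "\<epsilon> / 8"] by simp
    then show ?thesis using \<open>\<epsilon> > 0\<close> by (simp add: ennreal_plus[symmetric] ennreal_less_iff del: ennreal_plus)
  qed
  finally show "\<exists>p. trig p \<and> (\<integral>\<^sup>+t. ennreal ((cmod (h t - p t))\<^sup>2) \<partial>unit_measure) < ennreal \<epsilon>" using p(1) by blast
qed

lemma trig_approx_scale: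
  assumes "trig_approx h"
  shows "trig_approx (\<lambda>t. c * h t)"
proof -
  have "L2u h" using assms by (simp add: trig_approx_def)
  then have h: "L2u (\<lambda>t. c * h t)"
    by (auto simp: L2u_def norm_mult power_mult_distrib ennreal_mult nn_integral_cmult ennreal_mult_less_top)
  have [measurable]: "h \<in> borel_measurable borel" using \<open>L2u h\<close> by (simp add: L2u_def)
  have "\<exists>p. trig p \<and> (\<integral>\<^sup>+t. ennreal ((cmod (c * h t - p t))\<^sup>2) \<partial>unit_measure) < ennreal \<epsilon>" if "\<epsilon> > 0" for \<epsilon>
  proof -
    have "\<epsilon> / (1 + (cmod c)\<^sup>2) > 0" using that by (simp add: add_pos_nonneg)
    then obtain p where p: "trig p" "(\<integral>\<^sup>+t. ennreal ((cmod (h t - p t))\<^sup>2) \<partial>unit_measure) < ennreal (\<epsilon> / (1 + (cmod c)\<^sup>2))"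
      using assms unfolding trig_approx_def by blast
    have [measurable]: "p \<in> borel_measurable borel" using L2u_trig[OF p(1)] by (simp add: L2u_def)
    have "(\<integral>\<^sup>+t. ennreal ((cmod (c * h t - c * p t))\<^sup>2) \<partial>unit_measure)
       = ennreal ((cmod c)\<^sup>2) * (\<integral>\<^sup>+t. ennreal ((cmod (h t - p t))\<^sup>2) \<partial>unit_measure)"
      by (subst nn_integral_cmult[symmetric]) (auto simp: right_diff_distrib[symmetric] norm_mult power_mult_distrib ennreal_mult)
    also have "\<dots> \<le> ennreal ((cmod c)\<^sup>2) * ennreal (\<epsilon> / (1 + (cmod c)\<^sup>2))"
      using p(2) by (intro mult_left_mono) auto
    also have "\<dots> = ennreal ((cmod c)\<^sup>2 * (\<epsilon> / (1 + (cmod c)\<^sup>2)))"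
      using that by (intro ennreal_mult[symmetric]) auto
    also have "\<dots> < ennreal \<epsilon>"
    proof -
      have "(cmod c)\<^sup>2 * (\<epsilon> / (1 + (cmod c)\<^sup>2)) < \<epsilon>"
        using that by (simp add: divide_less_eq add_pos_nonneg algebra_simps)
      then show ?thesis using that by (simp add: ennreal_less_iff)
    qed
    finally show ?thesis
      using trig_mult[OF trig_const[of c] p(1)] by (intro exI[of _ "\<lambda>t. c * p t"]) simp
  qed
  then show ?thesis using h by (simp add: trig_approx_def)
qed

lemma trig_approx_diff:
  assumes "trig_approx f" "trig_approx g"
  shows "trig_approx (\<lambda>t. f t - g t)"
proof -
  have fg: "L2u f" "L2u g" using assms by (auto simp: trig_approx_def)
  then have [measurable]: "f \<in> borel_measurable borel" "g \<in> borel_measurable borel"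
    by (auto simp: L2u_def)
  have "\<exists>p. trig p \<and> (\<integral>\<^sup>+t. ennreal ((cmod (f t - g t - p t))\<^sup>2) \<partial>unit_measure) < ennreal \<epsilon>" if "\<epsilon> > 0" for \<epsilon>
  proof -
    have e: "\<epsilon> / 8 > 0" using that by simp
    obtain p where p: "trig p" "(\<integral>\<^sup>+t. ennreal ((cmod (f t - p t))\<^sup>2) \<partial>unit_measure) < ennreal (\<epsilon> / 8)"
      using assms(1) e unfolding trig_approx_def by blast
    obtain q where q: "trig q" "(\<integral>\<^sup>+t. ennreal ((cmod (g t - q t))\<^sup>2) \<partial>unit_measure) < ennreal (\<epsilon> / 8)"
      using assms(2) e unfolding trig_approx_def by blast
    have [measurable]: "p \<in> borel_measurable borel" "q \<in> borel_measurable borel"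
      using L2u_trig[OF p(1)] L2u_trig[OF q(1)] by (auto simp: L2u_def)
    have "(\<integral>\<^sup>+t. ennreal ((cmod (f t - g t - (p t + - 1 * q t)))\<^sup>2) \<partial>unit_measure)
       = (\<integral>\<^sup>+t. ennreal ((cmod ((f t - p t) - (g t - q t)))\<^sup>2) \<partial>unit_measure)"
      by (simp add: algebra_simps)
    also have "\<dots> \<le> 2 * (\<integral>\<^sup>+t. ennreal ((cmod (f t - p t))\<^sup>2) \<partial>unit_measure) + 2 * (\<integral>\<^sup>+t. ennreal ((cmod (g t - q t))\<^sup>2) \<partial>unit_measure)"
      by (intro nn_diff_sq_le) auto
    also have "\<dots> \<le> 2 * ennreal (\<epsilon> / 8) + 2 * ennreal (\<epsilon> / 8)"
      using p(2) q(2) by (intro add_mono mult_left_mono) auto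
    also have "\<dots> < ennreal \<epsilon>"
    proof -
      have "2 * ennreal (\<epsilon> / 8) = ennreal (\<epsilon> / 4)"
        using \<open>\<epsilon> > 0\<close> ennreal_mult[of 2 "\<epsilon> / 8"] by simp
      then show ?thesis using \<open>\<epsilon> > 0\<close> by (simp add: ennreal_plus[symmetric] ennreal_less_iff del: ennreal_plus)
    qed
    finally show ?thesis
      using trig_add[OF p(1) trig_mult[OF trig_const[of "- 1"] q(1)]] by blast
  qed
  then show ?thesis using L2u_diff[OF fg] by (simp add: trig_approx_def)
qed

lemma trig_approx_sum:
  "finite F \<Longrightarrow> (\<And>i. i \<in> F \<Longrightarrow> trig_approx (f i)) \<Longrightarrow> trig_approx (\<lambda>t. \<Sum>i\<in>F. f i t)"
proof (induction F rule: finite_induct)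
  case empty
  then show ?case using trig_approx_trig[OF trig_const[of 0]] by simp
next
  case (insert i F)
  have "trig_approx (\<lambda>t. f i t - (- 1) * (\<Sum>i\<in>F. f i t))"
    using insert by (intro trig_approx_diff trig_approx_scale) auto
  then show ?case using insert.hyps by simp
qed

lemma trig_approx_cong:
  assumes "trig_approx f" "\<And>t. 0 \<le> t \<Longrightarrow> t < 1 \<Longrightarrow> f t = g t" "g \<in> borel_measurable borel"
  shows "trig_approx g"
proof (rule trig_approx_limit[where f = "\<lambda>_. f"])
  have ae: "AE t in unit_measure. f t = g t" by (rule AE_unit) (rule assms(2))
  have "(\<integral>\<^sup>+t. ennreal ((cmod (g t))\<^sup>2) \<partial>unit_measure) = (\<integral>\<^sup>+t. ennreal ((cmod (f t))\<^sup>2) \<partial>unit_measure)"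
    using ae by (intro nn_integral_cong_AE) auto
  then show "L2u g" using assms(1,3) by (simp add: trig_approx_def L2u_def)
  have "(\<integral>\<^sup>+t. ennreal ((cmod (g t - f t))\<^sup>2) \<partial>unit_measure) = (\<integral>\<^sup>+t. 0 \<partial>unit_measure)"
    using ae by (intro nn_integral_cong_AE) auto
  then show "(\<lambda>n::nat. \<integral>\<^sup>+t. ennreal ((cmod (g t - f t))\<^sup>2) \<partial>unit_measure) \<longlonglongrightarrow> 0" by simp
qed (rule assms(1))

lemma trig_approx_dominated:
  assumes f: "\<And>n. trig_approx (f n)" and h: "L2u h" and lim: "\<And>t. (\<lambda>n. f n t) \<longlonglongrightarrow> h t"
    and dom: "\<And>n t. cmod (f n t) \<le> w t" and w: "w \<in> borel_measurable borel" "(\<integral>\<^sup>+t. ennreal ((w t)\<^sup>2) \<partial>unit_measure) < \<infinity>"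
  shows "trig_approx h"
proof (rule trig_approx_limit[OF h f])
  have [measurable]: "f n \<in> borel_measurable borel" "h \<in> borel_measurable borel" for n
    using f h by (auto simp: trig_approx_def L2u_def)
  note [measurable] = w(1)
  have hw: "cmod (h t) \<le> w t" for t
    using tendsto_norm[OF lim[of t]] dom by (intro LIMSEQ_le_const2) auto
  have "(\<lambda>n. \<integral>\<^sup>+t. ennreal ((cmod (h t - f n t))\<^sup>2) \<partial>unit_measure) \<longlonglongrightarrow> (\<integral>\<^sup>+t. 0 \<partial>unit_measure)"
  proof (rule nn_integral_dominated_convergence[where w = "\<lambda>t. ennreal (4 * (w t)\<^sup>2)"])
    show "AE t in unit_measure. ennreal ((cmod (h t - f n t))\<^sup>2) \<le> ennreal (4 * (w t)\<^sup>2)" for n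
    proof (intro AE_I2 ennreal_leI)
      fix t
      have "cmod (h t - f n t) \<le> 2 * w t"
        using norm_triangle_ineq4[of "h t" "f n t"] hw[of t] dom[of n t] by linarith
      then have "(cmod (h t - f n t))\<^sup>2 \<le> (2 * w t)\<^sup>2" by (intro power_mono) auto
      then show "(cmod (h t - f n t))\<^sup>2 \<le> 4 * (w t)\<^sup>2" by (simp add: power_mult_distrib)
    qed
    show "(\<integral>\<^sup>+t. ennreal (4 * (w t)\<^sup>2) \<partial>unit_measure) < \<infinity>"
      using w by (simp add: ennreal_mult nn_integral_cmult ennreal_mult_less_top)
    have "(\<lambda>n. ennreal ((cmod (h t - f n t))\<^sup>2)) \<longlonglongrightarrow> ennreal ((cmod (h t - h t))\<^sup>2)" for t
      by (intro tendsto_intros lim)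
    then show "AE t in unit_measure. (\<lambda>n. ennreal ((cmod (h t - f n t))\<^sup>2)) \<longlonglongrightarrow> 0" by simp
  qed auto
  then show "(\<lambda>n. \<integral>\<^sup>+t. ennreal ((cmod (h t - f n t))\<^sup>2) \<partial>unit_measure) \<longlonglongrightarrow> 0" by simp
qed

text \<open>A function pulled back along \<open>circ 1\<close> is periodic, so Stone-Weierstrass can
  be used on the compact unit circle; uniform closeness there gives closeness in L2 because
  \<open>unit_measure\<close> has mass 1.\<close>

lemma trig_approx_continuous:
  fixes g :: "complex \<Rightarrow> real"
  assumes "continuous_on UNIV g"
  shows "trig_approx (\<lambda>t. of_real (g (circ 1 t)))"
  unfolding trig_approx_def
proof (intro conjI allI impI)
  have "compact (g ` sphere 0 1)"
    by (intro compact_continuous_image continuous_on_subset[OF assms]) auto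
  then obtain K where K: "\<And>z. cmod z = 1 \<Longrightarrow> \<bar>g z\<bar> \<le> K"
    using compact_imp_bounded by (force simp: bounded_iff)
  have [measurable]: "g \<in> borel_measurable borel" by (rule borel_measurable_continuous_onI[OF assms])
  have "(\<integral>\<^sup>+t. ennreal ((cmod (complex_of_real (g (circ 1 t))))\<^sup>2) \<partial>unit_measure) \<le> (\<integral>\<^sup>+t. ennreal (K\<^sup>2) \<partial>unit_measure)"
  proof (intro nn_integral_mono ennreal_leI)
    fix t
    show "(cmod (complex_of_real (g (circ 1 t))))\<^sup>2 \<le> K\<^sup>2" using K[of "circ 1 t"] by (intro power_mono) auto
  qed
  also have "\<dots> < \<infinity>" by simp
  finally show "L2u (\<lambda>t. of_real (g (circ 1 t)))" by (simp add: L2u_def)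
  fix \<epsilon> :: real assume "\<epsilon> > 0"
  then have "sqrt (\<epsilon> / 2) > 0" by simp
  then obtain p where p: "real_polynomial_function p" "\<And>z. z \<in> sphere 0 1 \<Longrightarrow> \<bar>g z - p z\<bar> < sqrt (\<epsilon> / 2)"
    by (rule Stone_Weierstrass_real_polynomial_function[OF compact_sphere[of "0 :: complex" 1] continuous_on_subset[OF assms subset_UNIV]])
      (rule that, assumption, blast)
  have "(\<integral>\<^sup>+t. ennreal ((cmod (of_real (g (circ 1 t)) - of_real (p (circ 1 t))))\<^sup>2) \<partial>unit_measure) \<le> (\<integral>\<^sup>+t. ennreal (\<epsilon> / 2) \<partial>unit_measure)"
  proof (intro nn_integral_mono ennreal_leI)
    fix t
    have "\<bar>g (circ 1 t) - p (circ 1 t)\<bar>\<^sup>2 \<le> (sqrt (\<epsilon> / 2))\<^sup>2"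
      using p(2)[of "circ 1 t"] by (intro power_mono) auto
    then show "(cmod (of_real (g (circ 1 t)) - of_real (p (circ 1 t))))\<^sup>2 \<le> \<epsilon> / 2"
      using \<open>\<epsilon> > 0\<close> by (simp add: of_real_diff[symmetric] del: of_real_diff)
  qed
  also have "\<dots> < ennreal \<epsilon>" using \<open>\<epsilon> > 0\<close> by (simp add: ennreal_less_iff)
  finally show "\<exists>p. trig p \<and> (\<integral>\<^sup>+t. ennreal ((cmod (of_real (g (circ 1 t)) - p t))\<^sup>2) \<partial>unit_measure) < ennreal \<epsilon>"
    using trig_real_polynomial[OF p(1)] by blast
qed

text \<open>Dynkin's argument with the closed sets as generator: their indicators are limits of
  continuous cut-offs of \<open>infdist\<close>, complements follow by linearity, and disjoint
  unions by dominated convergence.\<close>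

lemma trig_approx_indicator_circ:
  assumes "B \<in> sets borel"
  shows "trig_approx (\<lambda>t. indicator B (circ 1 t))"
proof -
  have sb: "sets borel = sigma_sets (UNIV :: complex set) (Collect closed)"
    unfolding borel_eq_closed by (rule sets_measure_of) simp
  have B: "B \<in> sigma_sets UNIV (Collect closed)" using assms by (simp only: sb)
  have "Int_stable (Collect (closed :: complex set \<Rightarrow> bool))" "Collect (closed :: complex set \<Rightarrow> bool) \<subseteq> Pow UNIV"
    by (auto simp: Int_stable_def)
  then show ?thesis
    using B
  proof (induction rule: sigma_sets_induct_disjoint)
    case (basic C)
    then have C: "closed C" by simp
    show ?case
    \<comment> \<open>\<open>infdist\<close> to the empty set is 0 by convention, so the cut-offs
      below would tend to 1 instead of 0.\<close>
    proof (cases "C = {}")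
      case True
      then show ?thesis using trig_approx_trig[OF trig_const[of 0]] by simp
    next
      case False
      define g where "g n z = max 0 (1 - real n * infdist z C)" for n and z :: complex
      have app: "trig_approx (\<lambda>t. of_real (g n (circ 1 t)))" for n
        unfolding g_def by (intro trig_approx_continuous continuous_intros)
      have lim: "(\<lambda>n. complex_of_real (g n z)) \<longlonglongrightarrow> indicator C z" for z
      proof (cases "z \<in> C")
        case True
        then show ?thesis by (simp add: g_def)
      next
        case zC: False
        then have pos: "infdist z C > 0"
          using in_closed_iff_infdist_zero[OF C False] infdist_nonneg[of z C] by (metis order_le_less)
        obtain N where N: "1 < real N * infdist z C" using reals_Archimedean3[OF pos] by blast
        have "g n z = 0" if "n \<ge> N" for n
        proof -
          have "real N * infdist z C \<le> real n * infdist z C" using that pos by (intro mult_right_mono) auto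
          then show ?thesis using N by (simp add: g_def)
        qed
        then have "eventually (\<lambda>n. complex_of_real (g n z) = indicator C z) sequentially"
          using zC by (auto simp: eventually_sequentially)
        then show ?thesis by (rule tendsto_eventually)
      qed
      have le: "cmod (complex_of_real (g n (circ 1 t))) \<le> 1" for n t
        by (simp add: g_def infdist_nonneg)
      have L2: "L2u (\<lambda>t. indicator C (circ 1 t))"
      proof -
        have "C \<in> sets borel" using C by simp
        note [measurable] = this
        have "(\<integral>\<^sup>+t. ennreal ((cmod (indicator C (circ 1 t)))\<^sup>2) \<partial>unit_measure) \<le> (\<integral>\<^sup>+t. 1 \<partial>unit_measure)"
          by (intro nn_integral_mono) (auto simp: indicator_def)
        also have "\<dots> < \<infinity>" by simp
        finally show ?thesis by (simp add: L2u_def)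
      qed
      show ?thesis
        by (rule trig_approx_dominated[OF app L2 lim le]) simp_all
    qed
  next
    case empty
    show ?case using trig_approx_trig[OF trig_const[of 0]] by simp
  next
    case (compl A)
    have "trig_approx (\<lambda>t. 1 - indicator A (circ 1 t))"
      by (intro trig_approx_diff compl trig_approx_trig trig_const)
    moreover have "A \<in> sets borel" using compl(1) by (simp only: sb)
    then have "(\<lambda>t. indicator (UNIV - A) (circ 1 t) :: complex) \<in> borel_measurable borel" by measurable
    ultimately show ?case
      by (elim trig_approx_cong) (auto simp: indicator_def)
  next
    case (union A)
    have [measurable]: "A i \<in> sets borel" for i using union(2) unfolding sb by blast
    have app: "trig_approx (\<lambda>t. \<Sum>i<n. indicator (A i) (circ 1 t))" for n
      by (intro trig_approx_sum union) simp
    have sum: "(\<Sum>i<n. indicator (A i) z) = (indicator (\<Union>i<n. A i) z :: complex)" for n z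
      by (rule indicator_UN_disjoint[symmetric, OF finite_lessThan disjoint_family_on_mono[OF subset_UNIV union(1)]])
    have lim: "(\<lambda>n. indicator (\<Union>i<n. A i) z) \<longlonglongrightarrow> (indicator (\<Union>i. A i) z :: complex)" for z
      by (rule LIMSEQ_indicator_UN)
    have L2: "L2u (\<lambda>t. indicator (\<Union>i. A i) (circ 1 t))"
    proof -
      have "(\<Union>i. A i) \<in> sets borel" by (rule sets.countable_UN) auto
      then have meas: "(\<lambda>t. indicator (\<Union>i. A i) (circ 1 t) :: complex) \<in> borel_measurable borel" by measurable
      have "(\<integral>\<^sup>+t. ennreal ((cmod (indicator (\<Union>i. A i) (circ 1 t)))\<^sup>2) \<partial>unit_measure) \<le> (\<integral>\<^sup>+t. 1 \<partial>unit_measure)"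
        by (intro nn_integral_mono) (auto simp: indicator_def)
      also have "\<dots> < \<infinity>" by simp
      finally show ?thesis using meas by (simp add: L2u_def)
    qed
    have lim': "(\<lambda>n. \<Sum>i<n. indicator (A i) (circ 1 t)) \<longlonglongrightarrow> (indicator (\<Union>i. A i) (circ 1 t) :: complex)" for t
      using lim[of "circ 1 t"] by (simp only: sum)
    have le: "cmod (\<Sum>i<n. indicator (A i) (circ 1 t)) \<le> 1" for n t
      by (simp only: sum) (simp add: indicator_def)
    show ?case
      by (rule trig_approx_dominated[OF app L2 lim' le]) simp_all
  qed
qed

text \<open>\<open>Arg2pi\<close> is continuous off the nonnegative real axis and zero on it, so it
  equals its own cut-off to an open set.\<close>

lemma Arg2pi_measurable: "Arg2pi \<in> borel_measurable borel"
proof -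
  have "open (- \<real>\<^sub>\<ge>\<^sub>0 :: complex set)" by (simp add: open_Compl)
  then have "(\<lambda>z. indicator (- \<real>\<^sub>\<ge>\<^sub>0) z *\<^sub>R Arg2pi z) \<in> borel_measurable borel"
    by (intro borel_measurable_continuous_on_indicator continuous_at_imp_continuous_on ballI continuous_at_Arg2pi) auto
  moreover have "(\<lambda>z. indicator (- \<real>\<^sub>\<ge>\<^sub>0) z *\<^sub>R Arg2pi z) = Arg2pi"
    by (auto simp: indicator_def fun_eq_iff Arg2pi_eq_0 complex_nonneg_Reals_iff complex_is_Real_iff)
  ultimately show ?thesis by simp
qed

lemma Arg2pi_circ: "0 \<le> t \<Longrightarrow> t < 1 \<Longrightarrow> Arg2pi (circ 1 t) / (2 * pi) = t"
proof -
  assume t: "0 \<le> t" "t < 1"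
  have "Arg2pi (circ 1 t) = 2 * pi * t"
    by (rule Arg2pi_unique[of 1]) (use t in \<open>auto simp: circ_def mult_ac\<close>)
  then show ?thesis by simp
qed

lemma trig_approx_L2u:
  assumes "L2u h"
  shows "trig_approx h"
proof -
  have h: "h \<in> borel_measurable borel" using assms by (simp add: L2u_def)
  obtain F where F: "\<And>i. simple_function borel (F i)" "\<And>x. (\<lambda>i. F i x) \<longlonglongrightarrow> h x" "\<And>i x. dist (F i x) 0 \<le> 2 * dist (h x) 0"
    using borel_measurable_implies_sequence_metric[OF h, of 0] by auto
  show ?thesis
  proof (rule trig_approx_dominated[where f = F and w = "\<lambda>t. 2 * cmod (h t)"])
    show "cmod (F n t) \<le> 2 * cmod (h t)" for n t using F(3) by simp
    show "(\<lambda>t. 2 * cmod (h t)) \<in> borel_measurable borel" using h by measurable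
    show "(\<integral>\<^sup>+t. ennreal ((2 * cmod (h t))\<^sup>2) \<partial>unit_measure) < \<infinity>"
      using assms h by (simp add: L2u_def power_mult_distrib ennreal_mult nn_integral_cmult ennreal_mult_less_top)
    fix n
    have fin: "finite (range (F n))" using F(1)[of n] by (simp add: simple_function_def)
    have meas: "F n -` {y} \<in> sets borel" for y
    proof (cases "y \<in> range (F n)")
      case True
      then show ?thesis using F(1)[of n] by (auto simp: simple_function_def)
    next
      case False
      then have "F n -` {y} = {}" by auto
      then show ?thesis by simp
    qed
    have "trig_approx (\<lambda>t. \<Sum>y\<in>range (F n). y * indicator (F n -` {y}) t)"
    proof (intro trig_approx_sum fin trig_approx_scale)
      fix y
      \<comment> \<open>On \<open>[0, 1)\<close> the parameter is recovered as
        \<open>Arg2pi (circ 1 t) / (2 * pi)\<close>; there the level set is the preimage under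
        \<open>circ 1\<close> of a Borel set of the plane.\<close>
      define B where "B = (\<lambda>z. Arg2pi z / (2 * pi)) -` (F n -` {y})"
      have "(\<lambda>z. Arg2pi z / (2 * pi)) \<in> borel_measurable borel" using Arg2pi_measurable by measurable
      then have "B \<in> sets borel" using meas[of y] unfolding B_def by (auto dest: measurable_sets)
      then have "trig_approx (\<lambda>t. indicator B (circ 1 t))" by (rule trig_approx_indicator_circ)
      then show "trig_approx (indicator (F n -` {y}))"
        by (rule trig_approx_cong) (use meas[of y] in \<open>auto simp: B_def indicator_def Arg2pi_circ\<close>)
    qed
    moreover have "(\<Sum>y\<in>range (F n). y * indicator (F n -` {y}) t) = F n t" for t
    proof -
      have "(\<Sum>y\<in>range (F n). y * indicator (F n -` {y}) t) = (\<Sum>y\<in>range (F n). if y = F n t then F n t else 0)"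
        by (intro sum.cong) (auto simp: indicator_def)
      then show ?thesis using fin by simp
    qed
    ultimately show "trig_approx (F n)" by (simp only:)
  qed (rule assms F(2))+
qed

text \<open>Bessel's inequality on \<open>{- n..n}\<close> gives one direction. For the other, a
  trigonometric polynomial close to \<open>h\<close> is inserted into
  \<open>nsq_diff_sum_circ\<close> and the squares of \<open>cmod (fcoeff h k - a k)\<close> are
  dropped.\<close>

theorem parseval:
  assumes "L2u h"
  shows "(\<integral>\<^sup>+k. ennreal ((cmod (fcoeff h k))\<^sup>2) \<partial>count_space UNIV) = (\<integral>\<^sup>+t. ennreal ((cmod (h t))\<^sup>2) \<partial>unit_measure)"
proof (rule antisym)
  let ?S = "\<integral>\<^sup>+k. ennreal ((cmod (fcoeff h k))\<^sup>2) \<partial>count_space UNIV"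
  have part: "(\<Sum>k\<in>F. ennreal ((cmod (fcoeff h k))\<^sup>2)) \<le> ?S" if "finite F" for F
  proof -
    have "(\<Sum>k\<in>F. ennreal ((cmod (fcoeff h k))\<^sup>2)) = (\<integral>\<^sup>+k. ennreal ((cmod (fcoeff h k))\<^sup>2) * indicator F k \<partial>count_space UNIV)"
      using that by (subst nn_integral_count_space'[of F]) auto
    also have "\<dots> \<le> ?S" by (intro nn_integral_mono) (auto simp: indicator_def)
    finally show ?thesis .
  qed
  show "?S \<le> (\<integral>\<^sup>+t. ennreal ((cmod (h t))\<^sup>2) \<partial>unit_measure)"
    unfolding nsq_eq[OF assms]
  proof -
    have "?S = (\<integral>\<^sup>+k. (SUP n::nat. ennreal ((cmod (fcoeff h k))\<^sup>2) * indicator {- int n..int n} k) \<partial>count_space UNIV)"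
    proof (rule nn_integral_cong)
      fix k :: int
      have "ennreal ((cmod (fcoeff h k))\<^sup>2) \<le> ennreal ((cmod (fcoeff h k))\<^sup>2) * indicator {- int (nat \<bar>k\<bar>)..int (nat \<bar>k\<bar>)} k"
        by (auto simp: indicator_def)
      then have "ennreal ((cmod (fcoeff h k))\<^sup>2) \<le> (SUP n::nat. ennreal ((cmod (fcoeff h k))\<^sup>2) * indicator {- int n..int n} k)"
        by (rule order.trans) (rule SUP_upper, simp)
      moreover have "(SUP n::nat. ennreal ((cmod (fcoeff h k))\<^sup>2) * indicator {- int n..int n} k) \<le> ennreal ((cmod (fcoeff h k))\<^sup>2)"
        by (intro SUP_least) (auto simp: indicator_def)
      ultimately show "ennreal ((cmod (fcoeff h k))\<^sup>2) = (SUP n::nat. ennreal ((cmod (fcoeff h k))\<^sup>2) * indicator {- int n..int n} k)"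
        by (rule antisym)
    qed
    also have "\<dots> = (SUP n::nat. \<integral>\<^sup>+k. ennreal ((cmod (fcoeff h k))\<^sup>2) * indicator {- int n..int n} k \<partial>count_space UNIV)"
      by (rule nn_integral_monotone_convergence_SUP) (auto simp: incseq_def le_fun_def indicator_def)
    also have "\<dots> \<le> ennreal (nsq h)"
    proof (rule SUP_least)
      fix n :: nat
      have "(\<integral>\<^sup>+k. ennreal ((cmod (fcoeff h k))\<^sup>2) * indicator {- int n..int n} k \<partial>count_space UNIV)
          = (\<Sum>k\<in>{- int n..int n}. ennreal ((cmod (fcoeff h k))\<^sup>2))"
        by (subst nn_integral_count_space'[of "{- int n..int n}"]) auto
      also have "\<dots> = ennreal (\<Sum>k\<in>{- int n..int n}. (cmod (fcoeff h k))\<^sup>2)"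
        by (rule sum_ennreal) simp
      also have "\<dots> \<le> ennreal (nsq h)" by (intro ennreal_leI bessel[OF assms]) simp
      finally show "(\<integral>\<^sup>+k. ennreal ((cmod (fcoeff h k))\<^sup>2) * indicator {- int n..int n} k \<partial>count_space UNIV) \<le> ennreal (nsq h)" .
    qed
    finally show "?S \<le> ennreal (nsq h)" .
  qed
  show "(\<integral>\<^sup>+t. ennreal ((cmod (h t))\<^sup>2) \<partial>unit_measure) \<le> ?S"
  proof (rule ennreal_le_epsilon)
    fix \<epsilon> :: real assume "\<epsilon> > 0"
    then obtain p where p: "trig p" "(\<integral>\<^sup>+t. ennreal ((cmod (h t - p t))\<^sup>2) \<partial>unit_measure) < ennreal \<epsilon>"
      using trig_approx_L2u[OF assms] unfolding trig_approx_def by blast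
    obtain F a where F: "finite F" "p = (\<lambda>t. \<Sum>k\<in>F. a k * circ k t)" using trig_sum[OF p(1)] by blast
    have "nsq (\<lambda>t. h t - p t) = nsq h + (\<Sum>k\<in>F. (cmod (fcoeff h k - a k))\<^sup>2 - (cmod (fcoeff h k))\<^sup>2)"
      unfolding F(2) using nsq_diff_sum_circ[OF F(1) assms] by blast
    then have "nsq h \<le> nsq (\<lambda>t. h t - p t) + (\<Sum>k\<in>F. (cmod (fcoeff h k))\<^sup>2)"
      by (simp add: sum_subtractf sum_nonneg)
    also have "nsq (\<lambda>t. h t - p t) \<le> \<epsilon>"
      using p(2) nsq_eq[OF L2u_diff[OF assms L2u_trig[OF p(1)]]] \<open>\<epsilon> > 0\<close> by (simp add: ennreal_less_iff nsq_def)
    finally have "ennreal (nsq h) \<le> ennreal (\<epsilon> + (\<Sum>k\<in>F. (cmod (fcoeff h k))\<^sup>2))"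
      by (intro ennreal_leI) simp
    also have "\<dots> = ennreal \<epsilon> + (\<Sum>k\<in>F. ennreal ((cmod (fcoeff h k))\<^sup>2))"
      using \<open>\<epsilon> > 0\<close> by (simp add: ennreal_plus sum_nonneg)
    also have "\<dots> \<le> ennreal \<epsilon> + ?S" by (intro add_left_mono part F(1))
    finally show "(\<integral>\<^sup>+t. ennreal ((cmod (h t))\<^sup>2) \<partial>unit_measure) \<le> ?S + ennreal \<epsilon>"
      by (simp add: nsq_eq[OF assms] add.commute)
  qed
qed

section \<open>Periodization of the Gabor coefficients\<close>

lemma nn_integral_periodize:
  assumes [measurable]: "f \<in> borel_measurable borel"
  shows "(\<integral>\<^sup>+x. f x \<partial>lborel) = (\<integral>\<^sup>+t. (\<integral>\<^sup>+j. f (t + real_of_int j) \<partial>count_space UNIV) \<partial>unit_measure)"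
proof -
  have pt: "f x = (\<integral>\<^sup>+j. f x * indicator {real_of_int j..<real_of_int j + 1} x \<partial>count_space UNIV)" for x
  proof -
    have "x \<in> {real_of_int j..<real_of_int j + 1} \<longleftrightarrow> j = \<lfloor>x\<rfloor>" for j
      using floor_eq_iff[of x j] by auto
    then have "(\<integral>\<^sup>+j. f x * indicator {real_of_int j..<real_of_int j + 1} x \<partial>count_space UNIV)
      = (\<Sum>j\<in>{\<lfloor>x\<rfloor>}. f x * indicator {real_of_int j..<real_of_int j + 1} x)"
      by (intro nn_integral_count_space') (auto simp: indicator_def)
    also have "\<dots> = f x" by (simp add: indicator_def)
    finally show ?thesis by simp
  qed
  have "(\<integral>\<^sup>+x. f x \<partial>lborel) = (\<integral>\<^sup>+x. (\<integral>\<^sup>+j. f x * indicator {real_of_int j..<real_of_int j + 1} x \<partial>count_space UNIV) \<partial>lborel)"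
    by (intro nn_integral_cong pt)
  also have "\<dots> = (\<integral>\<^sup>+j. (\<integral>\<^sup>+x. f x * indicator {real_of_int j..<real_of_int j + 1} x \<partial>lborel) \<partial>count_space UNIV)"
    by (rule nn_integral_count_space_nn_integral) auto
  also have "\<dots> = (\<integral>\<^sup>+j. (\<integral>\<^sup>+t. f (t + real_of_int j) \<partial>unit_measure) \<partial>count_space UNIV)"
  proof (rule nn_integral_cong)
    fix j :: int
    have "(\<integral>\<^sup>+x. f x * indicator {real_of_int j..<real_of_int j + 1} x \<partial>lborel)
       = (\<integral>\<^sup>+t. f (real_of_int j + 1 * t) * indicator {real_of_int j..<real_of_int j + 1} (real_of_int j + 1 * t) \<partial>lborel)"
      by (subst nn_integral_real_affine[where c = 1 and t = "real_of_int j"]) auto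
    also have "\<dots> = (\<integral>\<^sup>+t. f (t + real_of_int j) * indicator {0..<1} t \<partial>lborel)"
      by (intro nn_integral_cong) (auto simp: indicator_def add.commute)
    also have "\<dots> = (\<integral>\<^sup>+t. f (t + real_of_int j) \<partial>unit_measure)"
      by (subst nn_integral_unit) auto
    finally show "(\<integral>\<^sup>+x. f x * indicator {real_of_int j..<real_of_int j + 1} x \<partial>lborel) = (\<integral>\<^sup>+t. f (t + real_of_int j) \<partial>unit_measure)" .
  qed
  also have "\<dots> = (\<integral>\<^sup>+t. (\<integral>\<^sup>+j. f (t + real_of_int j) \<partial>count_space UNIV) \<partial>unit_measure)"
    by (rule nn_integral_count_space_nn_integral[symmetric]) auto
  finally show ?thesis .
qed

interpretation count_int: sigma_finite_measure "count_space (UNIV :: int set)"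
  by (rule sigma_finite_measure_count_space)

interpretation unit_int: pair_sigma_finite unit_measure "count_space (UNIV :: int set)" ..

lemma measurable_add_int [measurable]: "(\<lambda>p. fst p + real_of_int (snd p)) \<in> borel_measurable (unit_measure \<Otimes>\<^sub>M count_space UNIV)"
proof -
  have "real_of_int \<in> borel_measurable (count_space UNIV)" by simp
  then have "(\<lambda>p. real_of_int (snd p)) \<in> borel_measurable (unit_measure \<Otimes>\<^sub>M count_space UNIV)"
    by (rule measurable_compose[OF measurable_snd])
  moreover have "fst \<in> borel_measurable (unit_measure \<Otimes>\<^sub>M count_space (UNIV :: int set))"
    by (subst measurable_cong_sets[OF refl unit_measure_sets[symmetric]]) (rule measurable_fst)
  ultimately show ?thesis by measurable
qed

text \<open>Presents the line as the image of \<open>[0, 1) \<times> \<int>\<close> under addition,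
  so that periodization of Bochner integrals becomes a change of variables followed by
  Fubini.\<close>

lemma lborel_eq_distr:
  "lborel = distr (unit_measure \<Otimes>\<^sub>M count_space (UNIV :: int set)) borel (\<lambda>p. fst p + real_of_int (snd p))" (is "_ = ?D")
proof (rule measure_eqI)
  fix A :: "real set" assume "A \<in> sets lborel"
  then have [measurable]: "A \<in> sets borel" by simp
  have "emeasure ?D A = (\<integral>\<^sup>+x. indicator A x \<partial>?D)" by simp
  also have "\<dots> = (\<integral>\<^sup>+p. indicator A (fst p + real_of_int (snd p)) \<partial>(unit_measure \<Otimes>\<^sub>M count_space UNIV))"
    by (rule nn_integral_distr) auto
  also have "\<dots> = (\<integral>\<^sup>+t. (\<integral>\<^sup>+j. indicator A (fst (t, j) + real_of_int (snd (t, j))) \<partial>count_space UNIV) \<partial>unit_measure)"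
    by (rule count_int.nn_integral_fst[symmetric]) measurable
  also have "\<dots> = (\<integral>\<^sup>+x. indicator A x \<partial>lborel)"
    by (subst nn_integral_periodize) auto
  also have "\<dots> = emeasure lborel A" by (rule nn_integral_indicator) simp
  finally show "emeasure lborel A = emeasure ?D A" by simp
qed simp

lemma integral_periodize:
  fixes f :: "real \<Rightarrow> 'b::{banach, second_countable_topology}"
  assumes "integrable lborel f"
  shows "integral\<^sup>L lborel f = (LINT t|unit_measure. LINT j|count_space UNIV. f (t + real_of_int j))"
proof -
  have [measurable]: "f \<in> borel_measurable borel" using assms by auto
  have "integrable (unit_measure \<Otimes>\<^sub>M count_space (UNIV :: int set)) (\<lambda>p. f (fst p + real_of_int (snd p)))"
    using assms by (subst (asm) lborel_eq_distr) (subst (asm) integrable_distr_eq, auto)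
  from unit_int.integral_fst'[OF this]
  have "(LINT t|unit_measure. LINT j|count_space UNIV. f (t + real_of_int j)) = (LINT p|(unit_measure \<Otimes>\<^sub>M count_space (UNIV :: int set)). f (fst p + real_of_int (snd p)))"
    by simp
  also have "\<dots> = integral\<^sup>L lborel f"
    by (subst lborel_eq_distr) (subst integral_distr, auto)
  finally show ?thesis by simp
qed

text \<open>It is read in two ways. As a function of \<open>t\<close> it is the periodization whose
  Fourier coefficients are the Gabor coefficients at translation \<open>l\<close>. For fixed
  \<open>t\<close> it is the sample at \<open>t - l\<close> of the combination of integer shifts of
  \<open>G\<close> with coefficients \<open>f (t + j)\<close>.\<close>

definition period_sum :: "(real \<Rightarrow> complex) \<Rightarrow> (real \<Rightarrow> real) \<Rightarrow> real \<Rightarrow> real \<Rightarrow> complex" where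
  "period_sum f G l t = (LINT j|count_space UNIV. f (t + of_int j) * of_real (G (t + of_int j - l)))"

lemma exp_decay_sq_sum:
  assumes G: "exp_decay a C G"
  shows "(\<integral>\<^sup>+j. ennreal ((G (x + real_of_int j))\<^sup>2) \<partial>count_space UNIV) \<le> ennreal (C\<^sup>2 * sep_const (2 * a) 1)"
proof -
  have a: "a > 0" and C: "C > 0" and le: "\<bar>G x\<bar> \<le> C * exp (- a * \<bar>x\<bar>)" for x
    using G by (auto simp: exp_decay_def)
  have "(\<integral>\<^sup>+j. ennreal ((G (x + real_of_int j))\<^sup>2) \<partial>count_space UNIV)
     \<le> (\<integral>\<^sup>+j. ennreal (C\<^sup>2) * ennreal (exp (- (2 * a) * \<bar>- x - real_of_int j\<bar>)) \<partial>count_space UNIV)"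
  proof (rule nn_integral_mono)
    fix j :: int
    have "\<bar>G (x + real_of_int j)\<bar>\<^sup>2 \<le> (C * exp (- a * \<bar>x + real_of_int j\<bar>))\<^sup>2"
      by (intro power_mono le) simp
    also have "\<dots> = C\<^sup>2 * exp (- (2 * a) * \<bar>x + real_of_int j\<bar>)"
      by (simp add: power_mult_distrib exp_double[symmetric])
    also have "\<bar>x + real_of_int j\<bar> = \<bar>- x - real_of_int j\<bar>" by simp
    finally have "(G (x + real_of_int j))\<^sup>2 \<le> C\<^sup>2 * exp (- (2 * a) * \<bar>- x - real_of_int j\<bar>)" by simp
    then show "ennreal ((G (x + real_of_int j))\<^sup>2) \<le> ennreal (C\<^sup>2) * ennreal (exp (- (2 * a) * \<bar>- x - real_of_int j\<bar>))"
      by (subst ennreal_mult[symmetric]) (auto intro: ennreal_leI)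
  qed
  also have "\<dots> = ennreal (C\<^sup>2) * (\<integral>\<^sup>+j. ennreal (exp (- (2 * a) * \<bar>- x - real_of_int j\<bar>)) \<partial>count_space UNIV)"
    by (rule nn_integral_cmult) simp
  also have "\<dots> \<le> ennreal (C\<^sup>2) * ennreal (sep_const (2 * a) 1)"
    by (intro mult_left_mono separated_exp_sum) (use a in auto)
  also have "\<dots> = ennreal (C\<^sup>2 * sep_const (2 * a) 1)"
    using sep_const_pos[of "2 * a" 1] a by (simp add: ennreal_mult)
  finally show ?thesis .
qed

lemma exp_decay_sq_integral:
  assumes G: "exp_decay a C G"
  shows "(\<integral>\<^sup>+x. ennreal ((G (x - l))\<^sup>2) \<partial>lborel) < \<infinity>"
proof -
  have [measurable]: "G \<in> borel_measurable borel"
    by (rule borel_measurable_continuous_onI[OF exp_decay_continuous[OF G]])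
  have "(\<integral>\<^sup>+x. ennreal ((G (x - l))\<^sup>2) \<partial>lborel) = (\<integral>\<^sup>+t. (\<integral>\<^sup>+j. ennreal ((G (t + real_of_int j - l))\<^sup>2) \<partial>count_space UNIV) \<partial>unit_measure)"
    by (rule nn_integral_periodize) measurable
  also have "\<dots> \<le> (\<integral>\<^sup>+t. ennreal (C\<^sup>2 * sep_const (2 * a) 1) \<partial>unit_measure)"
  proof (rule nn_integral_mono)
    fix t
    have eq: "t + real_of_int j - l = (t - l) + real_of_int j" for j by simp
    show "(\<integral>\<^sup>+j. ennreal ((G (t + real_of_int j - l))\<^sup>2) \<partial>count_space UNIV) \<le> ennreal (C\<^sup>2 * sep_const (2 * a) 1)"
      unfolding eq by (rule exp_decay_sq_sum[OF G])
  qed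
  also have "\<dots> < \<infinity>" by simp
  finally show ?thesis .
qed

lemma period_sum_measurable:
  assumes G: "exp_decay a C G" and [measurable]: "f \<in> borel_measurable borel"
  shows "period_sum f G l \<in> borel_measurable borel"
proof -
  have [measurable]: "G \<in> borel_measurable borel"
    by (rule borel_measurable_continuous_onI[OF exp_decay_continuous[OF G]])
  have "(\<lambda>t. LINT j|count_space UNIV. f (fst (t, j) + of_int (snd (t, j))) * of_real (G (fst (t, j) + of_int (snd (t, j)) - l))) \<in> borel_measurable unit_measure"
    by (rule count_int.borel_measurable_lebesgue_integral) measurable
  then show ?thesis by (simp add: period_sum_def[abs_def])
qed

text \<open>Cauchy-Schwarz in \<open>j\<close>: the sum of squares of \<open>G\<close> over a
  shifted lattice is bounded uniformly, and integrating the other factor over \<open>t\<close>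
  reassembles the norm of \<open>f\<close>.\<close>

lemma L2u_period_sum:
  assumes G: "exp_decay a C G" and f [measurable]: "f \<in> borel_measurable borel" and fin: "(\<integral>\<^sup>+x. ennreal ((cmod (f x))\<^sup>2) \<partial>lborel) < \<infinity>"
  shows "L2u (period_sum f G l)"
proof -
  let ?K = "ennreal (C\<^sup>2 * sep_const (2 * a) 1)"
  have pt: "ennreal ((cmod (period_sum f G l t))\<^sup>2) \<le> ?K * (\<integral>\<^sup>+j. ennreal ((cmod (f (t + real_of_int j)))\<^sup>2) \<partial>count_space UNIV)" for t
  proof -
    have "ennreal (cmod (period_sum f G l t)) \<le> (\<integral>\<^sup>+j. ennreal (cmod (f (t + real_of_int j) * of_real (G (t + of_int j - l)))) \<partial>count_space UNIV)"
      unfolding period_sum_def by (rule norm_integral_le_nn_integral)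
    also have "\<dots> = (\<integral>\<^sup>+j. ennreal (cmod (f (t + real_of_int j))) * ennreal \<bar>G (t + of_int j - l)\<bar> \<partial>count_space UNIV)"
      by (simp add: norm_mult ennreal_mult)
    finally have "(ennreal (cmod (period_sum f G l t)))\<^sup>2 \<le> (\<integral>\<^sup>+j. ennreal (cmod (f (t + real_of_int j))) * ennreal \<bar>G (t + of_int j - l)\<bar> \<partial>count_space UNIV)\<^sup>2"
      by (rule power_mono) simp
    also have "\<dots> \<le> (\<integral>\<^sup>+j. (ennreal (cmod (f (t + real_of_int j))))\<^sup>2 \<partial>count_space UNIV) * (\<integral>\<^sup>+j. (ennreal \<bar>G (t + of_int j - l)\<bar>)\<^sup>2 \<partial>count_space UNIV)"
      by (rule Cauchy_Schwarz_nn_integral) auto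
    also have "(\<integral>\<^sup>+j. (ennreal \<bar>G (t + of_int j - l)\<bar>)\<^sup>2 \<partial>count_space UNIV) = (\<integral>\<^sup>+j. ennreal ((G ((t - l) + real_of_int j))\<^sup>2) \<partial>count_space UNIV)"
      by (intro nn_integral_cong) (simp add: ennreal_power algebra_simps)
    also have "(\<integral>\<^sup>+j. (ennreal (cmod (f (t + real_of_int j))))\<^sup>2 \<partial>count_space UNIV) * \<dots>
       \<le> (\<integral>\<^sup>+j. (ennreal (cmod (f (t + real_of_int j))))\<^sup>2 \<partial>count_space UNIV) * ?K"
      by (intro mult_left_mono exp_decay_sq_sum[OF G]) simp
    finally show ?thesis by (simp add: ennreal_power mult.commute)
  qed
  have "(\<integral>\<^sup>+t. ennreal ((cmod (period_sum f G l t))\<^sup>2) \<partial>unit_measure)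
     \<le> (\<integral>\<^sup>+t. ?K * (\<integral>\<^sup>+j. ennreal ((cmod (f (t + real_of_int j)))\<^sup>2) \<partial>count_space UNIV) \<partial>unit_measure)"
    by (intro nn_integral_mono pt)
  also have "\<dots> = ?K * (\<integral>\<^sup>+t. (\<integral>\<^sup>+j. ennreal ((cmod (f (t + real_of_int j)))\<^sup>2) \<partial>count_space UNIV) \<partial>unit_measure)"
  proof (rule nn_integral_cmult)
    have "(\<lambda>t. \<integral>\<^sup>+j. ennreal ((cmod (f (fst (t, j) + real_of_int (snd (t, j)))))\<^sup>2) \<partial>count_space UNIV) \<in> borel_measurable unit_measure"
      by (rule count_int.borel_measurable_nn_integral) measurable
    then show "(\<lambda>t. \<integral>\<^sup>+j. ennreal ((cmod (f (t + real_of_int j)))\<^sup>2) \<partial>count_space UNIV) \<in> borel_measurable unit_measure" by simp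
  qed
  also have "\<dots> = ?K * (\<integral>\<^sup>+x. ennreal ((cmod (f x))\<^sup>2) \<partial>lborel)"
    by (subst nn_integral_periodize) auto
  also have "\<dots> < \<infinity>" using fin by (simp add: ennreal_mult_less_top)
  finally show ?thesis using period_sum_measurable[OF G f] by (simp add: L2u_def)
qed

text \<open>A modulation by an integer frequency has period 1 and can be pulled out of the
  periodized sum; this is where the frequency set \<open>\<int>\<close> enters.\<close>

lemma gabor_coefficient_eq:
  assumes G: "exp_decay a C G" and f [measurable]: "f \<in> borel_measurable borel" and fin: "(\<integral>\<^sup>+x. ennreal ((cmod (f x))\<^sup>2) \<partial>lborel) < \<infinity>"
  shows "(LINT x|lborel. f x * cnj (modulation (of_int k) (translation l (\<lambda>x. of_real (G x))) x)) = fcoeff (period_sum f G l) k"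
proof -
  have [measurable]: "G \<in> borel_measurable borel"
    by (rule borel_measurable_continuous_onI[OF exp_decay_continuous[OF G]])
  have [measurable]: "(\<lambda>x. cnj (circ k x)) \<in> borel_measurable borel" by (simp add: circ_cnj)
  let ?\<phi> = "\<lambda>x. f x * of_real (G (x - l)) * cnj (circ k x)"
  have "integrable lborel ?\<phi>"
  proof (rule integrableI_bounded)
    have "(\<integral>\<^sup>+x. ennreal (norm (?\<phi> x)) \<partial>lborel) \<le> (\<integral>\<^sup>+x. ennreal ((cmod (f x))\<^sup>2) + ennreal ((G (x - l))\<^sup>2) \<partial>lborel)"
    proof (rule nn_integral_mono)
      fix x
      have "2 * cmod (f x) * \<bar>G (x - l)\<bar> \<le> (cmod (f x))\<^sup>2 + \<bar>G (x - l)\<bar>\<^sup>2" by (rule sum_squares_bound)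
      moreover have "0 \<le> cmod (f x) * \<bar>G (x - l)\<bar>" by simp
      moreover have "norm (?\<phi> x) = cmod (f x) * \<bar>G (x - l)\<bar>" by (simp add: norm_mult)
      ultimately have "norm (?\<phi> x) \<le> (cmod (f x))\<^sup>2 + (G (x - l))\<^sup>2" unfolding power2_abs by linarith
      then show "ennreal (norm (?\<phi> x)) \<le> ennreal ((cmod (f x))\<^sup>2) + ennreal ((G (x - l))\<^sup>2)"
        by (subst (asm) ennreal_le_iff[symmetric]) (auto simp: ennreal_plus)
    qed
    also have "\<dots> = (\<integral>\<^sup>+x. ennreal ((cmod (f x))\<^sup>2) \<partial>lborel) + (\<integral>\<^sup>+x. ennreal ((G (x - l))\<^sup>2) \<partial>lborel)"
      by (rule nn_integral_add) auto
    also have "\<dots> < \<infinity>" using fin exp_decay_sq_integral[OF G, of l] by simp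
    finally show "(\<integral>\<^sup>+x. ennreal (norm (?\<phi> x)) \<partial>lborel) < \<infinity>" .
  qed measurable
  from integral_periodize[OF this]
  have "integral\<^sup>L lborel ?\<phi> = (LINT t|unit_measure. LINT j|count_space UNIV. ?\<phi> (t + real_of_int j))" .
  also have "\<dots> = (LINT t|unit_measure. period_sum f G l t * cnj (circ k t))"
  proof (intro Bochner_Integration.integral_cong refl)
    fix t
    have "circ k (t + real_of_int j) = circ k t" for j
    proof -
      have "circ k (t + real_of_int j) = circ k t * exp (2 * of_real pi * \<i> * of_int (k * j))"
        by (simp add: circ_def exp_add[symmetric] algebra_simps)
      also have "exp (2 * of_real pi * \<i> * of_int (k * j)) = 1"
        using exp_integer_2pi[of "of_int (k * j)"] by (simp add: mult_ac)
      finally show ?thesis by simp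
    qed
    then show "(LINT j|count_space UNIV. ?\<phi> (t + real_of_int j)) = period_sum f G l t * cnj (circ k t)"
      by (simp add: period_sum_def)
  qed
  also have "\<dots> = fcoeff (period_sum f G l) k" by (simp add: fcoeff_def)
  finally show ?thesis
    by (simp add: modulation_def translation_def circ_def mult_ac)
qed

text \<open>Moves the frame sums to integrals against counting measure, where Tonelli applies.
  Countability provides the increasing exhaustion by the finite sets \<open>D n\<close>.\<close>

lemma infsum_ennreal_eq_nn_integral:
  fixes f :: "'a \<Rightarrow> ennreal"
  assumes "countable A"
  shows "infsum f A = (\<integral>\<^sup>+x. f x \<partial>count_space A)"
proof -
  have sum: "sum f F = (\<integral>\<^sup>+x. f x * indicator F x \<partial>count_space A)" if "finite F" "F \<subseteq> A" for F
    using that by (subst nn_integral_count_space'[of F]) (auto intro!: sum.cong)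
  have inf: "infsum f A = (SUP F\<in>{F. finite F \<and> F \<subseteq> A}. sum f F)"
    by (rule nonneg_infsum_complete) simp
  show ?thesis
  proof (rule antisym)
    show "infsum f A \<le> (\<integral>\<^sup>+x. f x \<partial>count_space A)"
      unfolding inf
    proof (rule SUP_least)
      fix F assume "F \<in> {F. finite F \<and> F \<subseteq> A}"
      then show "sum f F \<le> (\<integral>\<^sup>+x. f x \<partial>count_space A)"
        by (auto simp: sum indicator_def intro!: nn_integral_mono)
    qed
    define D where "D n = A \<inter> (from_nat_into A ` {..n})" for n
    have D: "finite (D n)" "D n \<subseteq> A" for n by (auto simp: D_def)
    have inc: "incseq D" by (auto simp: incseq_def D_def)
    have "(\<integral>\<^sup>+x. f x \<partial>count_space A) = (\<integral>\<^sup>+x. (SUP n. f x * indicator (D n) x) \<partial>count_space A)"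
    proof (rule nn_integral_cong)
      fix x assume "x \<in> space (count_space A)"
      then have x: "x \<in> A" by simp
      then obtain n where "from_nat_into A n = x" using from_nat_into_surj[OF assms] by blast
      then have "x \<in> D n" using x by (auto simp: D_def)
      then have "f x \<le> f x * indicator (D n) x" by simp
      also have "\<dots> \<le> (SUP n. f x * indicator (D n) x)" by (rule SUP_upper) simp
      finally have "f x \<le> (SUP n. f x * indicator (D n) x)" .
      moreover have "(SUP n. f x * indicator (D n) x) \<le> f x"
        by (intro SUP_least) (auto simp: indicator_def)
      ultimately show "f x = (SUP n. f x * indicator (D n) x)" by (rule antisym)
    qed
    also have "\<dots> = (SUP n. \<integral>\<^sup>+x. f x * indicator (D n) x \<partial>count_space A)"
    proof (rule nn_integral_monotone_convergence_SUP)
      show "incseq (\<lambda>n x. f x * indicator (D n) x)"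
        using inc by (auto simp: incseq_def le_fun_def indicator_def)
    qed simp
    also have "\<dots> = (SUP n. sum f (D n))" using sum[OF D] by simp
    also have "\<dots> \<le> infsum f A"
      unfolding inf by (rule SUP_mono) (use D in blast)
    finally show "(\<integral>\<^sup>+x. f x \<partial>count_space A) \<le> infsum f A" .
  qed
qed

lemma infsum_times_Ints:
  fixes F :: "real \<Rightarrow> real \<Rightarrow> ennreal"
  assumes "countable \<Lambda>"
  shows "(\<Sum>\<^sub>\<infinity>(l, v)\<in>\<Lambda> \<times> \<int>. F l v) = (\<integral>\<^sup>+l. (\<integral>\<^sup>+k. F l (of_int k) \<partial>count_space UNIV) \<partial>count_space \<Lambda>)"
proof -
  have "countable (\<int> :: real set)" by (simp add: Ints_def)
  then have "(\<Sum>\<^sub>\<infinity>(l, v)\<in>\<Lambda> \<times> \<int>. F l v) = (\<integral>\<^sup>+p. (case p of (l, v) \<Rightarrow> F l v) \<partial>count_space (\<Lambda> \<times> \<int>))"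
    using assms by (intro infsum_ennreal_eq_nn_integral countable_SIGMA)
  also have "\<dots> = (\<integral>\<^sup>+p. (case (fst p, real_of_int (snd p)) of (l, v) \<Rightarrow> F l v) \<partial>count_space (\<Lambda> \<times> UNIV))"
    by (rule nn_integral_bij_count_space[symmetric]) (auto simp: bij_betw_def inj_on_def Ints_def image_iff)
  also have "\<dots> = (\<integral>\<^sup>+p. (F (fst p) (real_of_int (snd p)) * indicator \<Lambda> (fst p)) \<partial>count_space UNIV)"
    by (subst nn_integral_count_space_indicator) (auto simp: indicator_def intro!: nn_integral_cong)
  also have "\<dots> = (\<integral>\<^sup>+l. (\<integral>\<^sup>+k. F (fst (l, k)) (real_of_int (snd (l, k))) * indicator \<Lambda> (fst (l, k)) \<partial>count_space UNIV) \<partial>count_space UNIV)"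
    by (rule nn_integral_fst_count_space[symmetric])
  also have "\<dots> = (\<integral>\<^sup>+l. (\<integral>\<^sup>+k. F l (of_int k) \<partial>count_space UNIV) * indicator \<Lambda> l \<partial>count_space UNIV)"
    by (simp add: nn_integral_multc)
  also have "\<dots> = (\<integral>\<^sup>+l. (\<integral>\<^sup>+k. F l (of_int k) \<partial>count_space UNIV) \<partial>count_space \<Lambda>)"
    by (cases "\<Lambda> = UNIV") (auto simp: nn_integral_count_space_indicator)
  finally show ?thesis .
qed

text \<open>For each translation Parseval carries out the sum over the modulations; Tonelli then
  moves the integral over \<open>t\<close> outside, and what stays inside is
  \<open>sample_norm\<close> of the sequence \<open>f (t + j)\<close>.\<close>

theorem gabor_sum_eq:
  assumes \<Lambda>: "countable \<Lambda>" and G: "exp_decay a C G"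
    and f [measurable]: "f \<in> borel_measurable borel" and fin: "(\<integral>\<^sup>+x. ennreal ((cmod (f x))\<^sup>2) \<partial>lborel) < \<infinity>"
  shows "(\<Sum>\<^sub>\<infinity>(\<mu>, \<nu>)\<in>\<Lambda> \<times> \<int>. ennreal ((cmod (LINT x|lborel. f x * cnj (modulation \<nu> (translation \<mu> (\<lambda>x. of_real (G x))) x)))\<^sup>2))
    = (\<integral>\<^sup>+t. sample_norm \<Lambda> G t (\<lambda>j. f (t + of_int j)) \<partial>unit_measure)"
proof -
  have "(\<Sum>\<^sub>\<infinity>(\<mu>, \<nu>)\<in>\<Lambda> \<times> \<int>. ennreal ((cmod (LINT x|lborel. f x * cnj (modulation \<nu> (translation \<mu> (\<lambda>x. of_real (G x))) x)))\<^sup>2))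
    = (\<integral>\<^sup>+l. (\<integral>\<^sup>+k. ennreal ((cmod (fcoeff (period_sum f G l) k))\<^sup>2) \<partial>count_space UNIV) \<partial>count_space \<Lambda>)"
    unfolding infsum_times_Ints[OF \<Lambda>] gabor_coefficient_eq[OF G f fin] ..
  also have "\<dots> = (\<integral>\<^sup>+l. (\<integral>\<^sup>+t. ennreal ((cmod (period_sum f G l t))\<^sup>2) \<partial>unit_measure) \<partial>count_space \<Lambda>)"
    by (intro nn_integral_cong parseval L2u_period_sum[OF G f fin])
  also have "\<dots> = (\<integral>\<^sup>+t. (\<integral>\<^sup>+l. ennreal ((cmod (period_sum f G l t))\<^sup>2) \<partial>count_space \<Lambda>) \<partial>unit_measure)"
  proof (rule nn_integral_count_space_nn_integral[OF \<Lambda>, symmetric])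
    fix l
    have [measurable]: "period_sum f G l \<in> borel_measurable borel" by (rule period_sum_measurable[OF G f])
    show "(\<lambda>t. ennreal ((cmod (period_sum f G l t))\<^sup>2)) \<in> borel_measurable unit_measure" by simp
  qed
  finally show ?thesis by (simp add: sample_norm_def period_sum_def)
qed

section \<open>Fourier transforms\<close>

text \<open>\<open>fourier_transform\<close> over Borel instead of Lebesgue measure, to work with
  product measures and characteristic functions.\<close>

definition ft :: "(real \<Rightarrow> complex) \<Rightarrow> real \<Rightarrow> complex" where
  "ft f \<xi> = (LINT x|lborel. f x * exp (- (2 * of_real pi * \<i> * of_real x * of_real \<xi>)))"

lemma ft_gauss:
  assumes "c > 0"
  shows "ft (\<lambda>x. of_real (gauss c x)) \<xi> = of_real (exp (- c * \<xi>\<^sup>2))"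
proof -
  \<comment> \<open>The scale at which \<open>s\<close> times the standard normal density at
    \<open>s x\<close> is \<open>gauss c x\<close>, that is
    \<open>(s x)^2 / 2 = pi^2 x^2 / c\<close>. The transform is then the normal characteristic
    function at \<open>t\<close>.\<close>
  define s where "s = sqrt 2 * pi / sqrt c"
  have s: "s > 0" using assms by (simp add: s_def)
  define t where "t = - 2 * pi * \<xi> / s"
  have "complex_of_real (exp (- (t\<^sup>2) / 2)) = char std_normal_distribution t"
    by (simp add: char_std_normal_distribution)
  also have "\<dots> = (LINT x|lborel. std_normal_density x *\<^sub>R iexp (t * x))"
    unfolding char_def by (subst integral_density) auto
  also have "\<dots> = s *\<^sub>R (LINT x|lborel. std_normal_density (s * x) *\<^sub>R iexp (t * (s * x)))"
    using s by (subst lborel_integral_real_affine[where c = s and t = 0]) auto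
  also have "\<dots> = (LINT x|lborel. s *\<^sub>R (std_normal_density (s * x) *\<^sub>R iexp (t * (s * x))))"
    by (rule integral_scaleR_right[symmetric])
  also have "\<dots> = ft (\<lambda>x. of_real (gauss c x)) \<xi>"
    unfolding ft_def
  proof (intro Bochner_Integration.integral_cong refl)
    fix x
    have "s * std_normal_density (s * x) = gauss c x"
    proof -
      have "s / sqrt (2 * pi) = sqrt (pi / c)"
      proof (rule power2_eq_imp_eq)
        have "(s / sqrt (2 * pi))\<^sup>2 = 2 * pi\<^sup>2 / c / (2 * pi)"
          using assms by (simp add: s_def power_divide power_mult_distrib)
        also have "\<dots> = pi / c" by (simp add: power2_eq_square)
        finally show "(s / sqrt (2 * pi))\<^sup>2 = (sqrt (pi / c))\<^sup>2"
          using assms by simp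
      qed (use s assms in auto)
      moreover have "(s * x)\<^sup>2 / 2 = pi\<^sup>2 / c * x\<^sup>2"
        using assms by (simp add: s_def power_divide power_mult_distrib)
      moreover have "s * std_normal_density (s * x) = s / sqrt (2 * pi) * exp (- ((s * x)\<^sup>2 / 2))"
        by (simp add: std_normal_density_def)
      ultimately show ?thesis
        by (simp only: gauss_def) simp
    qed
    moreover have "\<i> * of_real (t * (s * x)) = - (2 * of_real pi * \<i> * of_real x * of_real \<xi>)"
      using s by (simp add: t_def)
    ultimately show "s *\<^sub>R (std_normal_density (s * x) *\<^sub>R iexp (t * (s * x))) =
        of_real (gauss c x) * exp (- (2 * of_real pi * \<i> * of_real x * of_real \<xi>))"
      by (simp only: scaleR_scaleR) (simp add: scaleR_conv_of_real)
  qed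
  also have "- (t\<^sup>2) / 2 = - c * \<xi>\<^sup>2"
    using assms by (simp add: t_def s_def power_divide power_mult_distrib field_simps)
  finally show ?thesis by simp
qed

lemma integrable_exp_abs:
  assumes "a > 0"
  shows "integrable lborel (\<lambda>x::real. exp (- a * \<bar>x\<bar>))"
proof -
  have int: "integrable lborel (\<lambda>s. indicator {0..} s * exp (- a * s))"
    using has_bochner_integral_exp_Ici[OF assms, of 0] by (rule integrable.intros)
  have int': "integrable lborel (\<lambda>s. indicator {0..} (0 + -1 * s) * exp (- a * (0 + -1 * s)))"
    using lborel_integrable_real_affine[OF int, of "-1" 0] by simp
  show ?thesis
    by (rule Bochner_Integration.integrable_bound[OF Bochner_Integration.integrable_add[OF int int']])
      (auto simp: indicator_def abs_if)
qed

lemma exp_decay_integrable: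
  assumes G: "exp_decay a C G"
  shows "integrable lborel G"
proof (rule Bochner_Integration.integrable_bound)
  show "integrable lborel (\<lambda>x. C * exp (- a * \<bar>x\<bar>))"
    using integrable_exp_abs G by (auto simp: exp_decay_def)
  show "G \<in> borel_measurable lborel"
    using borel_measurable_continuous_onI[OF exp_decay_continuous[OF G]] by simp
  show "AE x in lborel. norm (G x) \<le> norm (C * exp (- a * \<bar>x\<bar>))"
    using G by (auto simp: exp_decay_def abs_mult)
qed

text \<open>The transform of the one-sided exponential density behind \<open>exp_smooth\<close>,
  computed from a primitive on \<open>[0, n]\<close> and dominated convergence.\<close>

lemma integral_exp_complex:
  "(LINT s|lborel. indicator {0..} s *\<^sub>R exp (- ((1 + \<i> * of_real y) * of_real s))) = inverse (1 + \<i> * of_real y)"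
proof -
  define w where "w = 1 + \<i> * of_real y"
  have w: "w \<noteq> 0" "Re w = 1" by (auto simp: w_def complex_eq_iff)
  have norm_e: "cmod (exp (- (w * of_real s))) = exp (- s)" for s
    by (simp add: norm_exp_eq_Re w)
  have [measurable]: "(\<lambda>s. exp (- (w * of_real s))) \<in> borel_measurable borel"
    by (intro borel_measurable_continuous_onI continuous_intros)
  have lim: "(\<lambda>n. LINT s|lborel. indicator {0..real n} s *\<^sub>R exp (- (w * of_real s))) \<longlonglongrightarrow> (LINT s|lborel. indicator {0..} s *\<^sub>R exp (- (w * of_real s)))"
  proof (rule integral_dominated_convergence[where w = "\<lambda>s. indicator {0..} s * exp (- 1 * s)"])
    show "integrable lborel (\<lambda>s. indicator {0..} s * exp (- 1 * s) :: real)"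
      using has_bochner_integral_exp_Ici[of 1 0] by (auto intro: integrable.intros)
    show "AE s in lborel. (\<lambda>n. indicator {0..real n} s *\<^sub>R exp (- (w * of_real s))) \<longlonglongrightarrow> indicator {0..} s *\<^sub>R exp (- (w * of_real s))"
    proof (rule AE_I2, rule tendsto_eventually)
      fix s :: real
      obtain N where "s \<le> real N" using real_arch_simple by blast
      then show "eventually (\<lambda>n. indicator {0..real n} s *\<^sub>R exp (- (w * of_real s)) = indicator {0..} s *\<^sub>R exp (- (w * of_real s))) sequentially"
        by (intro eventually_sequentiallyI[of N]) (auto simp: indicator_def)
    qed
    show "AE s in lborel. norm (indicator {0..real n} s *\<^sub>R exp (- (w * of_real s))) \<le> indicator {0..} s * exp (- 1 * s)" for n
      by (intro AE_I2) (auto simp: indicator_def norm_e w(2))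
  qed auto
  have eq: "(LINT s|lborel. indicator {0..real n} s *\<^sub>R exp (- (w * of_real s))) = inverse w - exp (- (w * of_real (real n))) / w" for n
  proof -
    have "(LINT s|lborel. indicator {0..real n} s *\<^sub>R exp (- (w * of_real s))) = - (exp (- (w * of_real (real n))) / w) - (- (exp (- (w * of_real 0)) / w))"
    proof (rule integral_FTC_Icc)
      fix x :: real
      have "((\<lambda>s. - (exp (- (w * of_real s)) / w)) has_vector_derivative - (exp (- (w * of_real x)) * (- (w * 1)) / w)) (at x within {0..real n})"
        by (rule has_vector_derivative_real_field) (auto intro!: derivative_eq_intros simp: w)
      then show "((\<lambda>s. - (exp (- (w * of_real s)) / w)) has_vector_derivative exp (- (w * of_real x))) (at x within {0..real n})"
        using w by simp
    qed (auto intro!: continuous_intros)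
    then show ?thesis by (simp add: inverse_eq_divide)
  qed
  have "(\<lambda>n. exp (- (w * of_real (real n))) / w) \<longlonglongrightarrow> 0"
  proof (rule tendsto_norm_zero_cancel)
    have "(\<lambda>n. exp (- real n)) \<longlonglongrightarrow> 0" by real_asymp
    from tendsto_divide[OF this tendsto_const[of "cmod w"]] w(1)
    have "(\<lambda>n. exp (- real n) / cmod w) \<longlonglongrightarrow> 0" by simp
    then show "(\<lambda>n. norm (exp (- (w * of_real (real n))) / w)) \<longlonglongrightarrow> 0"
      by (simp only: norm_divide norm_e)
  qed
  then have "(\<lambda>n. inverse w - exp (- (w * of_real (real n))) / w) \<longlonglongrightarrow> inverse w - 0"
    by (intro tendsto_diff tendsto_const)
  then have "(LINT s|lborel. indicator {0..} s *\<^sub>R exp (- (w * of_real s))) = inverse w - 0"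
    using lim unfolding eq by (rule LIMSEQ_unique[rotated])
  then show ?thesis by (simp add: w_def)
qed

text \<open>After Fubini the translation by \<open>\<delta> s\<close> becomes the phase
  \<open>e (\<delta> * s)\<close>, and the integral over \<open>s\<close> is
  \<open>integral_exp_complex\<close>. Each average contributes exactly one factor of the product,
  for either sign of \<delta>.\<close>

lemma ft_exp_smooth:
  assumes G: "exp_decay a C G"
  shows "ft (\<lambda>x. of_real (exp_smooth \<delta> G x)) \<xi> = inverse (1 + 2 * of_real pi * \<i> * of_real \<delta> * of_real \<xi>) * ft (\<lambda>x. of_real (G x)) \<xi>"
proof -
  have [measurable]: "G \<in> borel_measurable borel"
    by (rule borel_measurable_continuous_onI[OF exp_decay_continuous[OF G]])
  define e where "e x = exp (- (2 * of_real pi * \<i> * of_real x * of_real \<xi>))" for x :: real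
  have [measurable]: "e \<in> borel_measurable borel"
    unfolding e_def[abs_def] by (intro borel_measurable_continuous_onI continuous_intros)
  have norm_e: "cmod (e x) = 1" for x by (simp add: e_def norm_exp_eq_Re)
  define F where "F s x = (indicator {0..} s * exp (- s)) *\<^sub>R (of_real (G (x - \<delta> * s)) * e x)" for s x
  have intG: "integrable lborel (\<lambda>x. G (x - \<delta> * s))" for s
    using lborel_integrable_real_affine[OF exp_decay_integrable[OF G], of 1 "- \<delta> * s"] by (simp add: algebra_simps)
  have intGe: "integrable lborel (\<lambda>x. of_real (G (x - \<delta> * s)) * e x)" for s
    by (rule Bochner_Integration.integrable_bound[OF intG[of s]]) (auto simp: norm_mult norm_e)
  have shift: "(LINT x|lborel. f (x - \<delta> * s)) = integral\<^sup>L lborel f" for f :: "real \<Rightarrow> 'b::{banach, second_countable_topology}" and s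
    using lborel_integral_real_affine[of 1 f "- \<delta> * s"] by (simp add: algebra_simps)
  have int: "integrable (lborel \<Otimes>\<^sub>M lborel) (\<lambda>(s, x). F s x)"
  proof (rule lborel_pair.Fubini_integrable)
    show "(\<lambda>(s, x). F s x) \<in> borel_measurable (lborel \<Otimes>\<^sub>M lborel)"
      unfolding F_def by measurable
    have "(LINT x|lborel. norm (F s x)) = (indicator {0..} s * exp (- 1 * s)) * (LINT x|lborel. \<bar>G x\<bar>)" for s
      using shift[of "\<lambda>x. \<bar>G x\<bar>" s] by (simp add: F_def norm_mult norm_e)
    then show "integrable lborel (\<lambda>s. LINT x|lborel. norm (case (s, x) of (s, x) \<Rightarrow> F s x))"
      using has_bochner_integral_exp_Ici[of 1 0] by (auto intro: integrable.intros)
    show "AE s in lborel. integrable lborel (\<lambda>x. case (s, x) of (s, x) \<Rightarrow> F s x)"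
      unfolding F_def using intGe by simp
  qed
  have "ft (\<lambda>x. of_real (exp_smooth \<delta> G x)) \<xi> = (LINT x|lborel. LINT s|lborel. F s x)"
    unfolding ft_def
  proof (intro Bochner_Integration.integral_cong refl)
    fix x
    have "(LINT s|lborel. F s x) = (LINT s|lborel. of_real (indicator {0..} s * (exp (- s) * G (x - \<delta> * s))) * e x)"
      by (intro Bochner_Integration.integral_cong refl) (simp add: F_def scaleR_conv_of_real)
    also have "\<dots> = of_real (exp_smooth \<delta> G x) * e x"
      unfolding exp_smooth_def by (simp del: of_real_mult)
    finally show "of_real (exp_smooth \<delta> G x) * exp (- (2 * of_real pi * \<i> * of_real x * of_real \<xi>)) = (LINT s|lborel. F s x)"
      by (simp add: e_def)
  qed
  also have "\<dots> = (LINT s|lborel. LINT x|lborel. F s x)"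
    by (rule lborel_pair.Fubini_integral[OF int])
  also have "\<dots> = (LINT s|lborel. (indicator {0..} s *\<^sub>R exp (- ((1 + \<i> * of_real (2 * pi * \<delta> * \<xi>)) * of_real s))) * ft (\<lambda>x. of_real (G x)) \<xi>)"
  proof (intro Bochner_Integration.integral_cong refl)
    fix s
    have "(LINT x|lborel. of_real (G (x - \<delta> * s)) * e x) = (LINT x|lborel. e (\<delta> * s) * (of_real (G (x - \<delta> * s)) * e (x - \<delta> * s)))"
      by (intro Bochner_Integration.integral_cong refl) (simp add: e_def exp_add[symmetric] algebra_simps)
    also have "\<dots> = e (\<delta> * s) * ft (\<lambda>x. of_real (G x)) \<xi>"
      using shift[of "\<lambda>x. of_real (G x) * e x" s] by (simp add: ft_def e_def)
    finally have "(LINT x|lborel. F s x) = (indicator {0..} s * exp (- s)) *\<^sub>R (e (\<delta> * s) * ft (\<lambda>x. of_real (G x)) \<xi>)"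
      by (simp add: F_def)
    also have "\<dots> = (indicator {0..} s *\<^sub>R (of_real (exp (- s)) * e (\<delta> * s))) * ft (\<lambda>x. of_real (G x)) \<xi>"
      by (simp add: scaleR_conv_of_real)
    also have "of_real (exp (- s)) * e (\<delta> * s) = exp (- ((1 + \<i> * of_real (2 * pi * \<delta> * \<xi>)) * of_real s))"
    proof -
      have "of_real (exp (- s)) = exp (- complex_of_real s)" by (metis exp_of_real of_real_minus)
      then show ?thesis by (simp only: e_def exp_add[symmetric]) (simp add: algebra_simps)
    qed
    finally show "(LINT x|lborel. F s x) = (indicator {0..} s *\<^sub>R exp (- ((1 + \<i> * of_real (2 * pi * \<delta> * \<xi>)) * of_real s))) * ft (\<lambda>x. of_real (G x)) \<xi>" .
  qed
  also have "\<dots> = inverse (1 + \<i> * of_real (2 * pi * \<delta> * \<xi>)) * ft (\<lambda>x. of_real (G x)) \<xi>"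
    by (simp only: integral_mult_left_zero integral_exp_complex)
  finally show ?thesis by (simp add: mult_ac)
qed

lemma ft_tp_kernel:
  assumes "c > 0"
  shows "ft (\<lambda>x. of_real (tp_kernel c ds x)) \<xi> =
    (\<Prod>\<delta>\<leftarrow>ds. inverse (1 + 2 * of_real pi * \<i> * of_real \<delta> * of_real \<xi>)) * of_real (exp (- c * \<xi>\<^sup>2))"
proof (induction ds)
  case Nil
  then show ?case using ft_gauss[OF assms] by (simp add: tp_kernel_def)
next
  case (Cons \<delta> ds)
  obtain a where a: "a > 0" "\<forall>\<delta>\<in>set ds. a * \<bar>\<delta>\<bar> \<le> 1 / 2" using exists_decay_rate by blast
  obtain C where "exp_decay a C (tp_kernel c ds)" using exp_decay_tp_kernel[OF assms a] by blast
  from ft_exp_smooth[OF this, of \<delta> \<xi>] Cons.IH show ?case by (simp add: tp_kernel_def)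
qed

section \<open>Uniqueness of the Fourier transform, reduced to characteristic functions\<close>

lemma integrable_iexp:
  fixes d :: "real \<Rightarrow> complex"
  assumes "integrable lborel d"
  shows "integrable lborel (\<lambda>x. d x * iexp (t * x))"
proof (rule Bochner_Integration.integrable_bound[OF assms])
  have "(\<lambda>x. iexp (t * x)) \<in> borel_measurable borel"
    by (intro borel_measurable_continuous_onI continuous_intros)
  then show "(\<lambda>x. d x * iexp (t * x)) \<in> borel_measurable lborel"
    using assms by simp
qed (auto simp: norm_mult)

text \<open>The positive and negative parts of \<open>r\<close> have the same transform and, by its
  value at 0, the same mass \<open>m\<close>. If \<open>m > 0\<close>, dividing by it gives two
  probability densities with equal characteristic functions, and Levy's uniqueness theorem
  applies.\<close>

lemma fourier_uniqueness_real:
  fixes r :: "real \<Rightarrow> real"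
  assumes int: "integrable lborel r" and zero: "\<And>t. (LINT x|lborel. of_real (r x) * iexp (t * x)) = 0"
  shows "AE x in lborel. r x = 0"
proof -
  define p where "p x = max 0 (r x)" for x
  define n where "n x = max 0 (- r x)" for x
  have r: "r x = p x - n x" for x by (simp add: p_def n_def)
  have nn: "p x \<ge> 0" "n x \<ge> 0" for x by (auto simp: p_def n_def)
  have ip: "integrable lborel p" "integrable lborel n"
    unfolding p_def[abs_def] n_def[abs_def] using int by auto
  then have [measurable]: "p \<in> borel_measurable borel" "n \<in> borel_measurable borel" by auto
  have ipe: "integrable lborel (\<lambda>x. of_real (p x) * iexp (t * x))" "integrable lborel (\<lambda>x. of_real (n x) * iexp (t * x))" for t
    by (rule integrable_iexp, use ip in simp)+
  have eq: "(LINT x|lborel. of_real (p x) * iexp (t * x)) = (LINT x|lborel. of_real (n x) * iexp (t * x))" for t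
  proof -
    have "0 = (LINT x|lborel. of_real (p x) * iexp (t * x) - of_real (n x) * iexp (t * x))"
      using zero[of t] by (simp add: r left_diff_distrib)
    also have "\<dots> = (LINT x|lborel. of_real (p x) * iexp (t * x)) - (LINT x|lborel. of_real (n x) * iexp (t * x))"
      by (rule Bochner_Integration.integral_diff[OF ipe])
    finally show ?thesis by simp
  qed
  define m where "m = integral\<^sup>L lborel p"
  have mn: "integral\<^sup>L lborel n = m"
  proof -
    have "complex_of_real (integral\<^sup>L lborel p) = of_real (integral\<^sup>L lborel n)" using eq[of 0] by simp
    then show ?thesis unfolding m_def of_real_eq_iff by simp
  qed
  have "m \<ge> 0" unfolding m_def by (intro Bochner_Integration.integral_nonneg) (use nn in auto)
  show ?thesis
  proof (cases "m = 0")
    case True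
    then have "AE x in lborel. p x = 0" "AE x in lborel. n x = 0"
      using integral_nonneg_eq_0_iff_AE[OF ip(1)] integral_nonneg_eq_0_iff_AE[OF ip(2)] nn mn by (auto simp: m_def)
    then show ?thesis by eventually_elim (simp add: r)
  next
    case False
    with \<open>m \<ge> 0\<close> have m: "m > 0" by simp
    have dist: "real_distribution (density lborel (\<lambda>x. ennreal (q x / m)))"
      if q: "integrable lborel q" "\<And>x. q x \<ge> 0" "integral\<^sup>L lborel q = m" for q
    proof -
      have [measurable]: "q \<in> borel_measurable borel" using q(1) by auto
      have "emeasure (density lborel (\<lambda>x. ennreal (q x / m))) UNIV = (\<integral>\<^sup>+x. ennreal (q x / m) \<partial>lborel)"
        by (subst emeasure_density) auto
      also have "\<dots> = ennreal (LINT x|lborel. q x / m)"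
        using q m by (intro nn_integral_eq_integral) auto
      also have "(LINT x|lborel. q x / m) = 1" using q(3) m by simp
      finally show ?thesis by (intro real_distribution.intro prob_spaceI real_distribution_axioms.intro) auto
    qed
    have ch: "char (density lborel (\<lambda>x. ennreal (q x / m))) t = of_real (1 / m) * (LINT x|lborel. of_real (q x) * iexp (t * x))"
      if [measurable]: "q \<in> borel_measurable borel" and "\<And>x. q x \<ge> 0" for q t
    proof -
      have "char (density lborel (\<lambda>x. ennreal (q x / m))) t = (LINT x|lborel. (q x / m) *\<^sub>R iexp (t * x))"
        unfolding char_def using that(2) m by (subst integral_density) auto
      also have "\<dots> = (LINT x|lborel. of_real (1 / m) * (of_real (q x) * iexp (t * x)))"
        by (intro Bochner_Integration.integral_cong refl) (simp add: scaleR_conv_of_real)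
      finally show ?thesis by simp
    qed
    have "density lborel (\<lambda>x. ennreal (p x / m)) = density lborel (\<lambda>x. ennreal (n x / m))"
      by (rule Levy_uniqueness)
        (use dist[OF ip(1)] dist[OF ip(2)] nn mn eq in \<open>auto simp: m_def[symmetric] ch fun_eq_iff\<close>)
    then have "AE x in lborel. ennreal (p x / m) = ennreal (n x / m)"
      by (intro sigma_finite_measure.density_unique[OF lborel.sigma_finite_measure_axioms]) auto
    then show ?thesis
      by eventually_elim (use nn m in \<open>simp add: r\<close>)
  qed
qed

text \<open>The hypothesis at the frequency \<open>- t\<close> shows that the transform of
  \<open>cnj d\<close> vanishes as well, so real and imaginary parts can be treated
  separately.\<close>

lemma fourier_uniqueness:
  fixes d :: "real \<Rightarrow> complex"
  assumes int: "integrable lborel d" and zero: "\<And>\<xi>. ft d \<xi> = 0"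
  shows "AE x in lborel. d x = 0"
proof -
  have z: "(LINT x|lborel. d x * iexp (t * x)) = 0" for t
  proof -
    have "(LINT x|lborel. d x * iexp (t * x)) = ft d (- t / (2 * pi))"
      unfolding ft_def by (intro Bochner_Integration.integral_cong refl) (simp add: mult_ac)
    then show ?thesis using zero by simp
  qed
  have z': "(LINT x|lborel. cnj (d x) * iexp (t * x)) = 0" for t
  proof -
    have "(LINT x|lborel. cnj (d x) * iexp (t * x)) = (LINT x|lborel. cnj (d x * iexp (- t * x)))"
      by (intro Bochner_Integration.integral_cong refl) (simp add: exp_cnj)
    also have "\<dots> = cnj (LINT x|lborel. d x * iexp (- t * x))"
      by (rule Bochner_Integration.integral_cnj)
    finally show ?thesis using z[of "- t"] by simp
  qed
  have ie: "integrable lborel (\<lambda>x. d x * iexp (t * x))" "integrable lborel (\<lambda>x. cnj (d x) * iexp (t * x))" for t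
    by (rule integrable_iexp, use int in simp)+
  have "(LINT x|lborel. of_real (Re (d x)) * iexp (t * x)) = 0" for t
  proof -
    have "complex_of_real (Re z) * e = (z * e + cnj z * e) / 2" for z e
      by (simp add: complex_eq_iff)
    then have "(LINT x|lborel. of_real (Re (d x)) * iexp (t * x)) = (LINT x|lborel. (d x * iexp (t * x) + cnj (d x) * iexp (t * x)) / 2)"
      by (simp only:)
    also have "\<dots> = ((LINT x|lborel. d x * iexp (t * x)) + (LINT x|lborel. cnj (d x) * iexp (t * x))) / 2"
      using ie[of t] by simp
    finally show ?thesis using z z' by simp
  qed
  then have "AE x in lborel. Re (d x) = 0"
    using int by (intro fourier_uniqueness_real) auto
  moreover have "(LINT x|lborel. of_real (Im (d x)) * iexp (t * x)) = 0" for t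
  proof -
    have "complex_of_real (Im z) * e = (z * e - cnj z * e) / (2 * \<i>)" for z e
      by (simp add: complex_eq_iff)
    then have "(LINT x|lborel. of_real (Im (d x)) * iexp (t * x)) = (LINT x|lborel. (d x * iexp (t * x) - cnj (d x) * iexp (t * x)) / (2 * \<i>))"
      by (simp only:)
    also have "\<dots> = ((LINT x|lborel. d x * iexp (t * x)) - (LINT x|lborel. cnj (d x) * iexp (t * x))) / (2 * \<i>)"
      using ie[of t] by simp
    finally show ?thesis using z z' by simp
  qed
  then have "AE x in lborel. Im (d x) = 0"
    using int by (intro fourier_uniqueness_real) auto
  ultimately show ?thesis by eventually_elim (simp add: complex_eq_iff)
qed

lemma borel_version:
  fixes f :: "real \<Rightarrow> complex"
  assumes "f \<in> borel_measurable lebesgue"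
  shows "\<exists>f'\<in>borel_measurable borel. AE x in lebesgue. f x = f' x"
proof -
  have "(\<lambda>x. Re (f x)) \<in> borel_measurable lebesgue" "(\<lambda>x. Im (f x)) \<in> borel_measurable lebesgue"
    using assms by measurable
  then obtain u v where uv: "u \<in> borel_measurable lborel" "AE x in lborel. Re (f x) = u x"
    "v \<in> borel_measurable lborel" "AE x in lborel. Im (f x) = v x"
    using completion_ex_borel_measurable_real by blast
  have "AE x in lebesgue. Re (f x) = u x" "AE x in lebesgue. Im (f x) = v x"
    using uv(2,4) by (auto intro: AE_completion)
  then have "AE x in lebesgue. f x = Complex (u x) (v x)"
    by eventually_elim (simp add: complex_eq_iff)
  moreover have "(\<lambda>x. Complex (u x) (v x)) \<in> borel_measurable borel"
    using uv(1,3) by (auto simp: borel_measurable_complex_iff)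
  ultimately show ?thesis
    by (intro bexI[of _ "\<lambda>x. Complex (u x) (v x)"])
qed

lemma totally_positive_gaussian_type_kernel:
  assumes "totally_positive_gaussian_type g"
  shows "\<exists>c ds. c > 0 \<and> (AE x in lebesgue. g x = of_real (tp_kernel c ds x))"
proof -
  obtain n :: nat and \<delta> c where int: "integrable lebesgue g" and c: "c > 0"
    and ftg: "\<And>\<xi>. fourier_transform g \<xi> =
           (\<Prod>j=1..n. inverse (1 + 2 * of_real pi * \<i> * of_real (\<delta> j) * of_real \<xi>)) * of_real (exp (- c * \<xi>\<^sup>2))"
    using assms unfolding totally_positive_gaussian_type_def by blast
  define ds where "ds = map \<delta> [1..<Suc n]"
  obtain g' where g': "g' \<in> borel_measurable borel" "AE x in lebesgue. g x = g' x"
    by (rule bexE[OF borel_version[OF borel_measurable_integrable[OF int]]])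
  have "integrable lebesgue g'"
    using int g' by (subst integrable_cong_AE[symmetric, of g]) (auto intro: measurable_completion)
  then have int': "integrable lborel g'" using g'(1) by (subst (asm) integrable_completion) auto
  obtain a where a: "a > 0" "\<forall>\<delta>\<in>set ds. a * \<bar>\<delta>\<bar> \<le> 1 / 2" using exists_decay_rate by blast
  obtain C where G: "exp_decay a C (tp_kernel c ds)" using exp_decay_tp_kernel[OF c a] by blast
  have intG: "integrable lborel (\<lambda>x. complex_of_real (tp_kernel c ds x))"
    using exp_decay_integrable[OF G] by simp
  have iexp: "integrable lborel (\<lambda>x. f x * exp (- (2 * of_real pi * \<i> * of_real x * of_real \<xi>)))"
    if "integrable lborel f" for f \<xi>
    using integrable_iexp[OF that, of "- 2 * pi * \<xi>"] by (simp add: mult_ac)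
  have "ft (\<lambda>x. g' x - of_real (tp_kernel c ds x)) \<xi> = 0" for \<xi>
  proof -
    have "fourier_transform g \<xi> = (LINT x|lebesgue. g' x * exp (- (2 * of_real pi * \<i> * of_real x * of_real \<xi>)))"
      unfolding fourier_transform_def
    proof (rule integral_cong_AE)
      have e: "(\<lambda>x. exp (- (2 * of_real pi * \<i> * of_real x * of_real \<xi>))) \<in> borel_measurable lebesgue"
        by (intro measurable_completion) (auto intro!: borel_measurable_continuous_onI continuous_intros)
      show "(\<lambda>x. g x * exp (- (2 * of_real pi * \<i> * of_real x * of_real \<xi>))) \<in> borel_measurable lebesgue"
        using int e by (intro borel_measurable_times) auto
      show "(\<lambda>x. g' x * exp (- (2 * of_real pi * \<i> * of_real x * of_real \<xi>))) \<in> borel_measurable lebesgue"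
        using g'(1) e by (intro borel_measurable_times measurable_completion) auto
      show "AE x in lebesgue. g x * exp (- (2 * of_real pi * \<i> * of_real x * of_real \<xi>)) = g' x * exp (- (2 * of_real pi * \<i> * of_real x * of_real \<xi>))"
        using g'(2) by eventually_elim simp
    qed
    also have "\<dots> = ft g' \<xi>"
      unfolding ft_def using iexp[OF int', THEN borel_measurable_integrable] by (rule integral_completion)
    finally have "ft g' \<xi> = fourier_transform g \<xi>" by simp
    moreover have "ft (\<lambda>x. of_real (tp_kernel c ds x)) \<xi> = fourier_transform g \<xi>"
    proof -
      have "(\<Prod>\<delta>\<leftarrow>ds. inverse (1 + 2 * of_real pi * \<i> * of_real \<delta> * of_real \<xi>)) =
        (\<Prod>j\<leftarrow>[1..<Suc n]. inverse (1 + 2 * of_real pi * \<i> * of_real (\<delta> j) * of_real \<xi>))"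
        by (simp only: ds_def map_map comp_def)
      also have "\<dots> = (\<Prod>j\<in>set [1..<Suc n]. inverse (1 + 2 * of_real pi * \<i> * of_real (\<delta> j) * of_real \<xi>))"
        by (rule prod.distinct_set_conv_list[symmetric]) simp
      also have "set [1..<Suc n] = {1..n}" by auto
      finally show ?thesis unfolding ft_tp_kernel[OF c] ftg by simp
    qed
    moreover have "ft (\<lambda>x. g' x - of_real (tp_kernel c ds x)) \<xi> = ft g' \<xi> - ft (\<lambda>x. of_real (tp_kernel c ds x)) \<xi>"
      unfolding ft_def left_diff_distrib by (rule Bochner_Integration.integral_diff[OF iexp[OF int'] iexp[OF intG]])
    ultimately show ?thesis by simp
  qed
  then have "AE x in lborel. g' x - of_real (tp_kernel c ds x) = 0"
    using int' intG by (intro fourier_uniqueness) auto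
  then have "AE x in lebesgue. g' x - of_real (tp_kernel c ds x) = 0" by (rule AE_completion)
  with g'(2) have "AE x in lebesgue. g x = of_real (tp_kernel c ds x)" by eventually_elim simp
  then show ?thesis using c by (intro exI[of _ c] exI[of _ ds] conjI)
qed

section \<open>Frames and sampling inequalities\<close>

text \<open>The two centres \<open>t\<close> and \<open>t'\<close> allow \<open>H\<close> to be the
  sampled kernel itself or the difference of the kernel at two shifts. The factor 2 in
  \<open>K\<close> accounts for the two exponentials.\<close>

lemma schur_shift:
  fixes \<Lambda> :: "real set" and H :: "real \<Rightarrow> int \<Rightarrow> real"
  assumes sep: "d0 > 0" "\<And>x y. x \<in> \<Lambda> \<Longrightarrow> y \<in> \<Lambda> \<Longrightarrow> x \<noteq> y \<Longrightarrow> d0 \<le> \<bar>x - y\<bar>"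
    and "a > 0" "D \<ge> 0"
    and H: "\<And>l k. \<bar>H l k\<bar> \<le> D * (exp (- a * \<bar>t + of_int k - l\<bar>) + exp (- a * \<bar>t' + of_int k - l\<bar>))"
  defines "K \<equiv> 2 * (sep_const a 1 + sep_const a d0)"
  shows "(\<integral>\<^sup>+l. ennreal ((cmod (LINT k|count_space UNIV. c k * of_real (H l k)))\<^sup>2) \<partial>count_space \<Lambda>) \<le> ennreal ((D * K)\<^sup>2) * coeff_norm c"
proof -
  have pos: "sep_const a 1 > 0" "sep_const a d0 > 0" using \<open>a > 0\<close> sep(1) by (auto intro: sep_const_pos)
  then have K: "K > 0" by (simp add: K_def)
  define e where "e l k = exp (- a * \<bar>t + of_int k - l\<bar>) + exp (- a * \<bar>t' + of_int k - l\<bar>)" for l and k :: int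
  have add: "(\<integral>\<^sup>+i. ennreal (f i + g i) \<partial>count_space I) \<le> ennreal K"
    if "\<And>i. f i \<ge> 0" "\<And>i. g i \<ge> 0" "(\<integral>\<^sup>+i. ennreal (f i) \<partial>count_space I) \<le> ennreal p" "(\<integral>\<^sup>+i. ennreal (g i) \<partial>count_space I) \<le> ennreal p"
      "p \<ge> 0" "2 * p \<le> K" for f g I p
  proof -
    have "(\<integral>\<^sup>+i. ennreal (f i + g i) \<partial>count_space I) = (\<integral>\<^sup>+i. ennreal (f i) \<partial>count_space I) + (\<integral>\<^sup>+i. ennreal (g i) \<partial>count_space I)"
      using that(1,2) by (subst nn_integral_add[symmetric]) (auto simp: ennreal_plus)
    also have "\<dots> \<le> ennreal p + ennreal p" using that(3,4) by (rule add_mono)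
    also have "\<dots> = ennreal (p + p)" using that(5) by (intro ennreal_plus[symmetric])
    also have "\<dots> \<le> ennreal K" using that(6) by (intro ennreal_leI) simp
    finally show ?thesis .
  qed
  have row: "(\<integral>\<^sup>+k. ennreal (e l k) \<partial>count_space UNIV) \<le> ennreal K" for l
  proof -
    have "(\<integral>\<^sup>+k. ennreal (exp (- a * \<bar>u + of_int k - l\<bar>)) \<partial>count_space UNIV) \<le> ennreal (sep_const a 1)" for u
    proof -
      have eq: "\<bar>u + of_int k - l\<bar> = \<bar>(l - u) - real_of_int k\<bar>" for k by auto
      show ?thesis unfolding eq by (rule separated_exp_sum) (use \<open>a > 0\<close> in auto)
    qed
    then show ?thesis unfolding e_def using pos by (intro add) (auto simp: K_def)
  qed
  have col: "(\<integral>\<^sup>+l. ennreal (e l k) \<partial>count_space \<Lambda>) \<le> ennreal K" for k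
  proof -
    have "(\<integral>\<^sup>+l. ennreal (exp (- a * \<bar>u - l\<bar>)) \<partial>count_space \<Lambda>) \<le> ennreal (sep_const a d0)" for u
      by (rule separated_exp_sum) (use \<open>a > 0\<close> sep in auto)
    then show ?thesis unfolding e_def using pos by (intro add) (auto simp: K_def)
  qed
  have pt: "ennreal ((cmod (LINT k|count_space UNIV. c k * of_real (H l k)))\<^sup>2) \<le> (\<integral>\<^sup>+k. ennreal (e l k * (D * cmod (c k))) \<partial>count_space UNIV)\<^sup>2" for l
  proof -
    have "ennreal (cmod (LINT k|count_space UNIV. c k * of_real (H l k))) \<le> (\<integral>\<^sup>+k. ennreal (cmod (c k * of_real (H l k))) \<partial>count_space UNIV)"
      by (rule norm_integral_le_nn_integral)
    also have "\<dots> \<le> (\<integral>\<^sup>+k. ennreal (e l k * (D * cmod (c k))) \<partial>count_space UNIV)"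
    proof (intro nn_integral_mono ennreal_leI)
      fix k
      have "cmod (c k) * \<bar>H l k\<bar> \<le> cmod (c k) * (D * e l k)"
        unfolding e_def by (intro mult_left_mono H) simp
      then show "cmod (c k * of_real (H l k)) \<le> e l k * (D * cmod (c k))"
        by (simp add: norm_mult mult_ac)
    qed
    finally have "(ennreal (cmod (LINT k|count_space UNIV. c k * of_real (H l k))))\<^sup>2 \<le> (\<integral>\<^sup>+k. ennreal (e l k * (D * cmod (c k))) \<partial>count_space UNIV)\<^sup>2"
      by (rule power_mono) simp
    then show ?thesis by (simp add: ennreal_power)
  qed
  have "(\<integral>\<^sup>+l. ennreal ((cmod (LINT k|count_space UNIV. c k * of_real (H l k)))\<^sup>2) \<partial>count_space \<Lambda>)
     \<le> (\<integral>\<^sup>+l. (\<integral>\<^sup>+k. ennreal (e l k * (D * cmod (c k))) \<partial>count_space UNIV)\<^sup>2 \<partial>count_space \<Lambda>)"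
    by (intro nn_integral_mono pt)
  also have "\<dots> \<le> ennreal K * ennreal K * (\<integral>\<^sup>+k. ennreal ((D * cmod (c k))\<^sup>2) \<partial>count_space UNIV)"
    by (rule schur_test[OF separated_countable[OF sep]]) (use \<open>D \<ge> 0\<close> row col in \<open>auto simp: e_def\<close>)
  also have "(\<integral>\<^sup>+k. ennreal ((D * cmod (c k))\<^sup>2) \<partial>count_space UNIV) = (\<integral>\<^sup>+k. ennreal (D\<^sup>2) * ennreal ((cmod (c k))\<^sup>2) \<partial>count_space UNIV)"
    by (intro nn_integral_cong) (simp add: power_mult_distrib ennreal_mult)
  also have "\<dots> = ennreal (D\<^sup>2) * coeff_norm c"
    unfolding coeff_norm_def by (rule nn_integral_cmult) simp
  also have "ennreal K * ennreal K * (ennreal (D\<^sup>2) * coeff_norm c) = ennreal (K * K * D\<^sup>2) * coeff_norm c"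
    using K by (simp add: ennreal_mult mult.assoc)
  also have "K * K * D\<^sup>2 = (D * K)\<^sup>2" by (simp add: power2_eq_square)
  finally show ?thesis .
qed

lemma sample_norm_upper:
  fixes \<Lambda> :: "real set"
  assumes sep: "d0 > 0" "\<And>x y. x \<in> \<Lambda> \<Longrightarrow> y \<in> \<Lambda> \<Longrightarrow> x \<noteq> y \<Longrightarrow> d0 \<le> \<bar>x - y\<bar>"
    and G: "exp_decay a C G"
  shows "sample_norm \<Lambda> G t c \<le> ennreal ((C * (2 * (sep_const a 1 + sep_const a d0)))\<^sup>2) * coeff_norm c"
  unfolding sample_norm_def
proof (rule schur_shift[OF sep])
  show "a > 0" "C \<ge> 0" using G by (auto simp: exp_decay_def)
  fix l k
  have "\<bar>G (t + of_int k - l)\<bar> \<le> C * exp (- a * \<bar>t + of_int k - l\<bar>)" using G by (simp add: exp_decay_def)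
  also have "\<dots> \<le> C * (exp (- a * \<bar>t + of_int k - l\<bar>) + exp (- a * \<bar>t + of_int k - l\<bar>))"
    using \<open>C \<ge> 0\<close> by (intro mult_left_mono) auto
  finally show "\<bar>G (t + of_int k - l)\<bar> \<le> C * (exp (- a * \<bar>t + of_int k - l\<bar>) + exp (- a * \<bar>t + of_int k - l\<bar>))" .
qed

text \<open>Continuity of the sampled norm in the shift, uniform in \<open>c\<close>; it converts an
  inequality integrated over \<open>t\<close> into one at each single \<open>t\<close>.\<close>

lemma sample_norm_perturb:
  fixes \<Lambda> :: "real set"
  assumes sep: "d0 > 0" "\<And>x y. x \<in> \<Lambda> \<Longrightarrow> y \<in> \<Lambda> \<Longrightarrow> x \<noteq> y \<Longrightarrow> d0 \<le> \<bar>x - y\<bar>"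
    and G: "exp_decay a C G" and fin: "finite {k. c k \<noteq> 0}"
  shows "sample_norm \<Lambda> G t c \<le> 2 * sample_norm \<Lambda> G t' c + 2 * (ennreal ((C * \<bar>t - t'\<bar> * (2 * (sep_const a 1 + sep_const a d0)))\<^sup>2) * coeff_norm c)"
proof -
  have C: "C > 0" "a > 0" using G by (auto simp: exp_decay_def)
  define S where "S t l = (LINT k|count_space UNIV. c k * of_real (G (t + of_int k - l)))" for t l
  have int: "integrable (count_space UNIV) (\<lambda>k. c k * of_real (G (t + of_int k - l)))" for t l
    by (rule integrable_finite_support[OF fin]) simp
  have diff: "S t l - S t' l = (LINT k|count_space UNIV. c k * of_real (G (t + of_int k - l) - G (t' + of_int k - l)))" for l
    unfolding S_def by (subst Bochner_Integration.integral_diff[symmetric, OF int int]) (simp add: right_diff_distrib)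
  have le: "(\<integral>\<^sup>+l. ennreal ((cmod (S t l - S t' l))\<^sup>2) \<partial>count_space \<Lambda>) \<le> ennreal ((C * \<bar>t - t'\<bar> * (2 * (sep_const a 1 + sep_const a d0)))\<^sup>2) * coeff_norm c"
    unfolding diff
  proof (rule schur_shift[OF sep])
    fix l k
    show "\<bar>G (t + of_int k - l) - G (t' + of_int k - l)\<bar> \<le> C * \<bar>t - t'\<bar> * (exp (- a * \<bar>t + of_int k - l\<bar>) + exp (- a * \<bar>t' + of_int k - l\<bar>))"
    proof -
      have "\<bar>G x - G y\<bar> \<le> C * \<bar>x - y\<bar> * (exp (- a * \<bar>x\<bar>) + exp (- a * \<bar>y\<bar>))" for x y
        using G by (simp add: exp_decay_def)
      from this[of "t + of_int k - l" "t' + of_int k - l"] show ?thesis by simp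
    qed
  qed (use C in auto)
  have "sample_norm \<Lambda> G t c \<le> (\<integral>\<^sup>+l. 2 * ennreal ((cmod (S t' l))\<^sup>2) + 2 * ennreal ((cmod (S t l - S t' l))\<^sup>2) \<partial>count_space \<Lambda>)"
    unfolding sample_norm_def S_def[symmetric]
  proof (rule nn_integral_mono)
    fix l
    have "(cmod (S t' l - (S t' l - S t l)))\<^sup>2 \<le> 2 * (cmod (S t' l))\<^sup>2 + 2 * (cmod (S t' l - S t l))\<^sup>2"
      by (rule cmod_diff_sq_le)
    then have "ennreal ((cmod (S t l))\<^sup>2) \<le> ennreal (2 * (cmod (S t' l))\<^sup>2 + 2 * (cmod (S t l - S t' l))\<^sup>2)"
      by (intro ennreal_leI) (simp add: norm_minus_commute)
    then show "ennreal ((cmod (S t l))\<^sup>2) \<le> 2 * ennreal ((cmod (S t' l))\<^sup>2) + 2 * ennreal ((cmod (S t l - S t' l))\<^sup>2)"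
      by (simp add: ennreal_mult)
  qed
  also have "\<dots> = 2 * sample_norm \<Lambda> G t' c + 2 * (\<integral>\<^sup>+l. ennreal ((cmod (S t l - S t' l))\<^sup>2) \<partial>count_space \<Lambda>)"
    by (simp add: nn_integral_add nn_integral_cmult sample_norm_def S_def)
  also have "\<dots> \<le> 2 * sample_norm \<Lambda> G t' c + 2 * (ennreal ((C * \<bar>t - t'\<bar> * (2 * (sep_const a 1 + sep_const a d0)))\<^sup>2) * coeff_norm c)"
    by (intro add_left_mono mult_left_mono le) simp
  finally show ?thesis .
qed

lemma sample_norm_shift_int:
  "sample_norm \<Lambda> G (t + of_int m) c = sample_norm \<Lambda> G t (\<lambda>k. c (k - m))"
  "coeff_norm (\<lambda>k. c (k - m)) = coeff_norm c"
proof -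
  have bij: "bij_betw (\<lambda>k::int. k - m) UNIV UNIV"
    by (rule bij_betwI[where g = "\<lambda>k. k + m"]) auto
  have "(LINT k|count_space UNIV. c k * of_real (G (t + of_int m + of_int k - l))) =
     (LINT k|count_space UNIV. c (k - m) * of_real (G (t + of_int k - l)))" for l
    by (subst integral_bij_count_space[OF bij, symmetric]) simp
  then show "sample_norm \<Lambda> G (t + of_int m) c = sample_norm \<Lambda> G t (\<lambda>k. c (k - m))"
    by (simp add: sample_norm_def)
  show "coeff_norm (\<lambda>k. c (k - m)) = coeff_norm c"
    unfolding coeff_norm_def by (rule nn_integral_bij_count_space[OF bij])
qed

text \<open>The inequality is tested on step functions supported in short intervals to the right of \<open>t + \<int>\<close>.\<close>

lemma sampling_if_integrated:
  fixes \<Lambda> :: "real set"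
  assumes sep: "d0 > 0" "\<And>x y. x \<in> \<Lambda> \<Longrightarrow> y \<in> \<Lambda> \<Longrightarrow> x \<noteq> y \<Longrightarrow> d0 \<le> \<bar>x - y\<bar>"
    and G: "exp_decay a C G" and "A > 0"
    and int: "\<And>f. f \<in> borel_measurable borel \<Longrightarrow> (\<integral>\<^sup>+x. ennreal ((cmod (f x))\<^sup>2) \<partial>lborel) < \<infinity> \<Longrightarrow>
      ennreal A * (\<integral>\<^sup>+x. ennreal ((cmod (f x))\<^sup>2) \<partial>lborel) \<le> (\<integral>\<^sup>+t. sample_norm \<Lambda> G t (\<lambda>j. f (t + of_int j)) \<partial>unit_measure)"
    and fin: "finite {k. c k \<noteq> 0}"
  shows "ennreal (A / 4) * coeff_norm c \<le> sample_norm \<Lambda> G t c"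
proof -
  have C: "C > 0" "a > 0" using G by (auto simp: exp_decay_def)
  define K where "K = 2 * (sep_const a 1 + sep_const a d0)"
  have K: "K > 0" using sep_const_pos[of a 1] sep_const_pos[of a d0] C sep(1) by (simp add: K_def)
  have main: "ennreal (A / 4) * coeff_norm c \<le> sample_norm \<Lambda> G t c" if t: "0 \<le> t" "t < 1" and fin: "finite {k. c k \<noteq> 0}" for t c
  proof -
    \<comment> \<open>\<open>1 - t\<close> keeps the interval \<open>I\<close> inside
      \<open>[0, 1)\<close>. The other bound makes the perturbation error on \<open>I\<close> at
      most \<open>A / 2\<close> times \<open>coeff_norm c\<close>; the other half, divided by the
      factor 2 of \<open>sample_norm_perturb\<close>, is the final \<open>A / 4\<close>.\<close>
    define h where "h = min (1 - t) (sqrt (A / 4) / (C * K))"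
    have h: "h > 0" "h \<le> 1 - t" using t \<open>A > 0\<close> C K by (auto simp: h_def)
    have hA: "2 * (C * h * K)\<^sup>2 \<le> A / 2"
    proof -
      have "h \<le> sqrt (A / 4) / (C * K)" by (simp add: h_def)
      then have "C * h * K \<le> sqrt (A / 4)" using C K by (simp add: pos_le_divide_eq mult_ac)
      then have "(C * h * K)\<^sup>2 \<le> (sqrt (A / 4))\<^sup>2" using C K h by (intro power_mono) auto
      then show ?thesis using \<open>A > 0\<close> by simp
    qed
    define I where "I = {t..<t + h}"
    define f where "f x = (if x - of_int \<lfloor>x\<rfloor> \<in> I then c \<lfloor>x\<rfloor> else 0)" for x :: real
    have f_eq: "f (s + of_int j) = indicator I s * c j" if "0 \<le> s" "s < 1" for s j
    proof -
      have "\<lfloor>s + of_int j\<rfloor> = j" using that by (simp add: floor_eq_iff)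
      then show ?thesis by (simp add: f_def indicator_def)
    qed
    have f_meas: "f \<in> borel_measurable borel"
    proof -
      have "(\<lambda>x::real. c \<lfloor>x\<rfloor>) \<in> borel_measurable borel"
        by (rule measurable_compose[OF measurable_real_floor]) auto
      moreover have "{x::real. x - of_int \<lfloor>x\<rfloor> \<in> I} \<in> sets borel"
        unfolding I_def by measurable
      ultimately show ?thesis unfolding f_def[abs_def] by (intro measurable_If) simp_all
    qed
    have AEs: "AE s in unit_measure. 0 \<le> s \<and> s < 1" by (rule AE_unit) auto
    have emI: "(\<integral>\<^sup>+s. indicator I s \<partial>unit_measure) = ennreal h"
    proof -
      have "(\<integral>\<^sup>+s. indicator I s \<partial>unit_measure) = (\<integral>\<^sup>+s. indicator I s * indicator {0..<1} s \<partial>lborel)"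
        by (rule nn_integral_unit) (simp add: I_def)
      also have "\<dots> = (\<integral>\<^sup>+s. indicator I s \<partial>lborel)"
        using t h by (intro nn_integral_cong) (auto simp: I_def indicator_def)
      also have "\<dots> = ennreal h" using h by (simp add: I_def)
      finally show ?thesis .
    qed
    have I_meas [measurable]: "I \<in> sets borel" by (simp add: I_def)
    have "(\<integral>\<^sup>+x. ennreal ((cmod (f x))\<^sup>2) \<partial>lborel) = (\<integral>\<^sup>+s. (\<integral>\<^sup>+j. ennreal ((cmod (f (s + real_of_int j)))\<^sup>2) \<partial>count_space UNIV) \<partial>unit_measure)"
      by (rule nn_integral_periodize) (use f_meas in measurable)
    also have "\<dots> = (\<integral>\<^sup>+s. indicator I s * coeff_norm c \<partial>unit_measure)"
    proof (rule nn_integral_cong_AE, use AEs in eventually_elim)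
      case (elim s)
      have "(\<integral>\<^sup>+j. ennreal ((cmod (f (s + real_of_int j)))\<^sup>2) \<partial>count_space UNIV) = (\<integral>\<^sup>+j. ennreal ((cmod (indicator I s * c j))\<^sup>2) \<partial>count_space UNIV)"
        using elim by (simp add: f_eq)
      also have "\<dots> = indicator I s * coeff_norm c"
        by (auto simp: indicator_def coeff_norm_def)
      finally show ?case .
    qed
    also have "\<dots> = ennreal h * coeff_norm c"
      unfolding emI[symmetric] by (rule nn_integral_multc) simp
    finally have nf: "(\<integral>\<^sup>+x. ennreal ((cmod (f x))\<^sup>2) \<partial>lborel) = ennreal h * coeff_norm c" .
    have X: "coeff_norm c = ennreal (\<Sum>k | c k \<noteq> 0. (cmod (c k))\<^sup>2)"
      unfolding coeff_norm_def by (subst nn_integral_count_space'[OF fin]) auto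
    define x where "x = (\<Sum>k | c k \<noteq> 0. (cmod (c k))\<^sup>2)"
    have x: "coeff_norm c = ennreal x" "x \<ge> 0" unfolding X x_def by (auto intro: sum_nonneg)
    have "ennreal A * (ennreal h * coeff_norm c) \<le> (\<integral>\<^sup>+s. sample_norm \<Lambda> G s (\<lambda>j. f (s + of_int j)) \<partial>unit_measure)"
      unfolding nf[symmetric] by (rule int[OF f_meas]) (simp add: nf x ennreal_mult_less_top)
    also have "\<dots> \<le> (\<integral>\<^sup>+s. indicator I s * (2 * sample_norm \<Lambda> G t c + 2 * (ennreal ((C * h * K)\<^sup>2) * coeff_norm c)) \<partial>unit_measure)"
    proof (rule nn_integral_mono_AE, use AEs in eventually_elim)
      case (elim s)
      show ?case
      proof (cases "s \<in> I")
        case True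
        have "sample_norm \<Lambda> G s (\<lambda>j. f (s + of_int j)) = sample_norm \<Lambda> G s c"
          using elim True by (simp add: f_eq)
        also have "\<dots> \<le> 2 * sample_norm \<Lambda> G t c + 2 * (ennreal ((C * \<bar>s - t\<bar> * K)\<^sup>2) * coeff_norm c)"
          unfolding K_def by (rule sample_norm_perturb[OF sep G fin])
        also have "\<dots> \<le> 2 * sample_norm \<Lambda> G t c + 2 * (ennreal ((C * h * K)\<^sup>2) * coeff_norm c)"
        proof (intro add_left_mono mult_left_mono mult_right_mono ennreal_leI power_mono)
          show "\<bar>s - t\<bar> \<le> h" using True by (auto simp: I_def)
        qed (use C K in auto)
        finally show ?thesis using True by simp
      next
        case False
        then show ?thesis using elim by (simp add: f_eq sample_norm_def)
      qed
    qed
    also have "\<dots> = ennreal h * (2 * sample_norm \<Lambda> G t c + 2 * (ennreal ((C * h * K)\<^sup>2) * coeff_norm c))"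
      unfolding emI[symmetric] by (rule nn_integral_multc) simp
    finally have ineq: "ennreal A * (ennreal h * coeff_norm c) \<le> ennreal h * (2 * sample_norm \<Lambda> G t c + 2 * (ennreal ((C * h * K)\<^sup>2) * coeff_norm c))" .
    show ?thesis
    proof (cases "sample_norm \<Lambda> G t c")
      case (real y)
      have "ennreal h * (2 * sample_norm \<Lambda> G t c + 2 * (ennreal ((C * h * K)\<^sup>2) * coeff_norm c)) = ennreal (h * (2 * y + 2 * ((C * h * K)\<^sup>2 * x)))"
        using real x h by (simp add: ennreal_mult ennreal_plus)
      moreover have "ennreal A * (ennreal h * coeff_norm c) = ennreal (A * (h * x))"
        using \<open>A > 0\<close> x h by (simp add: ennreal_mult)
      moreover have "h * (2 * y + 2 * ((C * h * K)\<^sup>2 * x)) \<ge> 0" using real x h by simp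
      ultimately have "A * (h * x) \<le> h * (2 * y + 2 * ((C * h * K)\<^sup>2 * x))" using ineq by simp
      then have "h * (A * x) \<le> h * (2 * y + 2 * ((C * h * K)\<^sup>2 * x))" by (simp add: mult_ac)
      then have "A * x \<le> 2 * y + 2 * ((C * h * K)\<^sup>2 * x)" using h by (simp only: mult_le_cancel_left_pos)
      also have "2 * ((C * h * K)\<^sup>2 * x) \<le> A / 2 * x" using mult_right_mono[OF hA x(2)] by simp
      finally have "A / 4 * x \<le> y" by simp
      then have "ennreal (A / 4 * x) \<le> ennreal y" by (rule ennreal_leI)
      moreover have "ennreal (A / 4 * x) = ennreal (A / 4) * ennreal x" using \<open>A > 0\<close> x by (intro ennreal_mult) auto
      ultimately show ?thesis using real x by (simp only:)
    qed simp
  qed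
  define m where "m = \<lfloor>t\<rfloor>"
  have tm: "t = (t - of_int m) + of_int m" "0 \<le> t - of_int m" "t - of_int m < 1"
    unfolding m_def by linarith+
  have fin': "finite {k. c (k - m) \<noteq> 0}"
    using finite_vimageI[OF fin, of "\<lambda>k. k - m"] by (simp add: inj_on_def vimage_def)
  have "ennreal (A / 4) * coeff_norm (\<lambda>k. c (k - m)) \<le> sample_norm \<Lambda> G (t - of_int m) (\<lambda>k. c (k - m))"
    by (rule main[OF tm(2,3) fin'])
  also have "\<dots> = sample_norm \<Lambda> G t c"
    by (subst (2) tm(1)) (rule sample_norm_shift_int(1)[symmetric])
  finally show ?thesis by (simp only: sample_norm_shift_int(2))
qed

section \<open>Borel representatives of Lebesgue measurable functions\<close>

lemma AE_lebesgue_translate: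
  fixes P :: "real \<Rightarrow> bool"
  assumes "AE x in lebesgue. P x"
  shows "AE x in lebesgue. P (x - \<mu>)"
proof -
  obtain N where N: "N \<in> null_sets lebesgue" "{x. \<not> P x} \<subseteq> N"
    using assms by (auto simp: eventually_ae_filter)
  then have "negligible N" by (simp add: negligible_iff_null_sets)
  then have "(+) \<mu> ` N \<in> null_sets lebesgue" by (simp add: negligible_translation flip: negligible_iff_null_sets)
  moreover have "{x \<in> space lebesgue. \<not> P (x - \<mu>)} \<subseteq> (+) \<mu> ` N"
  proof
    fix x assume "x \<in> {x \<in> space lebesgue. \<not> P (x - \<mu>)}"
    then have "x - \<mu> \<in> N" using N(2) by auto
    then show "x \<in> (+) \<mu> ` N" by (intro image_eqI[of _ _ "x - \<mu>"]) auto
  qed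
  ultimately show ?thesis by (rule AE_I')
qed

lemma borel_measurable_lebesgue_AE_cong:
  fixes f g :: "real \<Rightarrow> complex"
  assumes "g \<in> borel_measurable borel" "AE x in lebesgue. f x = g x"
  shows "f \<in> borel_measurable lebesgue"
proof -
  obtain N where N: "N \<in> null_sets lebesgue" "{x. f x \<noteq> g x} \<subseteq> N"
    using assms(2) by (auto simp: eventually_ae_filter)
  have g: "g \<in> borel_measurable lebesgue" using assms(1) by (auto intro: measurable_completion)
  show ?thesis
  proof (rule measurableI)
    fix B :: "complex set" assume "B \<in> sets borel"
    then have "g -` B \<inter> space lebesgue \<in> sets lebesgue" using g by (rule measurable_sets[rotated])
    moreover have "N \<in> sets lebesgue" using N(1) by auto
    moreover have "f -` B \<inter> N \<in> sets lebesgue"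
    proof -
      have "negligible N" using N(1) by (simp only: negligible_iff_null_sets)
      then have "negligible (f -` B \<inter> N)" by (rule negligible_subset) blast
      then have "f -` B \<inter> N \<in> null_sets lebesgue" by (simp only: negligible_iff_null_sets)
      then show ?thesis by (rule null_setsD2)
    qed
    ultimately have "(g -` B \<inter> space lebesgue - N) \<union> (f -` B \<inter> N) \<in> sets lebesgue"
      by (intro sets.Un sets.Diff)
    moreover have "f -` B \<inter> space lebesgue = (g -` B \<inter> space lebesgue - N) \<union> (f -` B \<inter> N)"
      using N(2) by auto
    ultimately show "f -` B \<inter> space lebesgue \<in> sets lebesgue" by (simp only:)
  qed simp
qed

lemma L2_borel_version:
  assumes f: "f \<in> L2" and f': "f' \<in> borel_measurable borel" "AE x in lebesgue. f x = f' x"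
  shows "(\<integral>\<^sup>+x. ennreal ((cmod (f' x))\<^sup>2) \<partial>lborel) = ennreal ((L2_norm f)\<^sup>2)"
proof -
  have int: "integrable lebesgue (\<lambda>x. (cmod (f x))\<^sup>2)" using f by (simp add: L2_def)
  have "(L2_norm f)\<^sup>2 = (LINT x|lebesgue. (cmod (f x))\<^sup>2)"
    unfolding L2_norm_def by (rule real_sqrt_pow2) (intro Bochner_Integration.integral_nonneg, simp)
  then have "ennreal ((L2_norm f)\<^sup>2) = (\<integral>\<^sup>+x. ennreal ((cmod (f x))\<^sup>2) \<partial>lebesgue)"
    using nn_integral_eq_integral[OF int] by simp
  also have "\<dots> = (\<integral>\<^sup>+x. ennreal ((cmod (f' x))\<^sup>2) \<partial>lebesgue)"
    by (rule nn_integral_cong_AE) (use f'(2) in eventually_elim, simp)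
  also have "\<dots> = (\<integral>\<^sup>+x. ennreal ((cmod (f' x))\<^sup>2) \<partial>lborel)" by (rule nn_integral_completion)
  finally show ?thesis by simp
qed

lemma L2_inner_kernel:
  assumes f: "f \<in> L2" and f': "f' \<in> borel_measurable borel" "AE x in lebesgue. f x = f' x"
    and G: "G \<in> borel_measurable borel" and g: "AE x in lebesgue. g x = complex_of_real (G x)"
  shows "L2_inner f (modulation \<nu> (translation \<mu> g)) =
    (LINT x|lborel. f' x * cnj (modulation \<nu> (translation \<mu> (\<lambda>x. of_real (G x))) x))"
proof -
  let ?m = "modulation \<nu> (translation \<mu> (\<lambda>x. complex_of_real (G x)))"
  have "AE x in lebesgue. g (x - \<mu>) = complex_of_real (G (x - \<mu>))"
    using AE_lebesgue_translate[OF g] .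
  then have ae: "AE x in lebesgue. modulation \<nu> (translation \<mu> g) x = ?m x"
    by eventually_elim (simp add: modulation_def translation_def)
  have e: "(\<lambda>t. exp (2 * complex_of_real pi * \<i> * of_real \<nu> * of_real t)) \<in> borel_measurable borel"
    by (intro borel_measurable_continuous_onI continuous_intros)
  have m: "?m \<in> borel_measurable borel"
    unfolding modulation_def translation_def using G e by measurable
  have meas: "(\<lambda>x. f' x * cnj (?m x)) \<in> borel_measurable borel"
  proof -
    have "(\<lambda>x. cnj (?m x)) \<in> borel_measurable borel"
      using m by (rule measurable_compose) (intro borel_measurable_continuous_onI continuous_intros)
    then show ?thesis using f'(1) by measurable
  qed
  have ae2: "AE x in lebesgue. f x * cnj (modulation \<nu> (translation \<mu> g) x) = f' x * cnj (?m x)"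
    using ae f'(2) by eventually_elim simp
  have "L2_inner f (modulation \<nu> (translation \<mu> g)) = (LINT x|lebesgue. f' x * cnj (?m x))"
    unfolding L2_inner_def
    by (rule integral_cong_AE[OF borel_measurable_lebesgue_AE_cong[OF meas ae2] _ ae2])
      (use meas in \<open>auto intro: measurable_completion\<close>)
  also have "\<dots> = (LINT x|lborel. f' x * cnj (?m x))"
    using meas by (intro integral_completion) simp
  finally show ?thesis .
qed

theorem theorem1p4:
  fixes g :: "real \<Rightarrow> complex" and \<Lambda> :: "real set"
  assumes "totally_positive_gaussian_type g"
    and "separated_set \<Lambda>"
  shows "gabor_frame g (\<Lambda> \<times> \<int>) \<longleftrightarrow> lower_beurling_density \<Lambda> > 1"
proof -
  obtain \<gamma> ds where \<gamma>: "\<gamma> > 0" and g: "AE x in lebesgue. g x = complex_of_real (tp_kernel \<gamma> ds x)"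
    using totally_positive_gaussian_type_kernel[OF assms(1)] by blast
  define G where "G = tp_kernel \<gamma> ds"
  obtain a where a: "a > 0" "\<forall>\<delta>\<in>set ds. a * \<bar>\<delta>\<bar> \<le> 1 / 2" using exists_decay_rate by blast
  obtain C where G: "exp_decay a C G"
    unfolding G_def using exp_decay_tp_kernel[OF \<gamma> a] by blast
  have G_meas [measurable]: "G \<in> borel_measurable borel"
    by (rule borel_measurable_continuous_onI[OF exp_decay_continuous[OF G]])
  obtain d0 where sep: "d0 > 0" "\<And>x y. x \<in> \<Lambda> \<Longrightarrow> y \<in> \<Lambda> \<Longrightarrow> x \<noteq> y \<Longrightarrow> d0 \<le> \<bar>x - y\<bar>"
    using assms(2) unfolding separated_set_iff_uniform_discrete uniform_discrete_def dist_real_def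
    by (metis linorder_not_le)
  have \<Lambda>: "countable \<Lambda>" by (rule separated_countable[OF sep])
  have g_meas: "g \<in> borel_measurable lebesgue"
    using assms(1) by (auto simp: totally_positive_gaussian_type_def)
  \<comment> \<open>Here \<open>f'\<close> is any Borel representative of \<open>f\<close>:
    periodization works with Borel functions, the frame condition with Lebesgue measurable
    ones.\<close>
  have gabor_sum: "(\<Sum>\<^sub>\<infinity>(\<mu>, \<nu>)\<in>\<Lambda> \<times> \<int>. ennreal ((cmod (L2_inner f (modulation \<nu> (translation \<mu> g))))\<^sup>2))
      = (\<integral>\<^sup>+t. sample_norm \<Lambda> G t (\<lambda>j. f' (t + of_int j)) \<partial>unit_measure)"
    if f: "f \<in> L2" and f': "f' \<in> borel_measurable borel" "AE x in lebesgue. f x = f' x" for f f'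
    unfolding L2_inner_kernel[OF f f' G_meas g[folded G_def]]
    by (rule gabor_sum_eq[OF \<Lambda> G f'(1)]) (simp add: L2_borel_version[OF f f'])
  show ?thesis
  proof
    assume "gabor_frame g (\<Lambda> \<times> \<int>)"
    then obtain A where A: "A > 0" and frame: "\<And>f. f \<in> L2 \<Longrightarrow> ennreal (A * (L2_norm f)\<^sup>2)
        \<le> (\<Sum>\<^sub>\<infinity>(\<mu>, \<nu>)\<in>\<Lambda> \<times> \<int>. ennreal ((cmod (L2_inner f (modulation \<nu> (translation \<mu> g))))\<^sup>2))"
      unfolding gabor_frame_def by blast
    have int: "ennreal A * (\<integral>\<^sup>+x. ennreal ((cmod (f x))\<^sup>2) \<partial>lborel) \<le> (\<integral>\<^sup>+t. sample_norm \<Lambda> G t (\<lambda>j. f (t + of_int j)) \<partial>unit_measure)"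
      if f: "f \<in> borel_measurable borel" and fin: "(\<integral>\<^sup>+x. ennreal ((cmod (f x))\<^sup>2) \<partial>lborel) < \<infinity>" for f
    proof -
      have "f \<in> borel_measurable lebesgue" using f by (auto intro: measurable_completion)
      moreover have "integrable lebesgue (\<lambda>x. (cmod (f x))\<^sup>2)"
        by (rule integrableI_bounded) (use calculation fin in \<open>auto simp: nn_integral_completion\<close>)
      ultimately have L2: "f \<in> L2" by (simp add: L2_def)
      have ae: "AE x in lebesgue. f x = f x" by simp
      show ?thesis
        using frame[OF L2] A unfolding gabor_sum[OF L2 f ae] L2_borel_version[OF L2 f ae]
        by (simp add: ennreal_mult)
    qed
    have samp: "ennreal (A / 4) * coeff_norm c \<le> sample_norm \<Lambda> G t c" if "finite {k. c k \<noteq> 0}" for t c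
      by (rule sampling_if_integrated[OF sep G A int that])
    have A4: "0 < A / 4" using \<open>A > 0\<close> by (intro divide_pos_pos) simp_all
    show "lower_beurling_density \<Lambda> > 1"
      by (rule dense_if_sampling[OF sep G A4 samp])
  next
    assume dens: "lower_beurling_density \<Lambda> > 1"
    obtain A where A: "A > 0" and low: "\<And>t c. coeff_norm c < \<infinity> \<Longrightarrow> ennreal A * coeff_norm c \<le> sample_norm \<Lambda> G t c"
      unfolding G_def using sampling_if_dense[OF sep dens \<gamma>] by blast
    define B where "B = (C * (2 * (sep_const a 1 + sep_const a d0)))\<^sup>2"
    have B: "B > 0"
      using G a(1) sep(1) sep_const_pos[of a 1] sep_const_pos[of a d0] by (auto simp: B_def exp_decay_def)
    have up: "sample_norm \<Lambda> G t c \<le> ennreal B * coeff_norm c" for t c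
      unfolding B_def by (rule sample_norm_upper[OF sep G])
    have "g \<in> L2"
    proof -
      have "(\<integral>\<^sup>+x. ennreal ((cmod (g x))\<^sup>2) \<partial>lebesgue) = (\<integral>\<^sup>+x. ennreal ((G (x - 0))\<^sup>2) \<partial>lebesgue)"
        by (rule nn_integral_cong_AE) (use g in eventually_elim, simp add: G_def)
      also have "\<dots> < \<infinity>"
        unfolding nn_integral_completion by (rule exp_decay_sq_integral[OF G])
      finally have "integrable lebesgue (\<lambda>x. (cmod (g x))\<^sup>2)"
        using g_meas by (intro integrableI_bounded) auto
      then show ?thesis using g_meas by (simp add: L2_def)
    qed
    moreover have "ennreal (A * (L2_norm f)\<^sup>2) \<le> (\<Sum>\<^sub>\<infinity>(\<mu>, \<nu>)\<in>\<Lambda> \<times> \<int>. ennreal ((cmod (L2_inner f (modulation \<nu> (translation \<mu> g))))\<^sup>2)) \<and>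
       (\<Sum>\<^sub>\<infinity>(\<mu>, \<nu>)\<in>\<Lambda> \<times> \<int>. ennreal ((cmod (L2_inner f (modulation \<nu> (translation \<mu> g))))\<^sup>2)) \<le> ennreal (B * (L2_norm f)\<^sup>2)"
      if f: "f \<in> L2" for f
    proof -
      have "f \<in> borel_measurable lebesgue" using f by (simp add: L2_def)
      from borel_version[OF this] obtain f' where f': "f' \<in> borel_measurable borel" "AE x in lebesgue. f x = f' x" ..
      note [measurable] = f'(1)
      define cn where "cn t = coeff_norm (\<lambda>j. f' (t + of_int j))" for t
      have cn_meas [measurable]: "cn \<in> borel_measurable unit_measure"
      proof -
        have "(\<lambda>t. \<integral>\<^sup>+j. ennreal ((cmod (f' (fst (t, j) + real_of_int (snd (t, j)))))\<^sup>2) \<partial>count_space UNIV) \<in> borel_measurable unit_measure"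
          by (rule count_int.borel_measurable_nn_integral) measurable
        then show ?thesis by (simp add: cn_def[abs_def] coeff_norm_def)
      qed
      have cn: "(\<integral>\<^sup>+t. cn t \<partial>unit_measure) = ennreal ((L2_norm f)\<^sup>2)"
        unfolding cn_def coeff_norm_def L2_borel_version[OF f f', symmetric]
        by (rule nn_integral_periodize[symmetric]) measurable
      \<comment> \<open>The bound \<open>low\<close> asks for a finite coefficient norm. It is
        finite for almost every \<open>t\<close>, because the integral of \<open>cn\<close> is the
        squared norm of \<open>f\<close>.\<close>
      have "AE t in unit_measure. cn t \<noteq> \<infinity>"
        by (rule nn_integral_PInf_AE[OF cn_meas]) (simp add: cn)
      then have "AE t in unit_measure. ennreal A * cn t \<le> sample_norm \<Lambda> G t (\<lambda>j. f' (t + of_int j))"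
        by eventually_elim (auto simp: cn_def less_top intro: low)
      then have "(\<integral>\<^sup>+t. ennreal A * cn t \<partial>unit_measure) \<le> (\<integral>\<^sup>+t. sample_norm \<Lambda> G t (\<lambda>j. f' (t + of_int j)) \<partial>unit_measure)"
        by (rule nn_integral_mono_AE)
      moreover have "(\<integral>\<^sup>+t. sample_norm \<Lambda> G t (\<lambda>j. f' (t + of_int j)) \<partial>unit_measure) \<le> (\<integral>\<^sup>+t. ennreal B * cn t \<partial>unit_measure)"
        unfolding cn_def by (intro nn_integral_mono up)
      ultimately show ?thesis
        unfolding gabor_sum[OF f f'] nn_integral_cmult[OF cn_meas] cn
        using A B by (simp add: ennreal_mult)
    qed
    ultimately show "gabor_frame g (\<Lambda> \<times> \<int>)"
      unfolding gabor_frame_def using A B by blast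
  qed
qed

end
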